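(* Let $d\ge2$, $1\le k\le M$, $\mathcal H\cong\mathbb C^d$, and let $\mathcal E:\mathsf{Lin}(\mathcal H_{in})\to\mathsf{Lin}(\mathcal H^{\otimes M})$ be a symmetric broadcast channel. Then there is a measure-and-prepare channel of the form $\widetilde{\mathcal E}(\rho)=\int\mathrm{Tr}[Q_x\rho]\,\rho_x^{\otimes M}\,\mu(dx)$, with $Q_x\,\mu(dx)$ a POVM on $\mathcal H_{in}$ and each $\rho_x$ a density operator on $\mathcal H$, such that $$\big\|\widetilde{\mathcal E}^{(k)}-\mathcal E^{(k)}\big\|_\diamond\le4\left(1-\sqrt{\frac{D^{(M-k)}_+}{D^{(M)}_+}}\right)\le\frac{2kd^2}{M},\qquad D^{(n)}_+=\binom{d^2+n-1}{n},$$ where $\widetilde{\mathcal E}^{(k)}=\mathrm{Tr}_{M-k}\circ\widetilde{\mathcal E}$ and $\mathcal E^{(k)}=\mathrm{Tr}_{M-k}\circ\mathcal E$.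
   Context: $\mathcal H_{in}$ is a finite-dimensional Hilbert space. A channel is a completely positive trace-preserving map. A channel $\mathcal E:\mathsf{Lin}(\mathcal H_{in})\to\mathsf{Lin}(\mathcal H^{\otimes M})$ is a symmetric broadcast channel if $U^{(M)}_\pi\mathcal E(\rho)U^{(M)\dagger}_\pi=\mathcal E(\rho)$ for all $\rho$ and all $\pi\in S_M$, where $U^{(M)}_\pi$ permutes the tensor factors. $\mathrm{Tr}_{M-k}$ is the partial trace over $M-k$ of the $M$ factors. The diamond norm of a Hermitian-preserving map $\Delta$ is $\|\Delta\|_\diamond=\sup_{\mathcal H_A}\sup_{\|\Psi\|=1}\|(\mathcal I_A\otimes\Delta)(|\Psi\rangle\langle\Psi|)\|_1$, with $\|A\|_1=\mathrm{Tr}|A|$. *)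

theory Defs
  imports "Jordan_Normal_Form.Matrix" "HOL-Analysis.Bochner_Integration"
begin

text \<open>An operator on C^n is an n x n complex matrix. The tensor product of
spaces is realised by the Kronecker product, with the index of the left factor
most significant. H^{tensor M} with H = C^d therefore has dimension d^M.\<close>

definition adj :: "complex mat \<Rightarrow> complex mat" where
  "adj A = Matrix.mat (dim_col A) (dim_row A) (\<lambda>(i,j). cnj (A $$ (j,i)))"

definition mtrace :: "complex mat \<Rightarrow> complex" where
  "mtrace A = (\<Sum>i<dim_row A. A $$ (i,i))"

definition psd :: "nat \<Rightarrow> complex mat \<Rightarrow> bool" where
  "psd n A \<longleftrightarrow> A \<in> carrier_mat n n \<and>
     (\<forall>v \<in> carrier_vec n. Im (v \<bullet>c (A *\<^sub>v v)) = 0 \<and> 0 \<le> Re (v \<bullet>c (A *\<^sub>v v)))"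

definition density_op :: "nat \<Rightarrow> complex mat \<Rightarrow> bool" where
  "density_op n A \<longleftrightarrow> psd n A \<and> mtrace A = 1"

definition mat_abs :: "complex mat \<Rightarrow> complex mat" where
  "mat_abs A = (THE B. psd (dim_col A) B \<and> B * B = adj A * A)"

definition trace_norm :: "complex mat \<Rightarrow> real" where
  "trace_norm A = Re (mtrace (mat_abs A))"

definition kron :: "complex mat \<Rightarrow> complex mat \<Rightarrow> complex mat" where
  "kron A B = Matrix.mat (dim_row A * dim_row B) (dim_col A * dim_col B)
     (\<lambda>(i,j). A $$ (i div dim_row B, j div dim_col B) * B $$ (i mod dim_row B, j mod dim_col B))"

fun tensor_pow :: "complex mat \<Rightarrow> nat \<Rightarrow> complex mat" where
  "tensor_pow A 0 = 1\<^sub>m 1"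
| "tensor_pow A (Suc n) = kron A (tensor_pow A n)"

text \<open>Permutation of the M tensor factors of (C^d)^{tensor M}: the j-th factor
is the digit (i div d^j) mod d of the index i.\<close>
definition digit :: "nat \<Rightarrow> nat \<Rightarrow> nat \<Rightarrow> nat" where
  "digit d i m = (i div d ^ m) mod d"

definition perm_op :: "nat \<Rightarrow> nat \<Rightarrow> (nat \<Rightarrow> nat) \<Rightarrow> complex mat" where
  "perm_op d M \<pi> = Matrix.mat (d ^ M) (d ^ M)
     (\<lambda>(i,j). if (\<forall>m<M. digit d i m = digit d j (\<pi> m)) then 1 else 0)"

text \<open>Partial trace over the last M - k of the M factors (the least significant
digits) of an operator on (C^d)^{tensor M}.\<close>
definition ptrace :: "nat \<Rightarrow> nat \<Rightarrow> nat \<Rightarrow> complex mat \<Rightarrow> complex mat" where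
  "ptrace d M k X = Matrix.mat (d ^ k) (d ^ k)
     (\<lambda>(i,j). \<Sum>l<d ^ (M - k). X $$ (i * d ^ (M - k) + l, j * d ^ (M - k) + l))"

text \<open>id_n tensor Phi, for Phi : Lin(C^din) -> Lin(C^dout), ancilla as left factor.\<close>
definition ext_map :: "nat \<Rightarrow> nat \<Rightarrow> nat \<Rightarrow> (complex mat \<Rightarrow> complex mat) \<Rightarrow> complex mat \<Rightarrow> complex mat" where
  "ext_map n din dout \<Phi> X = Matrix.mat (n * dout) (n * dout)
     (\<lambda>(i,j). \<Phi> (Matrix.mat din din (\<lambda>(p,q). X $$ ((i div dout) * din + p, (j div dout) * din + q)))
              $$ (i mod dout, j mod dout))"

definition linear_map :: "nat \<Rightarrow> nat \<Rightarrow> (complex mat \<Rightarrow> complex mat) \<Rightarrow> bool" where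
  "linear_map din dout \<Phi> \<longleftrightarrow>
     (\<forall>A \<in> carrier_mat din din. \<Phi> A \<in> carrier_mat dout dout) \<and>
     (\<forall>A \<in> carrier_mat din din. \<forall>B \<in> carrier_mat din din. \<Phi> (A + B) = \<Phi> A + \<Phi> B) \<and>
     (\<forall>A \<in> carrier_mat din din. \<forall>c. \<Phi> (c \<cdot>\<^sub>m A) = c \<cdot>\<^sub>m \<Phi> A)"

definition channel :: "nat \<Rightarrow> nat \<Rightarrow> (complex mat \<Rightarrow> complex mat) \<Rightarrow> bool" where
  "channel din dout \<Phi> \<longleftrightarrow> linear_map din dout \<Phi> \<and>
     (\<forall>A \<in> carrier_mat din din. mtrace (\<Phi> A) = mtrace A) \<and>
     (\<forall>n. \<forall>X. psd (n * din) X \<longrightarrow> psd (n * dout) (ext_map n din dout \<Phi> X))"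

text \<open>Diamond norm of a (Hermitian-preserving) map, as a supremum over all finite
ancilla dimensions n and unit vectors psi in C^n tensor C^din.\<close>
definition diamond_norm :: "nat \<Rightarrow> nat \<Rightarrow> (complex mat \<Rightarrow> complex mat) \<Rightarrow> real" where
  "diamond_norm din dout \<Delta> = Sup (insert 0 {trace_norm (ext_map n din dout \<Delta> (Matrix.mat (n*din) (n*din) (\<lambda>(i,j). Matrix.vec_index \<psi> i * cnj (Matrix.vec_index \<psi> j))))
      | n \<psi>. \<psi> \<in> carrier_vec (n * din) \<and> (\<Sum>i<n * din. (cmod (Matrix.vec_index \<psi> i))\<^sup>2) = 1})"

definition sym_broadcast :: "nat \<Rightarrow> nat \<Rightarrow> nat \<Rightarrow> (complex mat \<Rightarrow> complex mat) \<Rightarrow> bool" where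
  "sym_broadcast din d M \<E> \<longleftrightarrow> channel din (d ^ M) \<E> \<and>
     (\<forall>\<rho> \<in> carrier_mat din din. \<forall>\<pi>. \<pi> permutes {..<M} \<longrightarrow>
        perm_op d M \<pi> * \<E> \<rho> * adj (perm_op d M \<pi>) = \<E> \<rho>)"

definition povm :: "nat \<Rightarrow> complex mat measure \<Rightarrow> (complex mat \<Rightarrow> complex mat) \<Rightarrow> bool" where
  "povm din \<mu> Q \<longleftrightarrow> (\<forall>x \<in> space \<mu>. psd din (Q x)) \<and>
     (\<forall>i<din. \<forall>j<din. integrable \<mu> (\<lambda>x. Q x $$ (i,j))) \<and>
     Matrix.mat din din (\<lambda>(i,j). integral\<^sup>L \<mu> (\<lambda>x. Q x $$ (i,j))) = 1\<^sub>m din"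

definition meas_prep :: "nat \<Rightarrow> nat \<Rightarrow> complex mat measure \<Rightarrow> (complex mat \<Rightarrow> complex mat)
    \<Rightarrow> (complex mat \<Rightarrow> complex mat) \<Rightarrow> complex mat \<Rightarrow> complex mat" where
  "meas_prep d M \<mu> Q \<sigma> \<rho> = Matrix.mat (d ^ M) (d ^ M)
     (\<lambda>(i,j). integral\<^sup>L \<mu> (\<lambda>x. mtrace (Q x * \<rho>) * tensor_pow (\<sigma> x) M $$ (i,j)))"

definition Dplus :: "nat \<Rightarrow> nat \<Rightarrow> real" where
  "Dplus d n = real ((d\<^sup>2 + n - 1) choose n)"

end

theory Submission
  imports Defs "Jordan_Normal_Form.Spectral_Radius" "HOL-Probability.Probability"
    "HOL-Combinatorics.Multiset_Permutations"
begin

text \<open>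
  The positive square root of the Choi operator of \<open>\<E>\<close> is unique, hence commutes with the
  permutations of the \<open>M\<close> factors; read as a vector it purifies the channel output inside the
  symmetric subspace of \<open>(H \<otimes> K)\<^bsup>\<otimes>M\<^esup>\<close> with \<open>K = H\<close>, where \<open>H \<otimes> K\<close> has dimension \<open>d\<^sup>2\<close>.
  The channel \<open>\<E>'\<close> measures the coherent states \<open>x\<^bsup>\<otimes>M\<^esup>\<close> on this purification and prepares the
  state of \<open>H\<close> obtained from \<open>x\<close> by tracing out \<open>K\<close>. The unnormalised vector \<open>x\<close> is distributed such
  that all moments of degree at most \<open>M\<close> are those of a complex Gaussian, which is all that is used
  of the unitarily invariant measure.

  Let \<open>t = D\<^sub>+(M-k) / D\<^sub>+(M)\<close> and \<open>s = 1 / sqrt t\<close>. With \<open>v\<^sub>x\<close> the partial overlap of the purified output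
  with \<open>x\<^bsup>\<otimes>(M-k)\<^esup>\<close> and \<open>P\<^sub>x\<close> the projection onto \<open>x\<^bsup>\<otimes>k\<^esup>\<close>, integrating the positive operator
  \<open>(1 - s P\<^sub>x) v\<^sub>x v\<^sub>x\<^sup>* (1 - s P\<^sub>x)\<close> shows that the marginals satisfy \<open>\<E>' \<ge> (2 sqrt t - 1) \<E>\<close> in the
  completely positive order. Both maps preserve the trace, so their difference is a difference of
  positive parts of trace \<open>2 (1 - sqrt t)\<close> each.
\<close>

hide_const (open) Finite_Cartesian_Product.mat Finite_Cartesian_Product.vec
hide_type (open) Finite_Cartesian_Product.vec

section \<open>Spectral theory of positive matrices\<close>

text \<open>Normalising the prepared state divides by \<open>norm_sq d x ^ k\<close>, so the form of
  \<E>' is the integral of a rational function of x without an evident closed value. Completing the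
  square keeps this quotient in the one term that is to be bounded from below; the other terms are
  polynomial moments and exact. The ratio t arises there: weighting words of length M - k with
  \<open>norm_sq d x ^ k\<close> produces (M-k)! times a rising factorial from d^2 + M - k, and that
  equals M! / t. A general s > 0 yields \<E>' \<ge> (2/s - 1/(t s^2)) \<E>; the choice s = 1 / sqrt
  t gives the coefficient 2 sqrt t - 1 that matches the bound 4 (1 - sqrt t). Tensors over H
  \<otimes> K are functions on words of index pairs, symmetry meaning that the value depends on the
  multiset of letters only, and operator inequalities are tested on vectors, so that only scalar
  functions get integrated. The purification also carries a copy of the input space, whose index r
  is merely summed over.\<close>

lemma adj_carrier [simp]: "A \<in> carrier_mat n m \<Longrightarrow> adj A \<in> carrier_mat m n"
  by (auto simp: adj_def)

lemma adj_index [simp]: "i < dim_col A \<Longrightarrow> j < dim_row A \<Longrightarrow> adj A $$ (i, j) = cnj (A $$ (j, i))"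
  by (simp add: adj_def)

lemma adj_dim [simp]: "dim_row (adj A) = dim_col A" "dim_col (adj A) = dim_row A"
  by (simp_all add: adj_def)

lemma adj_adj [simp]: "adj (adj A) = A"
  by (auto simp: adj_def)

lemma mult_index:
  assumes "A \<in> carrier_mat n m" "B \<in> carrier_mat m p" "i < n" "j < p"
  shows "(A * B) $$ (i, j) = (\<Sum>k<m. A $$ (i, k) * B $$ (k, j))"
  using assms by (auto simp: scalar_prod_def lessThan_atLeast0 intro!: sum.cong)

lemma adj_mult:
  assumes "A \<in> carrier_mat n m" "B \<in> carrier_mat m p"
  shows "adj (A * B) = adj B * adj A"
proof (rule eq_matI)
  fix i j assume "i < dim_row (adj B * adj A)" "j < dim_col (adj B * adj A)"
  then have ij: "i < p" "j < n" using assms by auto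
  then show "adj (A * B) $$ (i, j) = (adj B * adj A) $$ (i, j)"
    using assms mult_index[OF assms, of j i] mult_index[of "adj B" p m "adj A" n i j]
    by (auto simp: mult.commute intro!: sum.cong)
qed (use assms in auto)

definition qform :: "nat \<Rightarrow> complex mat \<Rightarrow> (nat \<Rightarrow> complex) \<Rightarrow> complex" where
  "qform n A v = (\<Sum>i<n. \<Sum>j<n. cnj (v i) * A $$ (i, j) * v j)"

text \<open>\<open>\<bullet>c\<close> conjugates its second argument, so \<open>psd\<close> speaks
  of the conjugate of \<open>qform\<close>; being real and nonnegative, which the complex order
  expresses at once, is unaffected.\<close>

lemma psd_iff_qform: "psd n A \<longleftrightarrow> A \<in> carrier_mat n n \<and> (\<forall>v. 0 \<le> qform n A v)"
proof (cases "A \<in> carrier_mat n n")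
  case True
  have eq: "v \<bullet>c (A *\<^sub>v v) = cnj (qform n A (\<lambda>i. vec_index v i))" if "v \<in> carrier_vec n" for v
    using that True
    by (auto simp: qform_def scalar_prod_def lessThan_atLeast0 sum_distrib_left mult.assoc
        intro!: sum.cong)
  show ?thesis
  proof
    assume A: "psd n A"
    show "A \<in> carrier_mat n n \<and> (\<forall>v. 0 \<le> qform n A v)"
    proof (intro conjI allI True)
      fix v
      have "qform n A v = qform n A (\<lambda>i. vec_index (vec n v) i)"
        by (auto simp: qform_def intro!: sum.cong)
      moreover have "vec n v \<in> carrier_vec n" by simp
      ultimately show "0 \<le> qform n A v"
        using A eq[of "vec n v"] unfolding psd_def less_eq_complex_def
        by (metis complex_cnj complex.sel complex_Re_of_int complex_cnj_cancel_iff cnj.simps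
            neg_equal_0_iff_equal zero_complex.simps)
    qed
  next
    assume "A \<in> carrier_mat n n \<and> (\<forall>v. 0 \<le> qform n A v)"
    with eq show "psd n A" by (auto simp: psd_def less_eq_complex_def)
  qed
qed (auto simp: psd_def)

lemma qform_minus:
  assumes "A \<in> carrier_mat n n" "B \<in> carrier_mat n n"
  shows "qform n (A - B) v = qform n A v - qform n B v"
  using assms by (simp add: qform_def sum_subtractf algebra_simps)

lemma qform_smult:
  assumes "A \<in> carrier_mat n n"
  shows "qform n (c \<cdot>\<^sub>m A) v = c * qform n A v"
  using assms by (simp add: qform_def sum_distrib_left algebra_simps)

text \<open>Polarisation: the form is real at e_i, e_i + e_j and e_i + \<i> e_j, which gives in turn
  a real diagonal, opposite imaginary parts and equal real parts of the entries (i, j) and (j,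
  i).\<close>

lemma psd_hermitian:
  assumes "psd n A"
  shows "adj A = A"
proof (rule eq_matI)
  have A: "A \<in> carrier_mat n n" and q: "\<And>v. Im (qform n A v) = 0"
    using assms by (auto simp: psd_iff_qform less_eq_complex_def)
  show "dim_row (adj A) = dim_row A" "dim_col (adj A) = dim_col A" using A by auto
  fix i j assume "i < dim_row A" "j < dim_col A"
  then have ij: "i < n" "j < n" using A by auto
  have two: "qform n A v = (\<Sum>a\<in>{i,j}. \<Sum>b\<in>{i,j}. cnj (v a) * A $$ (a, b) * v b)"
    if "\<And>k. k \<notin> {i,j} \<Longrightarrow> v k = 0" for v
  proof -
    have "qform n A v = (\<Sum>a\<in>{i,j}. \<Sum>b<n. cnj (v a) * A $$ (a, b) * v b)"
      unfolding qform_def by (rule sum.mono_neutral_right) (use ij that in auto)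
    also have "\<dots> = (\<Sum>a\<in>{i,j}. \<Sum>b\<in>{i,j}. cnj (v a) * A $$ (a, b) * v b)"
      by (intro sum.cong sum.mono_neutral_right refl) (use ij that in auto)
    finally show ?thesis .
  qed
  have "cnj (A $$ (j, i)) = A $$ (i, j)"
  proof (cases "i = j")
    case True
    have "Im (A $$ (i, i)) = 0"
      using two[of "\<lambda>k. if k = i then 1 else 0"] q[of "\<lambda>k. if k = i then 1 else 0"] True by simp
    with True show ?thesis by (simp add: complex_eq_iff)
  next
    case False
    have d: "Im (A $$ (i, i)) = 0" if "i < n" for i
    proof -
      have "qform n A (\<lambda>k. if k = i then 1 else 0) = A $$ (i, i)"
        using that by (simp add: qform_def if_distrib[of cnj] if_distrib[where f="\<lambda>x. x * _"]
            if_distrib[where f="\<lambda>x. _ * x"] sum.delta cong: if_cong)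
      then show ?thesis using q[of "\<lambda>k. if k = i then 1 else 0"] by simp
    qed
    let ?v = "\<lambda>c k. if k = i then 1 else if k = j then c else 0"
    have "Im (A $$ (i, j) + A $$ (j, i)) = 0"
      using two[of "?v 1"] q[of "?v 1"] False d[OF ij(1)] d[OF ij(2)] by simp
    moreover have "Re (A $$ (i, j)) = Re (A $$ (j, i))"
      using two[of "?v \<i>"] q[of "?v \<i>"] False d[OF ij(1)] d[OF ij(2)] by simp
    ultimately show ?thesis by (simp add: complex_eq_iff)
  qed
  then show "adj A $$ (i, j) = A $$ (i, j)" using A ij by simp
qed

definition unitary_op :: "nat \<Rightarrow> complex mat \<Rightarrow> bool" where
  "unitary_op n U \<longleftrightarrow> U \<in> carrier_mat n n \<and> adj U * U = 1\<^sub>m n \<and> U * adj U = 1\<^sub>m n"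

definition real_diag :: "nat \<Rightarrow> (nat \<Rightarrow> real) \<Rightarrow> complex mat" where
  "real_diag n f = mat n n (\<lambda>(i, j). if i = j then of_real (f i) else 0)"

lemma real_diag_carrier [simp]: "real_diag n f \<in> carrier_mat n n"
  by (simp add: real_diag_def)

lemma unitary_opI:
  assumes "U \<in> carrier_mat n n" "adj U * U = 1\<^sub>m n"
  shows "unitary_op n U"
  using assms mat_mult_left_right_inverse[of "adj U" n U] by (simp add: unitary_op_def)

lemma unitary_op_mult:
  assumes "unitary_op n U" "unitary_op n V"
  shows "unitary_op n (U * V)"
proof (rule unitary_opI)
  have U: "U \<in> carrier_mat n n" "adj U * U = 1\<^sub>m n" and V: "V \<in> carrier_mat n n" "adj V * V = 1\<^sub>m n"
    using assms by (auto simp: unitary_op_def)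
  show "U * V \<in> carrier_mat n n" using U V by simp
  have "adj (U * V) * (U * V) = adj V * ((adj U * U) * V)"
    using U(1) V(1) by (simp add: adj_mult[of U n n V n] assoc_mult_mat[of _ n n _ n _ n])
  also have "\<dots> = 1\<^sub>m n" unfolding U(2) left_mult_one_mat[OF V(1)] by (rule V(2))
  finally show "adj (U * V) * (U * V) = 1\<^sub>m n" .
qed

text \<open>Gram-Schmidt, started from a basis with head v, keeps that head. Its vectors are
  orthogonal but not of norm one, hence the division by \<open>nr\<close> and a first column that is
  only proportional to v.\<close>

lemma exists_unitary_first_col:
  fixes v :: "complex vec"
  assumes v: "v \<in> carrier_vec n" and v0: "v \<noteq> 0\<^sub>v n" and n: "n \<noteq> 0"
  obtains W c where "unitary_op n W" "c \<noteq> 0" "col W 0 = c \<cdot>\<^sub>v v"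
proof -
  interpret cof_vec_space n "TYPE(complex)" .
  define b where "b = basis_completion v"
  define ws where "ws = gram_schmidt n b"
  from basis_completion[OF v v0, folded b_def]
  have dist_b: "distinct b" and indep: "\<not> lin_dep (set b)" and b: "set b \<subseteq> carrier_vec n"
    and hdb: "hd b = v" and len_b: "length b = n" by auto
  from hdb len_b n obtain vs where bv: "b = v # vs" by (cases b) auto
  from gram_schmidt_result[OF b dist_b indep refl, folded ws_def]
  have ws: "set ws \<subseteq> carrier_vec n" "corthogonal ws" "length ws = n"
    by (auto simp: len_b)
  from gram_schmidt_hd[OF v, of vs, folded bv] have hdws: "hd ws = v" unfolding ws_def .
  then have ws0: "ws ! 0 = v" using ws n by (metis hd_conv_nth length_0_conv)
  define nr where "nr i = sqrt (\<Sum>a<n. (cmod (vec_index (ws ! i) a))\<^sup>2)" for i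
  have wsc: "ws ! i \<in> carrier_vec n" if "i < n" for i using ws that by auto
  have ip: "(ws ! i) \<bullet>c (ws ! j) = (\<Sum>a<n. vec_index (ws ! i) a * cnj (vec_index (ws ! j) a))"
    if "i < n" "j < n" for i j
    using wsc[OF that(1)] wsc[OF that(2)]
    by (auto simp: scalar_prod_def lessThan_atLeast0 intro!: sum.cong)
  have ii: "(ws ! i) \<bullet>c (ws ! i) = of_real ((nr i)\<^sup>2)" if "i < n" for i
    using ip[OF that that] by (simp add: nr_def sum_nonneg complex_norm_square[symmetric])
  have nz: "nr i \<noteq> 0" if "i < n" for i
    using corthogonalD[OF ws(2), of i i] ii[OF that] that ws by auto
  define W where "W = mat n n (\<lambda>(a, i). vec_index (ws ! i) a / of_real (nr i))"
  have Wc: "W \<in> carrier_mat n n" by (simp add: W_def)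
  have "adj W * W = 1\<^sub>m n"
  proof (rule eq_matI)
    fix i j assume "i < dim_row (1\<^sub>m n :: complex mat)" "j < dim_col (1\<^sub>m n :: complex mat)"
    then have ij: "i < n" "j < n" by auto
    have "(adj W * W) $$ (i, j) = (\<Sum>a<n. cnj (W $$ (a, i)) * W $$ (a, j))"
      using mult_index[of "adj W" n n W n i j] Wc ij by (auto intro!: sum.cong)
    also have "\<dots> = (\<Sum>a<n. vec_index (ws ! j) a * cnj (vec_index (ws ! i) a)) / of_real (nr i * nr j)"
      unfolding sum_divide_distrib using ij
      by (intro sum.cong) (auto simp: W_def)
    also have "\<dots> = ((ws ! j) \<bullet>c (ws ! i)) / of_real (nr i * nr j)" using ip ij by simp
    also have "\<dots> = 1\<^sub>m n $$ (i, j)"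
      using corthogonalD[OF ws(2), of j i] ii[OF ij(1)] nz[OF ij(1)] ij ws
      by (auto simp: power2_eq_square)
    finally show "(adj W * W) $$ (i, j) = 1\<^sub>m n $$ (i, j)" .
  qed (use Wc in auto)
  then have "unitary_op n W" by (rule unitary_opI[OF Wc])
  moreover have "inverse (of_real (nr 0)) \<noteq> (0 :: complex)" using nz[of 0] n by simp
  moreover have "col W 0 = inverse (of_real (nr 0)) \<cdot>\<^sub>v v"
    using n v by (intro eq_vecI) (auto simp: W_def ws0 divide_inverse mult.commute)
  ultimately show ?thesis using that by blast
qed

text \<open>Deflation: conjugation by a unitary whose first column is an eigenvector clears the
  first column below the diagonal. Hermiticity then clears the first row and makes the eigenvalue
  real, and the remaining block is again hermitian.\<close>

theorem hermitian_diagonalization: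
  assumes "A \<in> carrier_mat n n" "adj A = A"
  shows "\<exists>U f. unitary_op n U \<and> A = U * real_diag n f * adj U"
  using assms
proof (induction n arbitrary: A)
  case 0
  then have "unitary_op 0 A" "A = A * real_diag 0 (\<lambda>_. 0) * adj A"
    by (auto simp: unitary_op_def intro!: eq_matI)
  then show ?case by blast
next
  case (Suc n)
  note A = Suc.prems(1) and H = Suc.prems(2)
  let ?N = "Suc n"
  from spectrum_non_empty[OF A] obtain e where "eigenvalue A e"
    by (auto simp: spectrum_def)
  then obtain v where v: "v \<in> carrier_vec ?N" "v \<noteq> 0\<^sub>v ?N" "A *\<^sub>v v = e \<cdot>\<^sub>v v"
    using A by (auto simp: eigenvalue_def eigenvector_def)
  obtain W c where W: "unitary_op ?N W" and c: "c \<noteq> 0" "col W 0 = c \<cdot>\<^sub>v v"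
    using exists_unitary_first_col[OF v(1,2)] by auto
  have Wc: "W \<in> carrier_mat ?N ?N" and WW: "adj W * W = 1\<^sub>m ?N" "W * adj W = 1\<^sub>m ?N"
    using W by (auto simp: unitary_op_def)
  define B where "B = adj W * (A * W)"
  have Bc: "B \<in> carrier_mat ?N ?N"
    unfolding B_def by (intro mult_carrier_mat[of _ ?N ?N] adj_carrier A Wc)
  have BH: "adj B = B"
    using A Wc H
    by (simp add: B_def adj_mult[of _ ?N ?N _ ?N] assoc_mult_mat[of _ ?N ?N _ ?N _ ?N])
  have col0: "B $$ (i, 0) = (if i = 0 then e else 0)" if "i < ?N" for i
  proof -
    have AW: "(A * W) $$ (a, 0) = e * W $$ (a, 0)" if "a < ?N" for a
    proof -
      have "(A * W) $$ (a, 0) = vec_index (A *\<^sub>v col W 0) a" using that A Wc by simp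
      also have "A *\<^sub>v col W 0 = e \<cdot>\<^sub>v col W 0"
        using c A v by (simp add: mult_mat_vec smult_smult_assoc mult.commute)
      finally show ?thesis using that Wc by simp
    qed
    have "B $$ (i, 0) = (\<Sum>a<?N. adj W $$ (i, a) * (A * W) $$ (a, 0))"
      unfolding B_def by (rule mult_index[of _ ?N ?N _ ?N]) (use A Wc that in auto)
    also have "\<dots> = e * (\<Sum>a<?N. adj W $$ (i, a) * W $$ (a, 0))"
      unfolding sum_distrib_left by (intro sum.cong refl) (simp add: AW)
    also have "(\<Sum>a<?N. adj W $$ (i, a) * W $$ (a, 0)) = (adj W * W) $$ (i, 0)"
      by (rule mult_index[of _ ?N ?N _ ?N, symmetric]) (use Wc that in auto)
    finally show ?thesis using WW that by simp
  qed
  have row0: "B $$ (0, i) = (if i = 0 then e else 0)" if "i < ?N" for i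
  proof -
    have "B $$ (0, i) = cnj (B $$ (i, 0))" using BH Bc that
      by (metis adj_index carrier_matD zero_less_Suc)
    moreover have "cnj e = e"
      using BH Bc col0[of 0] by (metis adj_index carrier_matD zero_less_Suc)
    ultimately show ?thesis using col0[OF that] by simp
  qed
  have e: "e = of_real (Re e)"
    using BH Bc col0[of 0] by (metis adj_index carrier_matD zero_less_Suc complex_cnj_cancel_iff
        Reals_cnj_iff of_real_Re)
  define A3 where "A3 = mat n n (\<lambda>(i, j). B $$ (Suc i, Suc j))"
  have A3c: "A3 \<in> carrier_mat n n" by (simp add: A3_def)
  have "adj A3 = A3"
  proof (rule eq_matI)
    fix i j assume "i < dim_row A3" "j < dim_col A3"
    then have "i < n" "j < n" by (auto simp: A3_def)
    then show "adj A3 $$ (i, j) = A3 $$ (i, j)"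
      using arg_cong[OF BH, of "\<lambda>X. X $$ (Suc i, Suc j)"] Bc by (simp add: A3_def)
  qed (auto simp: A3_def)
  from Suc.IH[OF A3c this] obtain U f where U: "unitary_op n U" and Af: "A3 = U * real_diag n f * adj U"
    by blast
  have Uc: "U \<in> carrier_mat n n" and UU: "adj U * U = 1\<^sub>m n" using U by (auto simp: unitary_op_def)
  define V where "V = four_block_mat (1\<^sub>m 1) (0\<^sub>m 1 n) (0\<^sub>m n 1) U"
  define g where "g = (\<lambda>i. case i of 0 \<Rightarrow> Re e | Suc j \<Rightarrow> f j)"
  have Vc: "V \<in> carrier_mat ?N ?N" using Uc by (auto simp: V_def)
  have aV: "adj V = four_block_mat (1\<^sub>m 1) (0\<^sub>m 1 n) (0\<^sub>m n 1) (adj U)"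
    using Uc by (intro eq_matI) (auto simp: V_def)
  have "adj V * V = four_block_mat (1\<^sub>m 1) (0\<^sub>m 1 n) (0\<^sub>m n 1) (1\<^sub>m n)"
    unfolding aV unfolding V_def
    by (subst mult_four_block_mat[of _ 1 1 _ n _ n _ _ 1 _ n]) (use Uc UU in auto)
  also have "\<dots> = 1\<^sub>m ?N" by (intro eq_matI) auto
  finally have V: "unitary_op ?N V" by (rule unitary_opI[OF Vc])
  have gd: "real_diag ?N g = four_block_mat (mat 1 1 (\<lambda>_. e)) (0\<^sub>m 1 n) (0\<^sub>m n 1) (real_diag n f)"
    by (intro eq_matI) (auto simp: real_diag_def g_def e[symmetric] split: nat.splits)
  have "V * real_diag ?N g = four_block_mat (mat 1 1 (\<lambda>_. e)) (0\<^sub>m 1 n) (0\<^sub>m n 1) (U * real_diag n f)"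
    unfolding gd unfolding V_def
    by (subst mult_four_block_mat[of _ 1 1 _ n _ n _ _ 1 _ n])
      (use Uc in \<open>auto simp: left_mult_zero_mat[of _ n n]\<close>)
  then have "V * real_diag ?N g * adj V = four_block_mat (mat 1 1 (\<lambda>_. e)) (0\<^sub>m 1 n) (0\<^sub>m n 1) A3"
    unfolding aV Af
    by (simp, subst mult_four_block_mat[of _ 1 1 _ n _ n _ _ 1 _ n])
      (use Uc in \<open>auto simp: right_mult_zero_mat[of _ n n] left_add_zero_mat[of _ n n] mult_carrier_mat[of _ n n]\<close>)
  also have "\<dots> = B"
    using Bc col0 row0 by (intro eq_matI) (auto simp: A3_def)
  finally have B: "B = V * real_diag ?N g * adj V" ..
  have "A = (W * adj W) * A * (W * adj W)" using A WW by simp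
  also have "\<dots> = W * B * adj W"
    using A Wc by (simp add: B_def assoc_mult_mat[of _ ?N ?N _ ?N _ ?N] mult_carrier_mat[of _ ?N ?N])
  also have "\<dots> = (W * V) * real_diag ?N g * adj (W * V)"
    using Wc Vc
    by (simp add: B adj_mult[of W ?N ?N V ?N] assoc_mult_mat[of _ ?N ?N _ ?N _ ?N] mult_carrier_mat[of _ ?N ?N])
  finally show ?case using unitary_op_mult[OF W V] by blast
qed

section \<open>Functional calculus in a fixed eigenbasis, square roots and the trace norm\<close>

definition spectral_mat :: "nat \<Rightarrow> complex mat \<Rightarrow> (nat \<Rightarrow> real) \<Rightarrow> complex mat" where
  "spectral_mat n U f = U * real_diag n f * adj U"

lemma spectral_mat_carrier [simp]: "unitary_op n U \<Longrightarrow> spectral_mat n U f \<in> carrier_mat n n"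
  unfolding spectral_mat_def unitary_op_def by (auto intro!: mult_carrier_mat[of _ n n])

lemma spectral_mat_index:
  assumes U: "unitary_op n U" and "a < n" "b < n"
  shows "spectral_mat n U f $$ (a, b) = (\<Sum>i<n. of_real (f i) * U $$ (a, i) * cnj (U $$ (b, i)))"
proof -
  have Uc: "U \<in> carrier_mat n n" using U by (simp add: unitary_op_def)
  have UD: "(U * real_diag n f) $$ (a, i) = of_real (f i) * U $$ (a, i)" if "i < n" for i
    using mult_index[OF Uc real_diag_carrier \<open>a < n\<close> that, of f] that
    by (simp add: real_diag_def if_distrib[where f="\<lambda>x. _ * x"] cong: if_cong)
  have "spectral_mat n U f $$ (a, b) = (\<Sum>i<n. (U * real_diag n f) $$ (a, i) * adj U $$ (i, b))"
    unfolding spectral_mat_def by (rule mult_index[of _ n n _ n]) (use Uc assms in auto)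
  also have "\<dots> = (\<Sum>i<n. of_real (f i) * U $$ (a, i) * cnj (U $$ (b, i)))"
    by (intro sum.cong refl) (use Uc assms UD in auto)
  finally show ?thesis .
qed

lemma unitary_op_cols:
  assumes "unitary_op n U" "i < n" "j < n"
  shows "(\<Sum>a<n. cnj (U $$ (a, i)) * U $$ (a, j)) = (if i = j then 1 else 0)"
proof -
  have "U \<in> carrier_mat n n" "adj U * U = 1\<^sub>m n" using assms by (auto simp: unitary_op_def)
  then have "(1\<^sub>m n :: complex mat) $$ (i, j) = (\<Sum>a<n. adj U $$ (i, a) * U $$ (a, j))"
    using mult_index[of "adj U" n n U n i j] assms by simp
  also have "\<dots> = (\<Sum>a<n. cnj (U $$ (a, i)) * U $$ (a, j))"
    using \<open>U \<in> carrier_mat n n\<close> assms by (intro sum.cong) auto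
  finally show ?thesis using assms by simp
qed

lemma unitary_op_rows:
  assumes "unitary_op n U" "a < n" "b < n"
  shows "(\<Sum>i<n. U $$ (a, i) * cnj (U $$ (b, i))) = (if a = b then 1 else 0)"
proof -
  have "U \<in> carrier_mat n n" "U * adj U = 1\<^sub>m n" using assms by (auto simp: unitary_op_def)
  then have "(1\<^sub>m n :: complex mat) $$ (a, b) = (\<Sum>i<n. U $$ (a, i) * adj U $$ (i, b))"
    using mult_index[of U n n "adj U" n a b] assms by simp
  also have "\<dots> = (\<Sum>i<n. U $$ (a, i) * cnj (U $$ (b, i)))"
    using \<open>U \<in> carrier_mat n n\<close> assms by (intro sum.cong) auto
  finally show ?thesis using assms by simp
qed

lemma spectral_mat_mult:
  assumes U: "unitary_op n U"
  shows "spectral_mat n U f * spectral_mat n U g = spectral_mat n U (\<lambda>i. f i * g i)"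
proof -
  have Uc: "U \<in> carrier_mat n n" and UU: "adj U * U = 1\<^sub>m n" using U by (auto simp: unitary_op_def)
  have D: "real_diag n f * real_diag n g = real_diag n (\<lambda>i. f i * g i)"
  proof (rule eq_matI)
    fix i j assume "i < dim_row (real_diag n (\<lambda>i. f i * g i))" "j < dim_col (real_diag n (\<lambda>i. f i * g i))"
    then have "i < n" "j < n" by (auto simp: real_diag_def)
    then show "(real_diag n f * real_diag n g) $$ (i, j) = real_diag n (\<lambda>i. f i * g i) $$ (i, j)"
      using mult_index[of "real_diag n f" n n "real_diag n g" n i j]
      by (simp add: real_diag_def if_distrib[where f="\<lambda>x. _ * x"] if_distrib[where f="\<lambda>x. x * _"] cong: if_cong)
  qed (auto simp: real_diag_def)
  note as = assoc_mult_mat[of _ n n _ n _ n]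
  have "spectral_mat n U f * spectral_mat n U g
      = U * (real_diag n f * ((adj U * U) * (real_diag n g * adj U)))"
    unfolding spectral_mat_def using Uc by (simp add: as mult_carrier_mat[of _ n n])
  also have "\<dots> = U * ((real_diag n f * real_diag n g) * adj U)"
    unfolding UU using Uc
    by (simp add: as mult_carrier_mat[of _ n n] left_mult_one_mat[of "real_diag n g * adj U" n n])
  finally show ?thesis
    unfolding D spectral_mat_def using Uc by (simp add: as mult_carrier_mat[of _ n n])
qed

lemma qform_spectral_mat:
  assumes U: "unitary_op n U"
  shows "qform n (spectral_mat n U f) v = of_real (\<Sum>i<n. f i * (cmod (\<Sum>a<n. cnj (U $$ (a, i)) * v a))\<^sup>2)"
proof -
  have "qform n (spectral_mat n U f) v
      = (\<Sum>a<n. \<Sum>b<n. \<Sum>i<n. of_real (f i) * (U $$ (a, i) * cnj (v a)) * (cnj (U $$ (b, i)) * v b))"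
    unfolding qform_def
    by (intro sum.cong refl) (simp add: spectral_mat_index[OF U] sum_distrib_left sum_distrib_right algebra_simps)
  also have "\<dots> = (\<Sum>a<n. \<Sum>i<n. \<Sum>b<n. of_real (f i) * (U $$ (a, i) * cnj (v a)) * (cnj (U $$ (b, i)) * v b))"
    by (intro sum.cong refl sum.swap)
  also have "\<dots> = (\<Sum>i<n. \<Sum>a<n. \<Sum>b<n. of_real (f i) * (U $$ (a, i) * cnj (v a)) * (cnj (U $$ (b, i)) * v b))"
    by (rule sum.swap)
  also have "\<dots> = (\<Sum>i<n. of_real (f i) * (cnj (\<Sum>a<n. cnj (U $$ (a, i)) * v a) * (\<Sum>b<n. cnj (U $$ (b, i)) * v b)))"
    by (intro sum.cong refl, simp only: cnj_sum complex_cnj_mult complex_cnj_cnj sum_product)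
      (simp add: sum_distrib_left mult_ac)
  also have "\<dots> = (\<Sum>i<n. of_real (f i * (cmod (\<Sum>a<n. cnj (U $$ (a, i)) * v a))\<^sup>2))"
    by (intro sum.cong refl) (simp only: complex_norm_square of_real_mult mult.commute)
  finally show ?thesis by simp
qed

lemma psd_spectral_mat:
  assumes "unitary_op n U" "\<And>i. i < n \<Longrightarrow> 0 \<le> f i"
  shows "psd n (spectral_mat n U f)"
  unfolding psd_iff_qform
  using assms by (auto simp: qform_spectral_mat less_eq_complex_def intro!: sum_nonneg)

lemma qform_spectral_mat_col:
  assumes U: "unitary_op n U" and i: "i < n"
  shows "qform n (spectral_mat n U f) (\<lambda>a. U $$ (a, i)) = of_real (f i)"
  unfolding qform_spectral_mat[OF U]
  using unitary_op_cols[OF U] i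
  by (simp add: if_distrib[where f="\<lambda>x. _ * (cmod x)\<^sup>2"] cong: if_cong)

text \<open>The trace can be taken in any orthonormal basis. In \<open>trace_norm_minus_le\<close>
  this is an eigenbasis of P - N, which need not diagonalise P or N.\<close>

lemma sum_qform_cols:
  assumes U: "unitary_op n U" and A: "A \<in> carrier_mat n n"
  shows "(\<Sum>i<n. qform n A (\<lambda>a. U $$ (a, i))) = mtrace A"
proof -
  have "(\<Sum>i<n. qform n A (\<lambda>a. U $$ (a, i)))
      = (\<Sum>a<n. \<Sum>i<n. \<Sum>b<n. cnj (U $$ (a, i)) * A $$ (a, b) * U $$ (b, i))"
    unfolding qform_def by (rule sum.swap)
  also have "\<dots> = (\<Sum>a<n. \<Sum>b<n. \<Sum>i<n. cnj (U $$ (a, i)) * A $$ (a, b) * U $$ (b, i))"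
    by (intro sum.cong refl sum.swap)
  also have "\<dots> = (\<Sum>a<n. \<Sum>b<n. A $$ (a, b) * (\<Sum>i<n. U $$ (b, i) * cnj (U $$ (a, i))))"
    by (simp add: sum_distrib_left mult_ac)
  also have "\<dots> = (\<Sum>a<n. \<Sum>b<n. if b = a then A $$ (a, a) else 0)"
    by (intro sum.cong refl) (simp add: unitary_op_rows[OF U])
  finally show ?thesis using A by (simp add: mtrace_def)
qed

lemma mtrace_spectral_mat:
  assumes U: "unitary_op n U"
  shows "mtrace (spectral_mat n U f) = of_real (\<Sum>i<n. f i)"
  using sum_qform_cols[OF U spectral_mat_carrier[OF U], of f] qform_spectral_mat_col[OF U] by simp

lemma hermitian_spectral:
  assumes "A \<in> carrier_mat n n" "adj A = A"
  obtains U f where "unitary_op n U" "A = spectral_mat n U f"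
  using hermitian_diagonalization[OF assms] by (auto simp: spectral_mat_def)

lemma adj_mult_mult_diag:
  assumes "U \<in> carrier_mat n n" "A \<in> carrier_mat n n" "i < n"
  shows "(adj U * A * U) $$ (i, i) = qform n A (\<lambda>a. U $$ (a, i))"
proof -
  have "(adj U * A) $$ (i, b) = (\<Sum>a<n. cnj (U $$ (a, i)) * A $$ (a, b))" if "b < n" for b
    using mult_index[of "adj U" n n A n i b] assms that by (auto intro!: sum.cong)
  then have "(adj U * A * U) $$ (i, i) = (\<Sum>b<n. (\<Sum>a<n. cnj (U $$ (a, i)) * A $$ (a, b)) * U $$ (b, i))"
    using mult_index[of "adj U * A" n n U n i i] assms by (simp add: mult_carrier_mat[of _ n n])
  also have "\<dots> = (\<Sum>b<n. \<Sum>a<n. cnj (U $$ (a, i)) * A $$ (a, b) * U $$ (b, i))"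
    by (simp add: sum_distrib_right)
  finally show ?thesis unfolding qform_def by (subst sum.swap)
qed

text \<open>In an eigenbasis of \<open>A - B\<close> with eigenvalues \<open>f\<close>, the diagonal of
  \<open>A\<^sup>2 - B\<^sup>2 = A (A - B) + (A - B) B\<close> has entries \<open>f i * (a i + b i)\<close> with \<open>a i, b i \<ge> 0\<close>.\<close>

lemma psd_sqrt_unique:
  assumes A: "psd n A" and B: "psd n B" and eq: "A * A = B * B"
  shows "A = B"
proof -
  have Ac: "A \<in> carrier_mat n n" and Bc: "B \<in> carrier_mat n n"
    using A B by (auto simp: psd_def)
  have "adj (A - B) = A - B"
  proof (rule eq_matI)
    fix i j assume "i < dim_row (A - B)" "j < dim_col (A - B)"
    then show "adj (A - B) $$ (i, j) = (A - B) $$ (i, j)"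
      using arg_cong[OF psd_hermitian[OF A], of "\<lambda>X. X $$ (i, j)"]
        arg_cong[OF psd_hermitian[OF B], of "\<lambda>X. X $$ (i, j)"] Ac Bc by simp
  qed (use Ac Bc in auto)
  then obtain U f where U: "unitary_op n U" and AB: "A - B = spectral_mat n U f"
    using hermitian_spectral[OF minus_carrier_mat[OF Bc]] by blast
  have Uc: "U \<in> carrier_mat n n" and UU: "adj U * U = 1\<^sub>m n" "U * adj U = 1\<^sub>m n"
    using U by (auto simp: unitary_op_def)
  note mc = mult_carrier_mat[of _ n n]
  note as = assoc_mult_mat[of _ n n _ n _ n]
  define C D where "C = adj U * A * U" and "D = adj U * B * U"
  have Cc: "C \<in> carrier_mat n n" and Dc: "D \<in> carrier_mat n n"
    unfolding C_def D_def using Ac Bc Uc by (auto intro!: mc)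
  have sq: "adj U * X * U * (adj U * X * U) = adj U * (X * X) * U" if "X \<in> carrier_mat n n" for X
  proof -
    have "adj U * X * U * (adj U * X * U) = adj U * X * ((U * adj U) * (X * U))"
      using Uc that by (simp add: as mc)
    also have "\<dots> = adj U * (X * X) * U"
      unfolding UU using Uc that by (simp add: as mc)
    finally show ?thesis .
  qed
  have CD: "C * C = D * D" unfolding C_def D_def by (simp only: sq Ac Bc eq)
  have "C - D = adj U * (A - B) * U"
    unfolding C_def D_def using Uc Ac Bc
    by (simp add: mult_minus_distrib_mat[of _ n n] minus_mult_distrib_mat[of _ n n] mc)
  also have "\<dots> = (adj U * U) * real_diag n f * (adj U * U)"
    unfolding AB spectral_mat_def using Uc by (simp add: as mc)
  also have "\<dots> = real_diag n f"
    unfolding UU by (simp add: left_mult_one_mat[OF real_diag_carrier] right_mult_one_mat[OF real_diag_carrier])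
  finally have diff: "C - D = real_diag n f" .
  have ent: "C $$ (i, j) = D $$ (i, j) + (if i = j then of_real (f i) else 0)" if "i < n" "j < n" for i j
    using arg_cong[OF diff, of "\<lambda>X. X $$ (i, j)"] that Cc Dc by (auto simp: real_diag_def algebra_simps)
  have "f i = 0" if i: "i < n" for i
  proof (rule ccontr)
    assume f: "f i \<noteq> 0"
    have c: "0 \<le> C $$ (i, i)" and d: "0 \<le> D $$ (i, i)"
      using A B Uc Ac Bc i unfolding C_def D_def psd_iff_qform
      by (auto simp only: adj_mult_mult_diag)
    have "(\<Sum>j<n. C $$ (i, j) * C $$ (j, i)) = (\<Sum>j<n. D $$ (i, j) * D $$ (j, i))"
      using mult_index[OF Cc Cc i i] mult_index[OF Dc Dc i i] CD by simp
    \<comment> \<open>Off the diagonal C and D agree, so in the i-th diagonal entry of the squares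
      only the summand j = i differs, by C_ii^2 - D_ii^2 = f_i (C_ii + D_ii).\<close>
    also have "(\<Sum>j<n. C $$ (i, j) * C $$ (j, i))
        = (\<Sum>j<n. D $$ (i, j) * D $$ (j, i) + (if j = i then of_real (f i) * (C $$ (i, i) + D $$ (i, i)) else 0))"
      by (intro sum.cong refl) (auto simp: ent i algebra_simps)
    finally have "of_real (f i) * (C $$ (i, i) + D $$ (i, i)) = 0"
      using i by (simp add: sum.distrib)
    then have "C $$ (i, i) + D $$ (i, i) = 0" using f by simp
    then have "C $$ (i, i) = 0" "D $$ (i, i) = 0"
      using c d by (simp_all add: less_eq_complex_def complex_eq_iff)
    with ent[OF i i] f show False by simp
  qed
  then have "A - B = 0\<^sub>m n n"
    unfolding AB using U by (intro eq_matI) (auto simp: spectral_mat_index spectral_mat_carrier[THEN carrier_matD(1)] spectral_mat_carrier[THEN carrier_matD(2)])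
  show "A = B"
  proof (rule eq_matI)
    fix i j assume "i < dim_row B" "j < dim_col B"
    then show "A $$ (i, j) = B $$ (i, j)"
      using arg_cong[OF \<open>A - B = 0\<^sub>m n n\<close>, of "\<lambda>X. X $$ (i, j)"] Ac Bc by simp
  qed (use Ac Bc in auto)
qed

lemma psd_sqrt_exists:
  assumes A: "psd n A"
  obtains S where "psd n S" "S * S = A"
proof -
  obtain U f where U: "unitary_op n U" and Af: "A = spectral_mat n U f"
    using hermitian_spectral[of A n] A psd_hermitian[OF A] by (auto simp: psd_def)
  have f: "0 \<le> f i" if "i < n" for i
    using A qform_spectral_mat_col[OF U that, of f] unfolding psd_iff_qform Af[symmetric]
    by (metis Re_complex_of_real less_eq_complex_def zero_complex.sel(1))
  have "psd n (spectral_mat n U (\<lambda>i. sqrt (f i)))"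
    by (rule psd_spectral_mat[OF U]) (simp add: f)
  moreover have "spectral_mat n U (\<lambda>i. sqrt (f i)) * spectral_mat n U (\<lambda>i. sqrt (f i)) = A"
    unfolding spectral_mat_mult[OF U] Af
    by (intro eq_matI) (auto simp: spectral_mat_index[OF U] f spectral_mat_carrier[OF U, THEN carrier_matD(1)]
        spectral_mat_carrier[OF U, THEN carrier_matD(2)] intro!: sum.cong)
  ultimately show ?thesis using that by blast
qed

text \<open>In an eigenbasis of P - N each eigenvalue is a difference of two nonnegative diagonal
  entries, so its modulus is at most their sum. Uniqueness of the positive root evaluates the
  definite description in \<open>mat_abs\<close>.\<close>

lemma trace_norm_minus_le:
  assumes P: "psd n P" and N: "psd n N"
  shows "trace_norm (P - N) \<le> Re (mtrace P) + Re (mtrace N)"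
proof -
  have Pc: "P \<in> carrier_mat n n" and Nc: "N \<in> carrier_mat n n"
    using P N by (auto simp: psd_def)
  have herm: "adj (P - N) = P - N"
  proof (rule eq_matI)
    fix i j assume "i < dim_row (P - N)" "j < dim_col (P - N)"
    then show "adj (P - N) $$ (i, j) = (P - N) $$ (i, j)"
      using arg_cong[OF psd_hermitian[OF P], of "\<lambda>X. X $$ (i, j)"]
        arg_cong[OF psd_hermitian[OF N], of "\<lambda>X. X $$ (i, j)"] Pc Nc by simp
  qed (use Pc Nc in auto)
  then obtain U f where U: "unitary_op n U" and PN: "P - N = spectral_mat n U f"
    using hermitian_spectral[OF minus_carrier_mat[OF Nc]] by blast
  have ps: "psd n (spectral_mat n U (\<lambda>i. \<bar>f i\<bar>))"
    by (rule psd_spectral_mat[OF U]) simp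
  have sq: "spectral_mat n U (\<lambda>i. \<bar>f i\<bar>) * spectral_mat n U (\<lambda>i. \<bar>f i\<bar>) = adj (P - N) * (P - N)"
    unfolding herm unfolding PN by (simp add: spectral_mat_mult[OF U])
  have dim: "dim_col (P - N) = n" using Nc by simp
  have "mat_abs (P - N) = spectral_mat n U (\<lambda>i. \<bar>f i\<bar>)"
    unfolding mat_abs_def dim using ps sq psd_sqrt_unique by (intro the_equality) auto
  then have "trace_norm (P - N) = (\<Sum>i<n. \<bar>f i\<bar>)"
    by (simp add: trace_norm_def mtrace_spectral_mat[OF U])
  also have "\<dots> \<le> (\<Sum>i<n. Re (qform n P (\<lambda>a. U $$ (a, i))) + Re (qform n N (\<lambda>a. U $$ (a, i))))"
  proof (rule sum_mono)
    fix i assume "i \<in> {..<n}"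
    then have "of_real (f i) = qform n (P - N) (\<lambda>a. U $$ (a, i))"
      using qform_spectral_mat_col[OF U, of i f] unfolding PN by simp
    then have "f i = Re (qform n P (\<lambda>a. U $$ (a, i))) - Re (qform n N (\<lambda>a. U $$ (a, i)))"
      unfolding qform_minus[OF Pc Nc] by (metis Re_complex_of_real minus_complex.simps(1))
    moreover have "0 \<le> Re (qform n P (\<lambda>a. U $$ (a, i)))" "0 \<le> Re (qform n N (\<lambda>a. U $$ (a, i)))"
      using P N by (auto simp: psd_iff_qform less_eq_complex_def)
    ultimately show "\<bar>f i\<bar> \<le> Re (qform n P (\<lambda>a. U $$ (a, i))) + Re (qform n N (\<lambda>a. U $$ (a, i)))"
      by simp
  qed
  also have "\<dots> = Re (mtrace P) + Re (mtrace N)"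
    by (simp add: sum.distrib sum_qform_cols[OF U Pc, symmetric] sum_qform_cols[OF U Nc, symmetric])
  finally show ?thesis .
qed

section \<open>A measure with Gaussian moments\<close>

lemma measurable_cnj [measurable]: "cnj \<in> borel_measurable borel"
  by (intro borel_measurable_continuous_onI continuous_intros)

text \<open>Law of |z|^2 for a standard complex Gaussian z, which is where the moments a! come
  from.\<close>

definition exp_measure :: "real measure" where
  "exp_measure = density lborel (exponential_density 1)"

lemma prob_space_exp_measure: "prob_space exp_measure"
  unfolding exp_measure_def by (rule prob_space_exponential_density) simp

lemma sets_exp_measure [measurable_cong, simp]: "sets exp_measure = sets borel"
  by (simp add: exp_measure_def)

lemma AE_exp_measure_nonneg: "AE t in exp_measure. 0 \<le> t"
  unfolding exp_measure_def by (subst AE_density) (auto simp: exponential_density_def erlang_density_def)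

lemma exp_measure_moment: "has_bochner_integral exp_measure (\<lambda>t. t ^ a) (fact a)"
proof -
  interpret prob_space exp_measure by (rule prob_space_exp_measure)
  have "distributed exp_measure lborel (\<lambda>x. x) (exponential_density 1)"
    unfolding distributed_def exp_measure_def by (auto simp: distr_id2 exponential_density_def)
  from has_bochner_integral_erlang_ith_moment[OF _ this, of a] show ?thesis by simp
qed

definition radial_measure :: "complex measure" where
  "radial_measure = distr exp_measure borel (\<lambda>t. of_real (sqrt t))"

lemma prob_space_radial: "prob_space radial_measure"
  unfolding radial_measure_def by (intro prob_space.prob_space_distr prob_space_exp_measure) measurable

text \<open>Required also for a \<noteq> b, where the phase makes the joint moment vanish: the
  integral of a product over independent coordinates factors only if every factor is integrable.
  Half-integer powers of t are dominated by 1 + t^(a+b).\<close>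

lemma radial_integrable: "integrable radial_measure (\<lambda>z. z ^ a * cnj z ^ b)"
proof -
  have "integrable exp_measure (\<lambda>t. complex_of_real (sqrt t) ^ a * cnj (complex_of_real (sqrt t)) ^ b)"
  proof (rule Bochner_Integration.integrable_bound)
    have "integrable exp_measure (\<lambda>t. t ^ (a + b))"
      using exp_measure_moment by (simp add: has_bochner_integral_iff)
    moreover have "integrable exp_measure (\<lambda>t. 1 :: real)"
      using prob_space_exp_measure by (simp add: prob_space.finite_measure finite_measure.integrable_const)
    ultimately show "integrable exp_measure (\<lambda>t. 1 + t ^ (a + b))" by simp
    show "AE t in exp_measure. norm (complex_of_real (sqrt t) ^ a * cnj (complex_of_real (sqrt t)) ^ b)
        \<le> norm (1 + t ^ (a + b))"
      using AE_exp_measure_nonneg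
    proof eventually_elim
      case (elim t)
      have "norm (complex_of_real (sqrt t) ^ a * cnj (complex_of_real (sqrt t)) ^ b) = sqrt t ^ (a + b)"
        using elim by (simp add: norm_mult norm_power power_add)
      also have "\<dots> \<le> 1 + t ^ (a + b)"
      proof (cases "t \<le> 1")
        case True
        then have "sqrt t ^ (a + b) \<le> 1" using elim by (intro power_le_one) auto
        then show ?thesis using elim by (smt (verit) zero_le_power)
      next
        case False
        then have "sqrt t \<le> t" using real_sqrt_le_iff[of t "t * t"] by (simp add: real_le_lsqrt power2_eq_square)
        then have "sqrt t ^ (a + b) \<le> t ^ (a + b)" using elim by (intro power_mono) auto
        then show ?thesis by simp
      qed
      finally show ?case using elim by simp
    qed
  qed measurable
  then show ?thesis unfolding radial_measure_def by (subst integrable_distr_eq) auto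
qed

lemma radial_moment: "integral\<^sup>L radial_measure (\<lambda>z. z ^ a * cnj z ^ a) = fact a"
proof -
  have "integral\<^sup>L radial_measure (\<lambda>z. z ^ a * cnj z ^ a)
      = integral\<^sup>L exp_measure (\<lambda>t. complex_of_real (sqrt t) ^ a * cnj (complex_of_real (sqrt t)) ^ a)"
    unfolding radial_measure_def by (subst integral_distr) auto
  also have "\<dots> = integral\<^sup>L exp_measure (\<lambda>t. complex_of_real (t ^ a))"
  proof (rule integral_cong_AE)
    show "AE t in exp_measure. complex_of_real (sqrt t) ^ a * cnj (complex_of_real (sqrt t)) ^ a
        = complex_of_real (t ^ a)"
      using AE_exp_measure_nonneg
      by eventually_elim (simp flip: power_mult_distrib of_real_mult of_real_power)
  qed measurable
  also have "\<dots> = complex_of_real (fact a)"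
    unfolding integral_complex_of_real using exp_measure_moment[of a] by (simp only: has_bochner_integral_iff)
  also have "\<dots> = fact a" by simp
  finally show ?thesis .
qed

text \<open>Roots of unity of order M + 1 in place of the whole circle: the mean of z^(a-b) over
  them vanishes unless M + 1 divides a - b, and exponents up to M leave only a = b.\<close>

definition phase_measure :: "nat \<Rightarrow> complex measure" where
  "phase_measure M = distr (measure_pmf (pmf_of_set {..M})) borel (\<lambda>q. cis (2 * pi / real (Suc M)) ^ q)"

lemma prob_space_phase: "prob_space (phase_measure M)"
  unfolding phase_measure_def by (intro prob_space.prob_space_distr measure_pmf.prob_space_axioms) simp

lemma phase_integrable: "integrable (phase_measure M) (\<lambda>z. z ^ a * cnj z ^ b)"
  unfolding phase_measure_def by (subst integrable_distr_eq) (auto intro!: integrable_measure_pmf_finite)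

lemma phase_moment:
  assumes "a \<le> M" "b \<le> M"
  shows "integral\<^sup>L (phase_measure M) (\<lambda>z. z ^ a * cnj z ^ b) = (if a = b then 1 else 0)"
proof -
  define w where "w = cis (2 * pi / real (Suc M))"
  define c where "c = w ^ a * cnj w ^ b"
  have "integral\<^sup>L (phase_measure M) (\<lambda>z. z ^ a * cnj z ^ b)
      = integral\<^sup>L (measure_pmf (pmf_of_set {..M})) (\<lambda>q. (w ^ q) ^ a * cnj (w ^ q) ^ b)"
    unfolding phase_measure_def w_def by (subst integral_distr) auto
  also have "\<dots> = (\<Sum>q\<le>M. (1 / real (Suc M)) *\<^sub>R c ^ q)"
    by (subst integral_measure_pmf[of "{..M}"])
      (auto simp: c_def power_mult_distrib mult.commute simp flip: power_mult)
  also have "\<dots> = (\<Sum>q<Suc M. c ^ q) / of_nat (Suc M)"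
    unfolding lessThan_Suc_atMost sum_divide_distrib by (simp add: scaleR_conv_of_real)
  also have "\<dots> = (if a = b then 1 else 0)"
  proof (cases "a = b")
    case True
    then have "c = 1" by (simp add: c_def w_def cis_cnj cis_mult flip: power_mult_distrib)
    with True show ?thesis by (simp flip: of_nat_Suc)
  next
    case False
    have cc: "c = cis (2 * pi * (real a - real b) / real (Suc M))"
      unfolding c_def w_def cis_cnj Complex.DeMoivre cis_mult
      by (rule arg_cong[where f=cis]) (simp add: algebra_simps diff_divide_distrib del: of_nat_Suc)
    have "c ^ Suc M = cis (2 * pi * (real a - real b))"
      unfolding cc Complex.DeMoivre by simp
    also have "\<dots> = cis (2 * pi * of_int (int a - int b))" by simp
    also have "\<dots> = 1" by (rule cis_multiple_2pi) simp
    finally have c1: "c ^ Suc M = 1" .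
    have "c \<noteq> 1"
    proof
      assume "c = 1"
      then have "cos (2 * pi * (real a - real b) / real (Suc M)) = 1"
        using cc by (metis cis.sel(1) one_complex.sel(1))
      then obtain k :: int where "2 * pi * (real a - real b) / real (Suc M) = of_int k * 2 * pi"
        unfolding cos_one_2pi_int by blast
      then have "2 * pi * (real a - real b) = 2 * pi * (of_int k * real (Suc M))"
        by (simp add: field_simps del: of_nat_Suc)
      then have "(real a - real b) = of_int k * real (Suc M)"
        by simp
      then have "real_of_int (int a - int b) = real_of_int (k * int (Suc M))" by simp
      then have "int a - int b = k * int (Suc M)" by (simp only: of_int_eq_iff)
      moreover have "\<bar>int a - int b\<bar> < int (Suc M)" "int a - int b \<noteq> 0" using assms False by auto
      ultimately show False
        by (metis abs_mult abs_of_nat dvd_imp_le_int dvd_triv_right not_le)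
    qed
    then show ?thesis using False c1 by (simp add: geometric_sum del: sum.lessThan_Suc power_Suc)
  qed
  finally show ?thesis .
qed

text \<open>A measure whose mixed moments of degree at most \<open>M\<close> are those of the standard complex
  Gaussian on \<open>\<complex>\<^bsup>d\<times>d\<^esup>\<close>.\<close>

definition gaussian_moments :: "nat \<Rightarrow> nat \<Rightarrow> complex mat measure \<Rightarrow> bool" where
  "gaussian_moments d M \<mu> \<longleftrightarrow> space \<mu> = carrier_mat d d \<and>
     (\<forall>i\<in>{..<d} \<times> {..<d}. (\<lambda>x. x $$ i) \<in> borel_measurable \<mu>) \<and>
     (\<forall>\<alpha> \<beta>. (\<forall>i\<in>{..<d} \<times> {..<d}. \<alpha> i \<le> M \<and> \<beta> i \<le> M) \<longrightarrow>
        has_bochner_integral \<mu> (\<lambda>x. \<Prod>i\<in>{..<d} \<times> {..<d}. (x $$ i) ^ \<alpha> i * cnj (x $$ i) ^ \<beta> i)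
          (\<Prod>i\<in>{..<d} \<times> {..<d}. if \<alpha> i = \<beta> i then fact (\<alpha> i) else 0))"

text \<open>Every entry is the product of an independent radius and an independent phase, told apart
  by the boolean in the index set; a mixed moment then factors into radial and phase
  moments.\<close>

lemma gaussian_moments_exist: "\<exists>\<mu>. gaussian_moments d M \<mu>"
proof -
  define A where "A = {..<d} \<times> {..<d}"
  define P where "P = (\<lambda>(i :: nat \<times> nat, c). if c then radial_measure else phase_measure M)"
  define N where "N = PiM (A \<times> (UNIV :: bool set)) P"
  define \<Phi> where "\<Phi> = (\<lambda>f :: (nat \<times> nat) \<times> bool \<Rightarrow> complex. mat d d (\<lambda>i. f (i, True) * f (i, False)))"
  \<comment> \<open>The coarsest sigma-algebra on the d by d matrices for which all entries are
    measurable, pulled back from the product of Borel algebras.\<close>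
  define T where "T = vimage_algebra (carrier_mat d d) (\<lambda>x. \<lambda>i\<in>A. x $$ i) (PiM A (\<lambda>_. borel :: complex measure))"
  have fin: "finite (A \<times> (UNIV :: bool set))" by (simp add: A_def)
  interpret product_prob_space P
    by (rule product_prob_spaceI) (auto simp: P_def prob_space_radial prob_space_phase)
  have setsP: "sets (P i) = sets borel" for i
    by (auto simp: P_def radial_measure_def phase_measure_def split: prod.splits)
  have ent: "(\<lambda>x. x $$ i) \<in> borel_measurable T" if "i \<in> A" for i
  proof -
    have "(\<lambda>x. \<lambda>i\<in>A. x $$ i) \<in> measurable T (PiM A (\<lambda>_. borel :: complex measure))"
      unfolding T_def by (rule measurable_vimage_algebra1) (auto simp: space_PiM)
    from measurable_compose[OF this measurable_component_singleton[OF that]]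
    show ?thesis using that by simp
  qed
  have comp: "(\<lambda>f. f (i, c)) \<in> borel_measurable N" if "i \<in> A" for i c
  proof -
    have "(\<lambda>f. f (i, c)) \<in> measurable N (P (i, c))"
      unfolding N_def by (rule measurable_component_singleton) (simp add: that)
    then show ?thesis using measurable_cong_sets[OF refl setsP, of N "(i, c)"] by simp
  qed
  have \<Phi>: "\<Phi> \<in> measurable N T"
    unfolding T_def
  proof (rule measurable_vimage_algebra2)
    show "\<Phi> \<in> space N \<rightarrow> carrier_mat d d" by (auto simp: \<Phi>_def)
    have "(\<lambda>f. \<lambda>i\<in>A. f (i, True) * f (i, False)) \<in> measurable N (PiM A (\<lambda>_. borel :: complex measure))"
      using comp by (intro measurable_restrict) measurable
    moreover have "(\<lambda>i\<in>A. \<Phi> f $$ i) = (\<lambda>i\<in>A. f (i, True) * f (i, False))" for f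
      by (auto simp: \<Phi>_def A_def)
    ultimately show "(\<lambda>f. \<lambda>i\<in>A. \<Phi> f $$ i) \<in> measurable N (PiM A (\<lambda>_. borel :: complex measure))"
      by simp
  qed
  define \<mu> where "\<mu> = distr N T \<Phi>"
  have ent': "(\<lambda>x. x $$ i) \<in> borel_measurable \<mu>" if "i \<in> A" for i
    using ent[OF that] by (simp add: \<mu>_def)
  have "has_bochner_integral \<mu> (\<lambda>x. \<Prod>i\<in>A. (x $$ i) ^ \<alpha> i * cnj (x $$ i) ^ \<beta> i)
      (\<Prod>i\<in>A. if \<alpha> i = \<beta> i then fact (\<alpha> i) else 0)"
    if le: "\<forall>i\<in>A. \<alpha> i \<le> M \<and> \<beta> i \<le> M" for \<alpha> \<beta>
    unfolding \<mu>_def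
  proof (rule has_bochner_integral_distr[OF _ \<Phi>])
    show "(\<lambda>x. \<Prod>i\<in>A. (x $$ i) ^ \<alpha> i * cnj (x $$ i) ^ \<beta> i) \<in> borel_measurable T"
      using ent by (intro borel_measurable_prod) (auto intro!: borel_measurable_times borel_measurable_power
          measurable_compose[OF _ measurable_cnj])
    let ?g = "\<lambda>(i :: nat \<times> nat, c :: bool) z. z ^ \<alpha> i * cnj z ^ \<beta> i :: complex"
    have int: "integrable (P j) (?g j)" for j
      by (auto simp: P_def radial_integrable phase_integrable split: prod.splits)
    have eq: "(\<Prod>i\<in>A. (\<Phi> f $$ i) ^ \<alpha> i * cnj (\<Phi> f $$ i) ^ \<beta> i)
        = (\<Prod>j\<in>A \<times> UNIV. ?g j (f j))" for f
      unfolding prod.cartesian_product'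
      by (intro prod.cong refl) (auto simp: \<Phi>_def A_def UNIV_bool power_mult_distrib mult_ac)
    have "has_bochner_integral N (\<lambda>f. \<Prod>j\<in>A \<times> UNIV. ?g j (f j)) (\<Prod>j\<in>A \<times> UNIV. integral\<^sup>L (P j) (?g j))"
      unfolding N_def has_bochner_integral_iff
      using product_integrable_prod[OF fin int] product_integral_prod[OF fin int] by blast
    also have "(\<Prod>j\<in>A \<times> UNIV. integral\<^sup>L (P j) (?g j))
        = (\<Prod>i\<in>A. if \<alpha> i = \<beta> i then fact (\<alpha> i) else 0)"
      unfolding prod.cartesian_product'
      using le by (intro prod.cong refl) (auto simp: UNIV_bool P_def radial_moment phase_moment)
    finally show "has_bochner_integral N (\<lambda>f. \<Prod>i\<in>A. (\<Phi> f $$ i) ^ \<alpha> i * cnj (\<Phi> f $$ i) ^ \<beta> i)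
        (\<Prod>i\<in>A. if \<alpha> i = \<beta> i then fact (\<alpha> i) else 0)"
      unfolding eq .
  qed
  moreover have "space \<mu> = carrier_mat d d" by (simp add: \<mu>_def T_def)
  ultimately show ?thesis using ent' unfolding gaussian_moments_def A_def by blast
qed

section \<open>Integrals over words\<close>

definition words :: "'a set \<Rightarrow> nat \<Rightarrow> 'a list set" where
  "words A n = {xs. set xs \<subseteq> A \<and> length xs = n}"

lemma finite_words [simp]: "finite A \<Longrightarrow> finite (words A n)"
  unfolding words_def by (rule finite_lists_length_eq)

text \<open>For a tensor given by its coordinates on words, dependence on the multiset alone is
  invariance under permutations of the factors, that is, membership in the symmetric
  subspace.\<close>

definition symmetric_on :: "'a list set \<Rightarrow> ('a list \<Rightarrow> 'b) \<Rightarrow> bool" where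
  "symmetric_on X w \<longleftrightarrow> (\<forall>I\<in>X. \<forall>J\<in>X. mset I = mset J \<longrightarrow> w I = w J)"

abbreviation pairs :: "nat \<Rightarrow> (nat \<times> nat) set" where
  "pairs d \<equiv> {..<d} \<times> {..<d}"

text \<open>The coordinate at I of a tensor power of x, where the matrix x is read as a vector of H
  \<otimes> K.\<close>

definition word_prod :: "complex mat \<Rightarrow> (nat \<times> nat) list \<Rightarrow> complex" where
  "word_prod x I = prod_list (map (\<lambda>i. x $$ i) I)"

definition norm_sq :: "nat \<Rightarrow> complex mat \<Rightarrow> real" where
  "norm_sq d x = (\<Sum>i\<in>pairs d. (cmod (x $$ i))\<^sup>2)"

text \<open>The multi-index factorial \<alpha>! of the monomial \<open>word_prod x I\<close>, which
  is its squared norm in the Gaussian inner product.\<close>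

definition mult_fact :: "nat \<Rightarrow> (nat \<times> nat) list \<Rightarrow> complex" where
  "mult_fact d I = (\<Prod>i\<in>pairs d. fact (count (mset I) i))"

lemma norm_sq_nonneg [simp]: "0 \<le> norm_sq d x"
  by (auto simp: norm_sq_def intro!: sum_nonneg)

lemma word_prod_Nil [simp]: "word_prod x [] = 1"
  and word_prod_Cons [simp]: "word_prod x (i # I) = x $$ i * word_prod x I"
  and word_prod_append: "word_prod x (I @ J) = word_prod x I * word_prod x J"
  by (simp_all add: word_prod_def)

lemma word_prod_eq_prod_count:
  assumes "set I \<subseteq> pairs d"
  shows "word_prod x I = (\<Prod>i\<in>pairs d. (x $$ i) ^ count (mset I) i)"
  using assms
proof (induction I)
  case (Cons a I)
  have "(\<Prod>i\<in>pairs d. (x $$ i) ^ count (mset (a # I)) i)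
      = (\<Prod>i\<in>pairs d. (if i = a then x $$ a else 1) * (x $$ i) ^ count (mset I) i)"
    by (intro prod.cong) auto
  also have "\<dots> = x $$ a * (\<Prod>i\<in>pairs d. (x $$ i) ^ count (mset I) i)"
    using Cons.prems unfolding prod.distrib by (subst prod.delta) auto
  finally show ?case using Cons by simp
qed simp

lemma mult_fact_Cons:
  assumes "a \<in> pairs d"
  shows "mult_fact d (a # I) = of_nat (Suc (count (mset I) a)) * mult_fact d I"
proof -
  have "mult_fact d (a # I)
      = (\<Prod>i\<in>pairs d. (if i = a then of_nat (Suc (count (mset I) a)) else 1) * fact (count (mset I) i))"
    unfolding mult_fact_def by (intro prod.cong) auto
  also have "\<dots> = of_nat (Suc (count (mset I) a)) * mult_fact d I"
    unfolding prod.distrib mult_fact_def using assms by (subst prod.delta) auto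
  finally show ?thesis .
qed

lemma sum_count_mset:
  assumes "finite A" "set I \<subseteq> A"
  shows "(\<Sum>a\<in>A. count (mset I) a) = length I"
  using assms size_multiset_overloaded_eq[of "mset I"]
  by (simp add: sum.mono_neutral_right[of A "set I" "count (mset I)"] count_mset_0_iff)

text \<open>Multinomial count of the rearrangements of I. That the product does not depend on I
  makes the constant in \<open>reproducing\<close> uniform over the symmetric subspace.\<close>

lemma card_same_mset:
  assumes "I \<in> words (pairs d) n"
  shows "of_nat (card {J \<in> words (pairs d) n. mset J = mset I}) * mult_fact d I = fact n"
proof -
  have "{J \<in> words (pairs d) n. mset J = mset I} = permutations_of_multiset (mset I)"
    using assms by (auto simp: words_def permutations_of_multiset_def dest: mset_eq_setD mset_eq_length)
  moreover have "mult_fact d I = of_nat (\<Prod>i\<in>set_mset (mset I). fact (count (mset I) i))"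
    unfolding mult_fact_def of_nat_prod of_nat_fact
    using assms by (intro prod.mono_neutral_right) (auto simp: words_def count_mset_0_iff[THEN iffD2])
  moreover have "size (mset I) = n" using assms by (simp add: words_def)
  ultimately show ?thesis
    using card_permutations_of_multiset_aux[of "mset I"]
    by (metis of_nat_fact of_nat_mult)
qed

text \<open>Two uses: it dominates the quotients by \<open>norm_sq d x ^ k\<close>, and it makes the
  word products vanish wherever that power does.\<close>

lemma norm_word_prod_le:
  assumes "K \<in> words (pairs d) k"
  shows "(cmod (word_prod x K))\<^sup>2 \<le> norm_sq d x ^ k"
  using assms
proof (induction K arbitrary: k)
  case (Cons i K)
  then obtain k' where k: "k = Suc k'" "K \<in> words (pairs d) k'" by (auto simp: words_def)
  have "(cmod (x $$ i))\<^sup>2 \<le> norm_sq d x"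
    unfolding norm_sq_def using Cons.prems by (intro member_le_sum) (auto simp: words_def)
  then have "(cmod (x $$ i))\<^sup>2 * (cmod (word_prod x K))\<^sup>2 \<le> norm_sq d x * norm_sq d x ^ k'"
    using Cons.IH[OF k(2)] by (intro mult_mono) auto
  then show ?case by (simp add: k norm_mult power_mult_distrib)
qed (simp add: words_def)

context
  fixes d M :: nat and \<mu> :: "complex mat measure"
  assumes \<mu>: "gaussian_moments d M \<mu>"
begin

lemma measurable_entry: "i \<in> pairs d \<Longrightarrow> (\<lambda>x. x $$ i) \<in> borel_measurable \<mu>"
  using \<mu> by (auto simp: gaussian_moments_def)

lemma measurable_word_prod:
  assumes "set I \<subseteq> pairs d"
  shows "(\<lambda>x. word_prod x I) \<in> borel_measurable \<mu>"
  using assms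
proof (induction I)
  case (Cons i I)
  then have "(\<lambda>x. x $$ i) \<in> borel_measurable \<mu>" "(\<lambda>x. word_prod x I) \<in> borel_measurable \<mu>"
    using measurable_entry by auto
  then show ?case by simp
qed simp

lemma measurable_norm_sq: "norm_sq d \<in> borel_measurable \<mu>"
proof -
  have "(\<lambda>x. \<Sum>i\<in>pairs d. (cmod (x $$ i))\<^sup>2) \<in> borel_measurable \<mu>"
    using measurable_entry by (intro borel_measurable_sum borel_measurable_power borel_measurable_norm) auto
  then show ?thesis by (simp add: norm_sq_def[abs_def])
qed

lemma word_prod_moment:
  assumes "set I \<subseteq> pairs d" "set J \<subseteq> pairs d" "length I \<le> M" "length J \<le> M"
  shows "has_bochner_integral \<mu> (\<lambda>x. word_prod x I * cnj (word_prod x J))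
     (if mset I = mset J then mult_fact d I else 0)"
proof -
  have le: "count (mset I) i \<le> M" "count (mset J) i \<le> M" for i
    using assms count_le_size[of "mset I" i] count_le_size[of "mset J" i] by auto
  have "has_bochner_integral \<mu>
      (\<lambda>x. \<Prod>i\<in>pairs d. (x $$ i) ^ count (mset I) i * cnj (x $$ i) ^ count (mset J) i)
      (\<Prod>i\<in>pairs d. if count (mset I) i = count (mset J) i then fact (count (mset I) i) else 0)"
    using \<mu> le unfolding gaussian_moments_def by auto
  moreover have "(\<Prod>i\<in>pairs d. (x $$ i) ^ count (mset I) i * cnj (x $$ i) ^ count (mset J) i)
      = word_prod x I * cnj (word_prod x J)" for x
    using assms by (simp add: word_prod_eq_prod_count[of _ d] prod.distrib)
  moreover have "(\<Prod>i\<in>pairs d. if count (mset I) i = count (mset J) i then fact (count (mset I) i) else 0)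
      = (if mset I = mset J then mult_fact d I else 0)"
  proof (cases "mset I = mset J")
    case False
    then obtain i where i: "count (mset I) i \<noteq> count (mset J) i" by (metis multiset_eqI)
    then have "i \<in> set I \<or> i \<in> set J" by (metis count_mset_0_iff)
    with assms have "i \<in> pairs d" by auto
    with i False show ?thesis by (auto intro!: prod_zero)
  qed (simp add: mult_fact_def)
  ultimately show ?thesis by simp
qed

text \<open>Multiplying by one factor \<open>norm_sq\<close> prepends a common letter to both words.\<close>

lemma norm_sq_word_prod_moment:
  assumes "set I \<subseteq> pairs d" "set J \<subseteq> pairs d" "length I = n" "length J = n" "n + k \<le> M"
  shows "has_bochner_integral \<mu> (\<lambda>x. of_real (norm_sq d x ^ k) * (word_prod x I * cnj (word_prod x J)))
     (if mset I = mset J then pochhammer (of_nat (d\<^sup>2 + n)) k * mult_fact d I else 0)"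
  using assms
proof (induction k arbitrary: I J n)
  case 0
  then show ?case using word_prod_moment[of I J] by (cases "mset I = mset J") simp_all
next
  case (Suc k)
  have "has_bochner_integral \<mu>
      (\<lambda>x. \<Sum>a\<in>pairs d. of_real (norm_sq d x ^ k) * (word_prod x (a # I) * cnj (word_prod x (a # J))))
      (\<Sum>a\<in>pairs d. if mset (a # I) = mset (a # J)
          then pochhammer (of_nat (d\<^sup>2 + Suc n)) k * mult_fact d (a # I) else 0)"
    using Suc.prems by (intro has_bochner_integral_sum Suc.IH) auto
  moreover have "(\<Sum>a\<in>pairs d. of_real (norm_sq d x ^ k) * (word_prod x (a # I) * cnj (word_prod x (a # J))))
      = of_real (norm_sq d x ^ Suc k) * (word_prod x I * cnj (word_prod x J))" for x
  proof -
    have "(\<Sum>a\<in>pairs d. of_real (norm_sq d x ^ k) * (word_prod x (a # I) * cnj (word_prod x (a # J))))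
       = (\<Sum>a\<in>pairs d. (x $$ a * cnj (x $$ a)) * (of_real (norm_sq d x ^ k) * (word_prod x I * cnj (word_prod x J))))"
      by (intro sum.cong) (auto simp: mult_ac)
    also have "\<dots> = of_real (norm_sq d x) * (of_real (norm_sq d x ^ k) * (word_prod x I * cnj (word_prod x J)))"
      unfolding sum_distrib_right[symmetric] norm_sq_def of_real_sum complex_norm_square ..
    finally show ?thesis by (simp add: mult_ac)
  qed
  moreover have "(\<Sum>a\<in>pairs d. if mset (a # I) = mset (a # J)
          then pochhammer (of_nat (d\<^sup>2 + Suc n)) k * mult_fact d (a # I) else 0)
      = (if mset I = mset J then pochhammer (of_nat (d\<^sup>2 + n)) (Suc k) * mult_fact d I else 0)"
  proof (cases "mset I = mset J")
    case True
    have "(\<Sum>a\<in>pairs d. pochhammer (of_nat (d\<^sup>2 + Suc n)) k * mult_fact d (a # I))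
        = pochhammer (of_nat (d\<^sup>2 + Suc n)) k * (mult_fact d I * of_nat (\<Sum>a\<in>pairs d. Suc (count (mset I) a)))"
      unfolding of_nat_sum sum_distrib_left by (intro sum.cong refl) (subst mult_fact_Cons, auto)
    \<comment> \<open>The d^2 letters contribute one each and the counts add up to the length n.
      This is the leading factor of the rising factorial; the induction hypothesis supplies the rest
      from d^2 + n + 1 on.\<close>
    also have "(\<Sum>a\<in>pairs d. Suc (count (mset I) a)) = d\<^sup>2 + n"
      using sum_count_mset[of "pairs d" I] Suc.prems by (simp add: sum_Suc power2_eq_square)
    finally have "(\<Sum>a\<in>pairs d. pochhammer (of_nat (d\<^sup>2 + Suc n)) k * mult_fact d (a # I))
        = pochhammer (of_nat (d\<^sup>2 + Suc n)) k * (mult_fact d I * of_nat (d\<^sup>2 + n))" .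
    then show ?thesis using True by (simp add: pochhammer_rec ac_simps)
  qed simp
  ultimately show ?case by simp
qed

text \<open>The average of the projections onto x^n is a multiple of the projection onto the
  symmetric subspace: at I only the rearrangements J of I contribute, all with the value
  \<open>w I\<close>, and their number times \<open>mult_fact d I\<close> is n!. Without weight this
  normalises the measurement; the weighted case produces the ratio of dimensions.\<close>

lemma reproducing:
  assumes w: "symmetric_on (words (pairs d) n) w" and I: "I \<in> words (pairs d) n" and "n + k \<le> M"
  shows "has_bochner_integral \<mu>
     (\<lambda>x. of_real (norm_sq d x ^ k) * (word_prod x I * (\<Sum>J\<in>words (pairs d) n. cnj (word_prod x J) * w J)))
     (fact n * pochhammer (of_nat (d\<^sup>2 + n)) k * w I)"
proof -
  let ?p = "pochhammer (of_nat (d\<^sup>2 + n)) k :: complex"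
  have "has_bochner_integral \<mu>
     (\<lambda>x. \<Sum>J\<in>words (pairs d) n. (of_real (norm_sq d x ^ k) * (word_prod x I * cnj (word_prod x J))) * w J)
     (\<Sum>J\<in>words (pairs d) n. (if mset I = mset J then ?p * mult_fact d I else 0) * w J)"
    using assms
    by (intro has_bochner_integral_sum has_bochner_integral_mult_left norm_sq_word_prod_moment)
      (auto simp: words_def)
  moreover have "(\<Sum>J\<in>words (pairs d) n. (if mset I = mset J then ?p * mult_fact d I else 0) * w J)
      = fact n * ?p * w I"
  proof -
    have "(\<Sum>J\<in>words (pairs d) n. (if mset I = mset J then ?p * mult_fact d I else 0) * w J)
        = (\<Sum>J\<in>words (pairs d) n. if mset J = mset I then ?p * mult_fact d I * w I else 0)"
    proof (intro sum.cong refl)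
      fix J assume "J \<in> words (pairs d) n"
      then have "w J = w I" if "mset I = mset J" using w I that unfolding symmetric_on_def by metis
      then show "(if mset I = mset J then ?p * mult_fact d I else 0) * w J
          = (if mset J = mset I then ?p * mult_fact d I * w I else 0)"
        by (cases "mset I = mset J") simp_all
    qed
    also have "\<dots> = (of_nat (card {J \<in> words (pairs d) n. mset J = mset I}) * mult_fact d I) * ?p * w I"
      by (subst sum.inter_filter[symmetric]) auto
    finally show ?thesis unfolding card_same_mset[OF I] .
  qed
  ultimately show ?thesis by (simp add: sum_distrib_left mult_ac)
qed

text \<open>The divisor is compensated by the words K and K' of length k, so the integrand is
  dominated by the product of the two words of length M, which is a polynomial moment.\<close>

lemma integrable_quotient:
  assumes K: "K \<in> words (pairs d) k" "K' \<in> words (pairs d) k"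
    and J: "J \<in> words (pairs d) M" "J' \<in> words (pairs d) M"
  shows "integrable \<mu> (\<lambda>x. word_prod x K * cnj (word_prod x K') / of_real (norm_sq d x ^ k)
           * (cnj (word_prod x J) * word_prod x J'))"
proof (rule Bochner_Integration.integrable_bound)
  have "has_bochner_integral \<mu> (\<lambda>x. word_prod x J' * cnj (word_prod x J)) (if mset J' = mset J then mult_fact d J' else 0)"
    using J by (intro word_prod_moment) (auto simp: words_def)
  then show "integrable \<mu> (\<lambda>x. word_prod x J' * cnj (word_prod x J))" by (simp add: has_bochner_integral_iff)
  have [measurable]: "norm_sq d \<in> borel_measurable \<mu>" "(\<lambda>x. word_prod x K) \<in> borel_measurable \<mu>"
    "(\<lambda>x. word_prod x K') \<in> borel_measurable \<mu>" "(\<lambda>x. word_prod x J) \<in> borel_measurable \<mu>"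
    "(\<lambda>x. word_prod x J') \<in> borel_measurable \<mu>"
    using measurable_norm_sq measurable_word_prod assms by (auto simp: words_def)
  show "(\<lambda>x. word_prod x K * cnj (word_prod x K') / of_real (norm_sq d x ^ k) * (cnj (word_prod x J) * word_prod x J'))
      \<in> borel_measurable \<mu>" by measurable
  show "AE x in \<mu>. norm (word_prod x K * cnj (word_prod x K') / of_real (norm_sq d x ^ k) * (cnj (word_prod x J) * word_prod x J'))
      \<le> norm (word_prod x J' * cnj (word_prod x J))"
  proof (rule AE_I2)
    fix x
    have n0: "0 \<le> norm_sq d x ^ k" by simp
    have "(cmod (word_prod x K) * cmod (word_prod x K'))\<^sup>2 \<le> norm_sq d x ^ k * norm_sq d x ^ k"
      unfolding power_mult_distrib using norm_word_prod_le K n0 by (intro mult_mono) auto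
    then have "cmod (word_prod x K) * cmod (word_prod x K') \<le> norm_sq d x ^ k"
      using n0 by (metis abs_le_square_iff abs_of_nonneg mult_nonneg_nonneg norm_ge_zero power2_eq_square)
    \<comment> \<open>This includes c = 0, where the quotient is 0 by convention.\<close>
    moreover have "p / c \<le> 1" if "p \<le> c" "0 \<le> c" for p c :: real
      using that by (cases "c = 0") (auto simp: divide_le_eq)
    ultimately have "cmod (word_prod x K) * cmod (word_prod x K') / norm_sq d x ^ k \<le> 1"
      using n0 by blast
    then have "cmod (word_prod x K) * cmod (word_prod x K') / norm_sq d x ^ k * (cmod (word_prod x J) * cmod (word_prod x J'))
        \<le> 1 * (cmod (word_prod x J) * cmod (word_prod x J'))"
      by (intro mult_right_mono) auto
    then show "norm (word_prod x K * cnj (word_prod x K') / of_real (norm_sq d x ^ k) * (cnj (word_prod x J) * word_prod x J'))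
      \<le> norm (word_prod x J' * cnj (word_prod x J))"
      using n0 by (simp add: norm_mult norm_divide norm_power power_abs mult.commute
          flip: of_real_power)
  qed
qed

lemma integrable_overlap:
  assumes "K \<in> words (pairs d) k" "K' \<in> words (pairs d) k"
  shows "integrable \<mu> (\<lambda>x.
     word_prod x K * (\<Sum>J\<in>words (pairs d) M. cnj (word_prod x J) * W J) *
     cnj (word_prod x K' * (\<Sum>J\<in>words (pairs d) M. cnj (word_prod x J) * W' J)) / of_real (norm_sq d x ^ k))"
proof -
  have "integrable \<mu> (\<lambda>x. \<Sum>J\<in>words (pairs d) M. \<Sum>J'\<in>words (pairs d) M.
     (W J * cnj (W' J')) * (word_prod x K * cnj (word_prod x K') / of_real (norm_sq d x ^ k)
        * (cnj (word_prod x J) * word_prod x J')))"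
    by (intro Bochner_Integration.integrable_sum integrable_mult_right integrable_quotient assms)
  moreover have "(\<Sum>J\<in>words (pairs d) M. \<Sum>J'\<in>words (pairs d) M.
     (W J * cnj (W' J')) * (word_prod x K * cnj (word_prod x K') / of_real (norm_sq d x ^ k)
        * (cnj (word_prod x J) * word_prod x J')))
     = word_prod x K * (\<Sum>J\<in>words (pairs d) M. cnj (word_prod x J) * W J) *
     cnj (word_prod x K' * (\<Sum>J\<in>words (pairs d) M. cnj (word_prod x J) * W' J)) / of_real (norm_sq d x ^ k)" for x
  proof -
    have "(\<Sum>J\<in>words (pairs d) M. \<Sum>J'\<in>words (pairs d) M.
     (W J * cnj (W' J')) * (word_prod x K * cnj (word_prod x K') / of_real (norm_sq d x ^ k)
        * (cnj (word_prod x J) * word_prod x J')))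
      = (word_prod x K * cnj (word_prod x K') / of_real (norm_sq d x ^ k)) *
        ((\<Sum>J\<in>words (pairs d) M. cnj (word_prod x J) * W J) *
          cnj (\<Sum>J\<in>words (pairs d) M. cnj (word_prod x J) * W' J))"
      unfolding cnj_sum sum_product unfolding sum_distrib_left
      by (intro sum.cong refl) (simp add: mult_ac)
    then show ?thesis by (simp add: mult_ac)
  qed
  ultimately show ?thesis by simp
qed

text \<open>Writing \<open>a\<close> for the overlap of the state with \<open>x\<^bsup>\<otimes>(M-k)\<^esup>\<close> and \<open>b\<close> for its projection onto
  \<open>x\<^bsup>\<otimes>k\<^esup>\<close>, integrate \<open>0 \<le> | |x|\<^sup>k a - s b / |x|\<^sup>k |\<^sup>2\<close>: the first square and the cross term
  are polynomial in \<open>x\<close>, and the reproducing property evaluates them.\<close>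

lemma overlap_bound:
  fixes Z :: "'z set" and y :: "'z \<Rightarrow> complex" and K :: "'z \<Rightarrow> (nat \<times> nat) list"
    and W :: "'z \<Rightarrow> (nat \<times> nat) list \<Rightarrow> complex" and s :: real
  assumes fin: "finite Z" and k: "k \<le> M"
    and K: "\<And>z. z \<in> Z \<Longrightarrow> K z \<in> words (pairs d) k"
    and W: "\<And>z. z \<in> Z \<Longrightarrow> symmetric_on (words (pairs d) M) (W z)"
    and s: "s\<^sup>2 * fact M = fact (M - k) * pochhammer (real (d\<^sup>2 + (M - k))) k"
  defines "u \<equiv> \<lambda>L. \<Sum>z\<in>Z. y z * W z (K z @ L)"
  defines "b \<equiv> \<lambda>x. \<Sum>z\<in>Z. y z * word_prod x (K z) * (\<Sum>J\<in>words (pairs d) M. cnj (word_prod x J) * W z J)"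
  shows "integrable \<mu> (\<lambda>x. (cmod (b x))\<^sup>2 / norm_sq d x ^ k)" (is ?int)
    and "(2 * s - s\<^sup>2) * fact M * (\<Sum>L\<in>words (pairs d) (M - k). (cmod (u L))\<^sup>2)
        \<le> s\<^sup>2 * integral\<^sup>L \<mu> (\<lambda>x. (cmod (b x))\<^sup>2 / norm_sq d x ^ k)" (is ?ineq)
proof -
  define R where "R = (\<Sum>L\<in>words (pairs d) (M - k). (cmod (u L))\<^sup>2)"
  have Rc: "(\<Sum>L\<in>words (pairs d) (M - k). cnj (u L) * u L) = of_real R"
    unfolding R_def of_real_sum complex_norm_square by (simp add: mult.commute)
  define a where "a x = (\<Sum>L\<in>words (pairs d) (M - k). cnj (word_prod x L) * u L)" for x
  define G where "G z x = (\<Sum>J\<in>words (pairs d) M. cnj (word_prod x J) * W z J)" for z x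
  have KL: "K z @ L \<in> words (pairs d) M" if "z \<in> Z" "L \<in> words (pairs d) (M - k)" for z L
    using K[OF that(1)] that(2) k by (auto simp: words_def)
  have "u I = u J" if "I \<in> words (pairs d) (M - k)" "J \<in> words (pairs d) (M - k)" "mset I = mset J" for I J
    unfolding u_def
  proof (intro sum.cong refl)
    fix z assume z: "z \<in> Z"
    have "W z (K z @ I) = W z (K z @ J)"
      using W[OF z] KL[OF z that(1)] KL[OF z that(2)] that(3)
      unfolding symmetric_on_def by (metis mset_append)
    then show "y z * W z (K z @ I) = y z * W z (K z @ J)" by simp
  qed
  then have u_sym: "symmetric_on (words (pairs d) (M - k)) u"
    unfolding symmetric_on_def by blast
  have cnj_a: "cnj (a x) = (\<Sum>L\<in>words (pairs d) (M - k). word_prod x L * cnj (u L))" for x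
    by (simp add: a_def)

  \<comment> \<open>Expanding the conjugate of \<open>a x\<close> leaves, for each L, the weighted
    integral that \<open>reproducing\<close> evaluates for words of length M - k; the hypothesis on
    \<open>s\<close> writes its constant as s^2 M!.\<close>
  have "has_bochner_integral \<mu>
     (\<lambda>x. \<Sum>L\<in>words (pairs d) (M - k). (of_real (norm_sq d x ^ k) * (word_prod x L * a x)) * cnj (u L))
     (\<Sum>L\<in>words (pairs d) (M - k). (fact (M - k) * pochhammer (of_nat (d\<^sup>2 + (M - k))) k * u L) * cnj (u L))"
    unfolding a_def using k
    by (intro has_bochner_integral_sum has_bochner_integral_mult_left reproducing u_sym) auto
  moreover have "(\<Sum>L\<in>words (pairs d) (M - k). (of_real (norm_sq d x ^ k) * (word_prod x L * a x)) * cnj (u L))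
      = of_real (norm_sq d x ^ k * (cmod (a x))\<^sup>2)" for x
    unfolding of_real_mult complex_norm_square cnj_a sum_distrib_left by (simp add: mult_ac)
  moreover have "(\<Sum>L\<in>words (pairs d) (M - k). (fact (M - k) * pochhammer (of_nat (d\<^sup>2 + (M - k))) k * u L) * cnj (u L))
      = of_real (s\<^sup>2 * fact M * R)"
  proof -
    have "(\<Sum>L\<in>words (pairs d) (M - k). (fact (M - k) * pochhammer (of_nat (d\<^sup>2 + (M - k))) k * u L) * cnj (u L))
       = fact (M - k) * pochhammer (of_nat (d\<^sup>2 + (M - k))) k * of_real R"
      unfolding Rc[symmetric] sum_distrib_left by (simp add: mult_ac)
    also have "\<dots> = of_real (fact (M - k) * pochhammer (real (d\<^sup>2 + (M - k))) k * R)"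
    proof -
      have "pochhammer (of_nat m) k = complex_of_real (pochhammer (real m) k)" for m
        using pochhammer_of_real[of "real m" k, where 'a=complex] by simp
      then show ?thesis by (simp only: of_real_mult of_real_fact)
    qed
    finally show ?thesis unfolding s .
  qed
  ultimately have "has_bochner_integral \<mu> (\<lambda>x. complex_of_real (norm_sq d x ^ k * (cmod (a x))\<^sup>2))
      (of_real (s\<^sup>2 * fact M * R))" by simp
  from has_bochner_integral_bounded_linear[OF bounded_linear_Re this]
  have I1: "has_bochner_integral \<mu> (\<lambda>x. norm_sq d x ^ k * (cmod (a x))\<^sup>2) (s\<^sup>2 * fact M * R)"
    by (simp only: Re_complex_of_real)

  \<comment> \<open>The word \<open>K z\<close> from \<open>b\<close> and the word L from
    \<open>a\<close> join to one of length M, so \<open>reproducing\<close> applies without weight,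
    and the sum over z gives back \<open>u L\<close>.\<close>
  have "has_bochner_integral \<mu>
     (\<lambda>x. \<Sum>L\<in>words (pairs d) (M - k). \<Sum>z\<in>Z.
        (of_real (norm_sq d x ^ 0) * (word_prod x (K z @ L) * G z x)) * (y z * cnj (u L)))
     (\<Sum>L\<in>words (pairs d) (M - k). \<Sum>z\<in>Z.
        (fact M * pochhammer (of_nat (d\<^sup>2 + M)) 0 * W z (K z @ L)) * (y z * cnj (u L)))"
    unfolding G_def
    by (intro has_bochner_integral_sum has_bochner_integral_mult_left reproducing W KL) auto
  moreover have "(\<Sum>L\<in>words (pairs d) (M - k). \<Sum>z\<in>Z.
        (of_real (norm_sq d x ^ 0) * (word_prod x (K z @ L) * G z x)) * (y z * cnj (u L)))
      = cnj (a x) * b x" for x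
    unfolding b_def cnj_a G_def[symmetric] sum_product
    by (intro sum.cong refl) (simp add: word_prod_append)
  moreover have "(\<Sum>L\<in>words (pairs d) (M - k). \<Sum>z\<in>Z.
        (fact M * pochhammer (of_nat (d\<^sup>2 + M)) 0 * W z (K z @ L)) * (y z * cnj (u L)))
      = of_real (fact M * R)"
  proof -
    have "(\<Sum>L\<in>words (pairs d) (M - k). \<Sum>z\<in>Z.
        (fact M * pochhammer (of_nat (d\<^sup>2 + M)) 0 * W z (K z @ L)) * (y z * cnj (u L)))
       = fact M * (\<Sum>L\<in>words (pairs d) (M - k). cnj (u L) * u L)"
      unfolding sum_distrib_left
    proof (intro sum.cong refl)
      fix L
      have "(\<Sum>z\<in>Z. (fact M * pochhammer (of_nat (d\<^sup>2 + M)) 0 * W z (K z @ L)) * (y z * cnj (u L)))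
          = fact M * (cnj (u L) * (\<Sum>z\<in>Z. y z * W z (K z @ L)))"
        unfolding sum_distrib_left by (simp add: mult_ac)
      then show "(\<Sum>z\<in>Z. (fact M * pochhammer (of_nat (d\<^sup>2 + M)) 0 * W z (K z @ L)) * (y z * cnj (u L)))
          = fact M * (cnj (u L) * u L)"
        by (simp only: u_def)
    qed
    then show ?thesis unfolding Rc by simp
  qed
  ultimately have "has_bochner_integral \<mu> (\<lambda>x. cnj (a x) * b x) (of_real (fact M * R))" by simp
  from has_bochner_integral_bounded_linear[OF bounded_linear_Re this]
  have I2: "has_bochner_integral \<mu> (\<lambda>x. Re (cnj (a x) * b x)) (fact M * R)"
    by (simp only: Re_complex_of_real)

  have "integrable \<mu> (\<lambda>x. \<Sum>z\<in>Z. \<Sum>z'\<in>Z. (y z * cnj (y z')) *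
     (word_prod x (K z) * G z x * cnj (word_prod x (K z') * G z' x) / of_real (norm_sq d x ^ k)))"
    unfolding G_def
    by (intro Bochner_Integration.integrable_sum integrable_mult_right integrable_overlap K)
  moreover have "(\<Sum>z\<in>Z. \<Sum>z'\<in>Z. (y z * cnj (y z')) *
     (word_prod x (K z) * G z x * cnj (word_prod x (K z') * G z' x) / of_real (norm_sq d x ^ k)))
     = of_real ((cmod (b x))\<^sup>2 / norm_sq d x ^ k)" for x
    unfolding b_def G_def[symmetric] of_real_divide complex_norm_square cnj_sum sum_product sum_divide_distrib
    by (intro sum.cong refl) (simp add: mult_ac)
  ultimately have "integrable \<mu> (\<lambda>x. complex_of_real ((cmod (b x))\<^sup>2 / norm_sq d x ^ k))" by simp
  from integrable_bounded_linear[OF bounded_linear_Re this] show ?int by (simp only: Re_complex_of_real)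

  have "(\<integral>x. 2 * s * Re (cnj (a x) * b x) \<partial>\<mu>)
      \<le> (\<integral>x. norm_sq d x ^ k * (cmod (a x))\<^sup>2 + s\<^sup>2 * ((cmod (b x))\<^sup>2 / norm_sq d x ^ k) \<partial>\<mu>)"
  proof (rule integral_mono)
    show "integrable \<mu> (\<lambda>x. 2 * s * Re (cnj (a x) * b x))"
      using I2 by (intro integrable_mult_right) (auto simp only: has_bochner_integral_iff)
    show "integrable \<mu> (\<lambda>x. norm_sq d x ^ k * (cmod (a x))\<^sup>2 + s\<^sup>2 * ((cmod (b x))\<^sup>2 / norm_sq d x ^ k))"
      using I1 \<open>?int\<close>
      by (intro Bochner_Integration.integrable_add integrable_mult_right) (auto simp only: has_bochner_integral_iff)
    fix x
    show "2 * s * Re (cnj (a x) * b x)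
        \<le> norm_sq d x ^ k * (cmod (a x))\<^sup>2 + s\<^sup>2 * ((cmod (b x))\<^sup>2 / norm_sq d x ^ k)"
    \<comment> \<open>If |x|^k = 0, every word of length k vanishes at x, hence so does
      \<open>b x\<close>, and the quotient by 0 is 0. Otherwise the claim follows from (q |a| - |s|
      |b| / q)^2 \<ge> 0 with q = |x|^k.\<close>
    proof (cases "norm_sq d x ^ k = 0")
      case True
      have "word_prod x (K z) = 0" if "z \<in> Z" for z
        using norm_word_prod_le[OF K[OF that], of x] True by simp
      then have "b x = 0" by (simp add: b_def)
      then show ?thesis using True by simp
    next
      case False
      define q where "q = sqrt (norm_sq d x ^ k)"
      have n0: "0 < norm_sq d x ^ k"
        using False norm_sq_nonneg[of d x] by (metis less_le zero_le_power)
      have q: "q > 0" "q\<^sup>2 = norm_sq d x ^ k"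
        unfolding q_def using real_sqrt_gt_zero[OF n0] real_sqrt_pow2[OF less_imp_le[OF n0]] by auto
      have "0 \<le> (q * cmod (a x) - \<bar>s\<bar> * cmod (b x) / q)\<^sup>2" by simp
      also have "\<dots> = q\<^sup>2 * (cmod (a x))\<^sup>2 + s\<^sup>2 * ((cmod (b x))\<^sup>2 / q\<^sup>2) - 2 * (\<bar>s\<bar> * (cmod (a x) * cmod (b x)))"
        using q(1) by (simp add: power2_diff power_mult_distrib power_divide)
      finally have "2 * (\<bar>s\<bar> * (cmod (a x) * cmod (b x))) \<le> q\<^sup>2 * (cmod (a x))\<^sup>2 + s\<^sup>2 * ((cmod (b x))\<^sup>2 / q\<^sup>2)"
        by simp
      moreover have "s * Re (cnj (a x) * b x) \<le> \<bar>s\<bar> * (cmod (a x) * cmod (b x))"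
      proof -
        have "s * Re (cnj (a x) * b x) \<le> \<bar>s\<bar> * \<bar>Re (cnj (a x) * b x)\<bar>"
          unfolding abs_mult[symmetric] by (rule abs_ge_self)
        also have "\<dots> \<le> \<bar>s\<bar> * cmod (cnj (a x) * b x)"
          by (intro mult_left_mono abs_Re_le_cmod) simp
        finally show ?thesis by (simp add: norm_mult)
      qed
      ultimately show ?thesis unfolding q(2) by linarith
    qed
  qed
  also have "\<dots> = s\<^sup>2 * fact M * R + s\<^sup>2 * integral\<^sup>L \<mu> (\<lambda>x. (cmod (b x))\<^sup>2 / norm_sq d x ^ k)"
  proof -
    have "integrable \<mu> (\<lambda>x. s\<^sup>2 * ((cmod (b x))\<^sup>2 / norm_sq d x ^ k))"
      by (rule integrable_mult_right) (rule \<open>?int\<close>)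
    then have "has_bochner_integral \<mu> (\<lambda>x. s\<^sup>2 * ((cmod (b x))\<^sup>2 / norm_sq d x ^ k))
        (s\<^sup>2 * integral\<^sup>L \<mu> (\<lambda>x. (cmod (b x))\<^sup>2 / norm_sq d x ^ k))"
      unfolding has_bochner_integral_iff by (simp only: integral_mult_right_zero)
    from has_bochner_integral_integral_eq[OF has_bochner_integral_add[OF I1 this]] show ?thesis .
  qed
  finally have "2 * s * (fact M * R) \<le> s\<^sup>2 * fact M * R + s\<^sup>2 * integral\<^sup>L \<mu> (\<lambda>x. (cmod (b x))\<^sup>2 / norm_sq d x ^ k)"
    using I2 by (simp add: has_bochner_integral_iff del: times_complex.sel)
  then show ?ineq unfolding R_def[symmetric] by (simp add: algebra_simps)
qed

end

section \<open>Words as matrix indices\<close>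

lemma sum_lessThan_mult:
  fixes f :: "nat \<Rightarrow> 'a :: comm_monoid_add"
  shows "(\<Sum>c<m * n. f c) = (\<Sum>r<m. \<Sum>l<n. f (r * n + l))"
proof -
  have "(\<Sum>c<m * n. f c) = (\<Sum>r<m. sum f {r * n..<r * n + n})" by (simp add: sum.nat_group)
  also have "\<dots> = (\<Sum>r<m. \<Sum>l<n. f (r * n + l))"
  proof (rule sum.cong[OF refl])
    fix r
    show "sum f {r * n..<r * n + n} = (\<Sum>l<n. f (r * n + l))"
      using sum.shift_bounds_nat_ivl[of f 0 "r * n" n] by (simp add: add.commute lessThan_atLeast0)
  qed
  finally show ?thesis .
qed

lemma index_less_mult: "r < m \<Longrightarrow> l < n \<Longrightarrow> r * n + l < m * (n :: nat)"
proof -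
  assume "r < m" "l < n"
  then have "r * n + l < Suc r * n" by simp
  also have "\<dots> \<le> m * n" using \<open>r < m\<close> by (intro mult_le_mono1) simp
  finally show ?thesis .
qed

text \<open>Most significant letter first, as for the Kronecker product.\<close>

fun word_index :: "nat \<Rightarrow> nat list \<Rightarrow> nat" where
  "word_index d [] = 0"
| "word_index d (x # xs) = x * d ^ length xs + word_index d xs"

lemma word_index_less: "xs \<in> words {..<d} n \<Longrightarrow> word_index d xs < d ^ n"
proof (induction xs arbitrary: n)
  case (Cons x xs)
  then have "word_index d xs < d ^ length xs" "x < d" "n = Suc (length xs)" by (auto simp: words_def)
  then show ?case by (simp add: index_less_mult)
qed (simp add: words_def)

lemma word_index_append: "word_index d (xs @ ys) = word_index d xs * d ^ length ys + word_index d ys"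
  by (induction xs) (auto simp: power_add algebra_simps)

lemma word_index_inj: "inj_on (word_index d) (words {..<d} n)"
proof (rule inj_onI)
  fix xs ys assume "xs \<in> words {..<d} n" "ys \<in> words {..<d} n" "word_index d xs = word_index d ys"
  then show "xs = ys"
  proof (induction xs arbitrary: ys n)
    case Nil
    then show ?case by (simp add: words_def)
  next
    case (Cons x xs)
    then have "length ys = Suc (length xs)" by (simp add: words_def)
    then obtain y ys' where ys: "ys = y # ys'" by (cases ys) auto
    have mem: "xs \<in> words {..<d} (n - 1)" "ys' \<in> words {..<d} (n - 1)" and len: "length ys' = length xs"
      using Cons.prems ys by (auto simp: words_def)
    let ?N = "d ^ length xs"
    have lt: "word_index d xs < ?N" "word_index d ys' < ?N"
      using word_index_less[OF mem(1)] word_index_less[OF mem(2)] mem len by (auto simp: words_def)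
    have eq: "x * ?N + word_index d xs = y * ?N + word_index d ys'"
      using Cons.prems ys len by simp
    have N0: "?N \<noteq> 0" using lt by linarith
    have "x = y"
      using arg_cong[OF eq, of "\<lambda>a. a div ?N"] lt
      by (simp only: div_mult_self3[OF N0] div_less add_0_right)
    moreover have "word_index d xs = word_index d ys'"
      using arg_cong[OF eq, of "\<lambda>a. a mod ?N"] lt by (simp only: mod_mult_self3 mod_less)
    ultimately show ?case using Cons.IH[OF mem] ys by simp
  qed
qed

lemma bij_word_index: "bij_betw (word_index d) (words {..<d} n) {..<d ^ n}"
  unfolding bij_betw_def
proof (intro conjI word_index_inj card_subset_eq)
  show "word_index d ` words {..<d} n \<subseteq> {..<d ^ n}" using word_index_less by auto
  show "card (word_index d ` words {..<d} n) = card {..<d ^ n}"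
    by (simp add: card_image[OF word_index_inj]) (simp add: words_def card_lists_length_eq)
qed simp

lemma sum_word_index: "(\<Sum>l<d ^ n. f l) = (\<Sum>xs\<in>words {..<d} n. f (word_index d xs))"
  using sum.reindex_bij_betw[OF bij_word_index, of f d n] by simp

lemma digit_word_index:
  "xs \<in> words {..<d} n \<Longrightarrow> m < n \<Longrightarrow> digit d (word_index d xs) m = rev xs ! m"
proof (induction xs arbitrary: n)
  case (Cons x xs)
  then have mem: "xs \<in> words {..<d} (n - 1)" and x: "x < d" and n: "n = Suc (length xs)"
    by (auto simp: words_def)
  have lt: "word_index d xs < d ^ length xs" using word_index_less[OF mem] n by simp
  show ?case
  proof (cases "m = length xs")
    case True
    then show ?thesis using lt x by (simp add: digit_def nth_append)
  next
    case False
    then have m: "m < length xs" using Cons.prems n by simp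
    \<comment> \<open>The leading letter contributes a multiple of d^(m+1), which digit m does not
      see.\<close>
    then have "length xs = (length xs - m - 1) + 1 + m" by simp
    then have "d ^ length xs = d ^ (length xs - m - 1) * d * d ^ m"
      by (metis power_add power_one_right)
    then have "(x * d ^ length xs + word_index d xs) div d ^ m mod d
        = (x * d ^ (length xs - m - 1) * d * d ^ m + word_index d xs) div d ^ m mod d"
      by (simp add: mult.assoc)
    also have "\<dots> = (word_index d xs div d ^ m) mod d"
      using x by (subst div_mult_self3) auto
    finally show ?thesis using Cons.IH[OF mem] m n by (simp add: digit_def nth_append)
  qed
qed (simp add: words_def)

text \<open>Reversal converts between most-significant-first words and the digits numbered by \<open>digit\<close>.\<close>

definition permute_word :: "(nat \<Rightarrow> nat) \<Rightarrow> 'a list \<Rightarrow> 'a list" where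
  "permute_word \<pi> xs = rev (permute_list \<pi> (rev xs))"

lemma permute_word_words:
  assumes "\<pi> permutes {..<n}" "xs \<in> words A n"
  shows "permute_word \<pi> xs \<in> words A n"
  using assms set_permute_list[of \<pi> "rev xs"] by (auto simp: words_def permute_word_def)

lemma permute_word_map:
  assumes "\<pi> permutes {..<length xs}"
  shows "permute_word \<pi> (map f xs) = map f (permute_word \<pi> xs)"
  using permute_list_map[of \<pi> "rev xs" f] assms by (simp add: permute_word_def rev_map)

lemma permute_word_inj:
  assumes "\<pi> permutes {..<n}"
  shows "inj_on (permute_word \<pi>) (words A n)"
proof (rule inj_onI)
  fix xs ys assume xs: "xs \<in> words A n" "ys \<in> words A n" "permute_word \<pi> xs = permute_word \<pi> ys"
  then have eq: "permute_list \<pi> (rev xs) = permute_list \<pi> (rev ys)" and len: "length xs = n" "length ys = n"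
    by (auto simp: permute_word_def words_def)
  have "rev xs ! m = rev ys ! m" if "m < n" for m
  proof -
    have "m \<in> \<pi> ` {..<n}" using permutes_image[OF assms] that by simp
    then obtain m' where m': "m' < n" "\<pi> m' = m" by auto
    then have "rev xs ! \<pi> m' = rev ys ! \<pi> m'"
      using eq len assms by (metis length_rev permute_list_nth)
    then show ?thesis using m' by simp
  qed
  then have "rev xs = rev ys" using len by (intro nth_equalityI) auto
  then show "xs = ys" by simp
qed

text \<open>Read from the least significant end, the digit condition of \<open>perm_op\<close> says
  that two permuted words agree; permuting is injective, so the row has a single nonzero
  entry.\<close>

lemma perm_op_row:
  assumes \<pi>: "\<pi> permutes {..<n}" and js: "js \<in> words {..<d} n" and a: "a < d ^ n"
  shows "perm_op d n \<pi> $$ (word_index d (permute_word \<pi> js), a) = (if a = word_index d js then 1 else 0)"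
proof -
  obtain bs where bs: "bs \<in> words {..<d} n" "a = word_index d bs"
    using a bij_word_index[of d n] by (auto simp: bij_betw_def image_iff)
  note pj = permute_word_words[OF \<pi> js]
  have len: "length js = n" "length bs = n" using js bs by (auto simp: words_def)
  have in_n: "\<pi> m < n" if "m < n" for m using permutes_in_image[OF \<pi>] that by simp
  have pl: "permute_list \<pi> (rev xs) ! m = rev xs ! \<pi> m" if "m < n" "length xs = n" for m and xs :: "nat list"
    using \<pi> that by (simp add: permute_list_nth)
  have "digit d (word_index d (permute_word \<pi> js)) m = rev js ! \<pi> m" if "m < n" for m
    using digit_word_index[OF pj that] pl[OF that len(1)] by (simp add: permute_word_def)
  moreover have "digit d a (\<pi> m) = rev bs ! \<pi> m" if "m < n" for m
    using digit_word_index[OF bs(1) in_n[OF that]] bs(2) by simp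
  ultimately have "(\<forall>m<n. digit d (word_index d (permute_word \<pi> js)) m = digit d a (\<pi> m))
      \<longleftrightarrow> (\<forall>m<n. rev js ! \<pi> m = rev bs ! \<pi> m)" by simp
  also have "\<dots> \<longleftrightarrow> permute_list \<pi> (rev js) = permute_list \<pi> (rev bs)"
    unfolding list_eq_iff_nth_eq using len pl by simp
  also have "\<dots> \<longleftrightarrow> permute_word \<pi> js = permute_word \<pi> bs"
    by (simp add: permute_word_def)
  also have "\<dots> \<longleftrightarrow> js = bs"
    using permute_word_inj[OF \<pi>] js bs by (auto simp: inj_on_def)
  also have "\<dots> \<longleftrightarrow> a = word_index d js"
    using word_index_inj[of d n] js bs by (auto simp: inj_on_def)
  finally show ?thesis using word_index_less[OF pj] a by (simp add: perm_op_def)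
qed

lemma perm_invariant_entries:
  assumes X: "X \<in> carrier_mat (d ^ n) (d ^ n)" and \<pi>: "\<pi> permutes {..<n}"
    and inv: "perm_op d n \<pi> * X * adj (perm_op d n \<pi>) = X"
    and us: "us \<in> words {..<d} n" and js: "js \<in> words {..<d} n"
  shows "X $$ (word_index d (permute_word \<pi> us), word_index d (permute_word \<pi> js))
    = X $$ (word_index d us, word_index d js)"
proof -
  let ?P = "perm_op d n \<pi>" and ?N = "d ^ n"
  let ?i = "word_index d (permute_word \<pi> us)" and ?j = "word_index d (permute_word \<pi> js)"
  have P: "?P \<in> carrier_mat ?N ?N" by (simp add: perm_op_def)
  have i: "?i < ?N" and j: "?j < ?N"
    using word_index_less[OF permute_word_words[OF \<pi>]] us js by auto
  have PX: "(?P * X) $$ (?i, b) = X $$ (word_index d us, b)" if "b < ?N" for b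
  proof -
    have "(?P * X) $$ (?i, b) = (\<Sum>a<?N. if a = word_index d us then X $$ (a, b) else 0)"
      unfolding mult_index[OF P X i that] by (intro sum.cong refl) (simp add: perm_op_row[OF \<pi> us])
    then show ?thesis using word_index_less[OF us] by simp
  qed
  have "X $$ (?i, ?j) = (?P * X * adj ?P) $$ (?i, ?j)" using inv by simp
  also have "\<dots> = (\<Sum>b<?N. (?P * X) $$ (?i, b) * adj ?P $$ (b, ?j))"
    by (rule mult_index[of _ ?N ?N _ ?N]) (use P X i j in auto)
  also have "\<dots> = (\<Sum>b<?N. if b = word_index d js then X $$ (word_index d us, b) else 0)"
    using P j by (intro sum.cong refl) (auto simp: PX perm_op_row[OF \<pi> js])
  finally show ?thesis using word_index_less[OF js] by simp
qed

section \<open>Symmetry of the positive root and purification of the channel\<close>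

lemma psd_rank_one: "psd n (mat n n (\<lambda>(i, j). f i * cnj (f j)))"
  unfolding psd_iff_qform
proof (intro conjI allI)
  fix v
  have "qform n (mat n n (\<lambda>(i, j). f i * cnj (f j))) v = (\<Sum>i<n. \<Sum>j<n. (cnj (v i) * f i) * (v j * cnj (f j)))"
    unfolding qform_def by (intro sum.cong refl) (simp add: mult_ac)
  also have "\<dots> = (\<Sum>i<n. cnj (v i) * f i) * cnj (\<Sum>i<n. cnj (v i) * f i)"
    by (simp add: sum_product)
  finally show "0 \<le> qform n (mat n n (\<lambda>(i, j). f i * cnj (f j))) v"
    by (simp only: complex_norm_square[symmetric]) (simp add: less_eq_complex_def)
qed simp

text \<open>Relabelling rows and columns of S by \<tau> gives another positive matrix, and its
  square is the relabelled square of S, hence the same square. Uniqueness of the root identifies the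
  two.\<close>

lemma psd_sqrt_invariant:
  assumes S: "psd n S" and \<tau>: "bij_betw \<tau> {..<n} {..<n}"
    and inv: "\<And>a b. a < n \<Longrightarrow> b < n \<Longrightarrow> (S * S) $$ (\<tau> a, \<tau> b) = (S * S) $$ (a, b)"
    and ab: "a < n" "b < n"
  shows "S $$ (\<tau> a, \<tau> b) = S $$ (a, b)"
proof -
  have Sc: "S \<in> carrier_mat n n" using S by (simp add: psd_def)
  have \<tau>n: "\<tau> a < n" if "a < n" for a using \<tau> that by (auto simp: bij_betw_def)
  define T where "T = mat n n (\<lambda>(a, b). S $$ (\<tau> a, \<tau> b))"
  have Tc: "T \<in> carrier_mat n n" by (simp add: T_def)
  have "psd n T"
    unfolding psd_iff_qform
  proof (intro conjI allI Tc)
    fix v :: "nat \<Rightarrow> complex"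
    let ?v = "\<lambda>a. v (inv_into {..<n} \<tau> a)"
    have v: "?v (\<tau> a) = v a" if "a < n" for a
      using that \<tau> by (simp add: bij_betw_inv_into_left)
    have "qform n T v = (\<Sum>a<n. \<Sum>b<n. cnj (?v (\<tau> a)) * S $$ (\<tau> a, \<tau> b) * ?v (\<tau> b))"
      unfolding qform_def by (intro sum.cong refl) (simp add: T_def v)
    also have "\<dots> = (\<Sum>a<n. \<Sum>b<n. cnj (?v (\<tau> a)) * S $$ (\<tau> a, b) * ?v b)"
      by (intro sum.cong refl sum.reindex_bij_betw[OF \<tau>])
    also have "\<dots> = qform n S ?v"
      unfolding qform_def by (rule sum.reindex_bij_betw[OF \<tau>])
    finally show "0 \<le> qform n T v" using S by (simp add: psd_iff_qform)
  qed
  moreover have "T * T = S * S"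
  proof (rule eq_matI)
    fix a b assume "a < dim_row (S * S)" "b < dim_col (S * S)"
    then have ab: "a < n" "b < n" using Sc by auto
    have "(T * T) $$ (a, b) = (\<Sum>c<n. S $$ (\<tau> a, \<tau> c) * S $$ (\<tau> c, \<tau> b))"
      unfolding mult_index[OF Tc Tc ab] using ab by (intro sum.cong refl) (simp add: T_def)
    also have "\<dots> = (\<Sum>c<n. S $$ (\<tau> a, c) * S $$ (c, \<tau> b))"
      by (rule sum.reindex_bij_betw[OF \<tau>])
    also have "\<dots> = (S * S) $$ (\<tau> a, \<tau> b)"
      using mult_index[OF Sc Sc \<tau>n[OF ab(1)] \<tau>n[OF ab(2)]] by simp
    finally show "(T * T) $$ (a, b) = (S * S) $$ (a, b)" using inv[OF ab] by simp
  qed (use Tc Sc in auto)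
  ultimately have "T = S" by (rule psd_sqrt_unique[OF _ S])
  show ?thesis using arg_cong[OF \<open>T = S\<close>, of "\<lambda>X. X $$ (a, b)"] ab by (simp add: T_def)
qed

definition matrix_unit :: "nat \<Rightarrow> nat \<Rightarrow> nat \<Rightarrow> complex mat" where
  "matrix_unit n p q = mat n n (\<lambda>(a, b). if a = p \<and> b = q then 1 else 0)"

text \<open>Additivity is available for two summands at a time, so the expansion in matrix units is
  built by induction on the set F of entries of A that have been kept.\<close>

lemma linear_map_expand:
  assumes L: "Defs.linear_map din dout \<Phi>" and A: "A \<in> carrier_mat din din" and ij: "i < dout" "j < dout"
  shows "\<Phi> A $$ (i, j) = (\<Sum>p<din. \<Sum>q<din. A $$ (p, q) * \<Phi> (matrix_unit din p q) $$ (i, j))"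
proof -
  have car: "\<And>A. A \<in> carrier_mat din din \<Longrightarrow> \<Phi> A \<in> carrier_mat dout dout"
    and add: "\<And>A B. A \<in> carrier_mat din din \<Longrightarrow> B \<in> carrier_mat din din \<Longrightarrow> \<Phi> (A + B) = \<Phi> A + \<Phi> B"
    and sm: "\<And>A c. A \<in> carrier_mat din din \<Longrightarrow> \<Phi> (c \<cdot>\<^sub>m A) = c \<cdot>\<^sub>m \<Phi> A"
    using L by (auto simp: Defs.linear_map_def)
  have uc: "matrix_unit din p q \<in> carrier_mat din din" for p q by (simp add: matrix_unit_def)
  have "\<Phi> (mat din din (\<lambda>x. if x \<in> F then A $$ x else 0)) $$ (i, j)
      = (\<Sum>(p, q)\<in>F. A $$ (p, q) * \<Phi> (matrix_unit din p q) $$ (i, j))"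
    if "finite F" "F \<subseteq> {..<din} \<times> {..<din}" for F
    using that
  proof (induction F rule: finite_induct)
    case empty
    have "mat din din (\<lambda>x. if x \<in> {} then A $$ x else 0) = 0 \<cdot>\<^sub>m (0\<^sub>m din din)"
      by (intro eq_matI) auto
    then have "\<Phi> (mat din din (\<lambda>x. if x \<in> {} then A $$ x else 0)) = 0 \<cdot>\<^sub>m \<Phi> (0\<^sub>m din din)"
      using sm[of "0\<^sub>m din din" 0] by simp
    moreover have "\<Phi> (0\<^sub>m din din) \<in> carrier_mat dout dout" by (rule car) simp
    ultimately show ?case using ij by simp
  next
    case (insert x F)
    obtain p q where x: "x = (p, q)" by (cases x)
    have split: "mat din din (\<lambda>y. if y \<in> insert x F then A $$ y else 0)
        = A $$ x \<cdot>\<^sub>m matrix_unit din p q + mat din din (\<lambda>y. if y \<in> F then A $$ y else 0)"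
      using insert.hyps by (intro eq_matI) (auto simp: x matrix_unit_def)
    have "\<Phi> (mat din din (\<lambda>y. if y \<in> insert x F then A $$ y else 0))
        = A $$ x \<cdot>\<^sub>m \<Phi> (matrix_unit din p q) + \<Phi> (mat din din (\<lambda>y. if y \<in> F then A $$ y else 0))"
      unfolding split using uc by (subst add) (auto simp: sm)
    moreover have "\<Phi> (mat din din (\<lambda>y. if y \<in> F then A $$ y else 0)) \<in> carrier_mat dout dout"
      by (rule car) simp
    ultimately show ?case using insert ij car[OF uc, of p q] x by simp
  qed
  from this[of "{..<din} \<times> {..<din}"]
  have "\<Phi> (mat din din (\<lambda>x. if x \<in> {..<din} \<times> {..<din} then A $$ x else 0)) $$ (i, j)
     = (\<Sum>p<din. \<Sum>q<din. A $$ (p, q) * \<Phi> (matrix_unit din p q) $$ (i, j))"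
    by (simp add: sum.cartesian_product)
  moreover have "mat din din (\<lambda>x. if x \<in> {..<din} \<times> {..<din} then A $$ x else 0) = A"
    using A by (intro eq_matI) auto
  ultimately show ?thesis by simp
qed

lemma word_index_surj:
  assumes "i < d ^ n"
  obtains xs where "xs \<in> words {..<d} n" "i = word_index d xs"
  using assms bij_word_index[of d n] by (auto simp: bij_betw_def image_iff set_eq_iff)

lemma block_index_surj:
  assumes "a < m * d ^ n"
  obtains p xs where "p < m" "xs \<in> words {..<d} n" "a = p * d ^ n + word_index d xs"
proof -
  have "d ^ n > 0" using assms by (cases "d ^ n") auto
  then have "a mod d ^ n < d ^ n" "a div d ^ n < m"
    using assms by (auto simp: less_mult_imp_div_less)
  moreover from word_index_surj[OF this(1)] obtain xs where "xs \<in> words {..<d} n" "a mod d ^ n = word_index d xs"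
    by blast
  ultimately show ?thesis using that[of "a div d ^ n" xs] by (metis div_mult_mod_eq)
qed

text \<open>The amplitudes are the blocks of the positive square root of the Choi operator; uniqueness of
  that root makes them inherit the permutation symmetry of the channel.\<close>

lemma symmetric_purification:
  fixes \<E> :: "complex mat \<Rightarrow> complex mat"
  assumes d: "0 < d" and E: "sym_broadcast din d M \<E>"
  obtains w :: "nat \<Rightarrow> nat \<Rightarrow> (nat \<times> nat) list \<Rightarrow> complex" where
    "\<And>p r. p < din \<Longrightarrow> r < din \<Longrightarrow> symmetric_on (words (pairs d) M) (w p r)"
    "\<And>\<rho> us vs. \<rho> \<in> carrier_mat din din \<Longrightarrow> us \<in> words {..<d} M \<Longrightarrow> vs \<in> words {..<d} M \<Longrightarrow>
       \<E> \<rho> $$ (word_index d us, word_index d vs) = (\<Sum>p<din. \<Sum>q<din. \<rho> $$ (p, q) *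
         (\<Sum>r<din. \<Sum>ls\<in>words {..<d} M. w p r (zip us ls) * cnj (w q r (zip vs ls))))"
proof -
  define N where "N = d ^ M"
  have N: "0 < N" using d by (simp add: N_def)
  have lin: "Defs.linear_map din N \<E>"
    and cp: "\<And>n X. psd (n * din) X \<Longrightarrow> psd (n * N) (ext_map n din N \<E> X)"
    and sym: "\<And>\<rho> \<pi>. \<rho> \<in> carrier_mat din din \<Longrightarrow> \<pi> permutes {..<M} \<Longrightarrow>
        perm_op d M \<pi> * \<E> \<rho> * adj (perm_op d M \<pi>) = \<E> \<rho>"
    using E by (auto simp: sym_broadcast_def channel_def N_def)
  have Ec: "\<E> \<rho> \<in> carrier_mat N N" if "\<rho> \<in> carrier_mat din din" for \<rho>
    using lin that by (simp add: Defs.linear_map_def)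
  have uc: "matrix_unit din p q \<in> carrier_mat din din" for p q by (simp add: matrix_unit_def)
  \<comment> \<open>The unnormalised maximally entangled vector on two copies of the input space,
    which makes \<open>C\<close> the Choi matrix with blocks given by the images of the matrix
    units.\<close>
  define f :: "nat \<Rightarrow> complex" where "f a = (if a div din = a mod din then 1 else 0)" for a
  define \<Omega> where "\<Omega> = mat (din * din) (din * din) (\<lambda>(a, b). f a * cnj (f b))"
  define C where "C = ext_map din din N \<E> \<Omega>"
  have "psd (din * N) C"
    unfolding C_def by (rule cp) (simp add: \<Omega>_def psd_rank_one)
  have C: "C $$ (p * N + i, q * N + j) = \<E> (matrix_unit din p q) $$ (i, j)"
    if "p < din" "q < din" "i < N" "j < N" for p q i j
  proof -
    have "mat din din (\<lambda>(a, b). \<Omega> $$ (p * din + a, q * din + b)) = matrix_unit din p q"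
      using that by (intro eq_matI) (auto simp: \<Omega>_def matrix_unit_def f_def index_less_mult)
    then show ?thesis
      using that index_less_mult[of p din i N] index_less_mult[of q din j N]
      by (simp add: C_def ext_map_def)
  qed
  obtain S where S: "psd (din * N) S" and SS: "S * S = C"
    using psd_sqrt_exists[OF \<open>psd (din * N) C\<close>] by blast
  have Sc: "S \<in> carrier_mat (din * N) (din * N)" using S by (simp add: psd_def)
  have Sh: "S $$ (b, a) = cnj (S $$ (a, b))" if "a < din * N" "b < din * N" for a b
    using arg_cong[OF psd_hermitian[OF S], of "\<lambda>X. X $$ (b, a)"] Sc that by simp
  \<comment> \<open>A row of S is an input index p with a word of H-indices, a column is a purifying
    index r with a word of K-indices. The two words are zipped into one word over pairs.\<close>
  define w where "w p r xs = S $$ (p * N + word_index d (map fst xs), r * N + word_index d (map snd xs))"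
    for p r xs
  have wi: "word_index d us < N" if "us \<in> words {..<d} M" for us
    using word_index_less[OF that] by (simp add: N_def)
  have w_zip: "w p r (zip us ls) = S $$ (p * N + word_index d us, r * N + word_index d ls)"
    if "us \<in> words {..<d} M" "ls \<in> words {..<d} M" for p r us ls
    using that by (simp add: w_def words_def)
  have "symmetric_on (words (pairs d) M) (w p r)" if pr: "p < din" "r < din" for p r
    unfolding symmetric_on_def
  proof (intro ballI impI)
    fix I J assume I: "I \<in> words (pairs d) M" and J: "J \<in> words (pairs d) M" and IJ: "mset I = mset J"
    obtain \<pi> where \<pi>: "\<pi> permutes {..<length (rev J)}" "permute_list \<pi> (rev J) = rev I"
      using mset_eq_permutation[of "rev I" "rev J"] IJ by auto
    have len: "length J = M" using J by (simp add: words_def)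
    have \<pi>M: "\<pi> permutes {..<M}" using \<pi> len by simp
    have I_eq: "I = permute_word \<pi> J" using \<pi>(2) by (simp add: permute_word_def)
    define \<sigma> where "\<sigma> i = word_index d (permute_word \<pi> (inv_into (words {..<d} M) (word_index d) i))" for i
    have \<sigma>: "\<sigma> (word_index d us) = word_index d (permute_word \<pi> us)" if "us \<in> words {..<d} M" for us
      using inv_into_f_f[OF word_index_inj that] by (simp add: \<sigma>_def)
    have \<sigma>_less: "\<sigma> i < N" if "i < N" for i
      using that \<sigma> wi permute_word_words[OF \<pi>M] word_index_surj[of i d M] unfolding N_def by metis
    have \<sigma>_inj: "i = j" if ij: "i < N" "j < N" "\<sigma> i = \<sigma> j" for i j
    proof -
      obtain us where us: "us \<in> words {..<d} M" "i = word_index d us"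
        using word_index_surj[OF ij(1)[unfolded N_def]] .
      obtain vs where vs: "vs \<in> words {..<d} M" "j = word_index d vs"
        using word_index_surj[OF ij(2)[unfolded N_def]] .
      have "permute_word \<pi> us = permute_word \<pi> vs"
        using inj_onD[OF word_index_inj, of d "permute_word \<pi> us" "permute_word \<pi> vs" M] ij(3) \<sigma> us vs
          permute_word_words[OF \<pi>M] by auto
      then show ?thesis using inj_onD[OF permute_word_inj[OF \<pi>M]] us vs by blast
    qed
    \<comment> \<open>\<tau> permutes the word part of an index and fixes the block number. Acting
      on rows and columns of S at once, it moves H-letters and K-letters together, which is a
      permutation of the pairs.\<close>
    define \<tau> where "\<tau> a = (a div N) * N + \<sigma> (a mod N)" for a
    have \<tau>: "\<tau> (p * N + word_index d us) = p * N + word_index d (permute_word \<pi> us)"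
      if "us \<in> words {..<d} M" for p us
      using wi[OF that] N by (simp add: \<tau>_def \<sigma>[OF that])
    have "inj_on \<tau> {..<din * N}"
    proof (rule inj_onI)
      fix a b assume "a \<in> {..<din * N}" "b \<in> {..<din * N}" and eq: "\<tau> a = \<tau> b"
      have s: "\<sigma> (a mod N) < N" "\<sigma> (b mod N) < N" using N \<sigma>_less by auto
      have "a div N = b div N"
        using arg_cong[OF eq, of "\<lambda>x. x div N"] s N by (simp add: \<tau>_def)
      moreover have "\<sigma> (a mod N) = \<sigma> (b mod N)"
        using arg_cong[OF eq, of "\<lambda>x. x mod N"] s N by (simp add: \<tau>_def)
      then have "a mod N = b mod N" using \<sigma>_inj N by simp
      ultimately show "a = b" by (metis div_mult_mod_eq)
    qed
    moreover have "\<tau> ` {..<din * N} \<subseteq> {..<din * N}"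
      using N \<sigma>_less by (auto simp: \<tau>_def intro!: index_less_mult less_mult_imp_div_less)
    ultimately have bij: "bij_betw \<tau> {..<din * N} {..<din * N}"
      by (simp add: bij_betw_def endo_inj_surj)
    have inv: "(S * S) $$ (\<tau> a, \<tau> b) = (S * S) $$ (a, b)" if a: "a < din * N" and b: "b < din * N" for a b
    proof -
      obtain p us where p: "p < din" "us \<in> words {..<d} M" "a = p * N + word_index d us"
        using block_index_surj[of a din d M] a unfolding N_def by blast
      obtain q vs where q: "q < din" "vs \<in> words {..<d} M" "b = q * N + word_index d vs"
        using block_index_surj[of b din d M] b unfolding N_def by blast
      show ?thesis
        unfolding SS p(3) q(3) \<tau>[OF p(2)] \<tau>[OF q(2)] C[OF p(1) q(1) wi[OF p(2)] wi[OF q(2)]]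
          C[OF p(1) q(1) wi[OF permute_word_words[OF \<pi>M p(2)]] wi[OF permute_word_words[OF \<pi>M q(2)]]]
        by (rule perm_invariant_entries[OF Ec[OF uc, unfolded N_def] \<pi>M sym[OF uc \<pi>M] p(2) q(2)])
    qed
    have m: "map fst J \<in> words {..<d} M" "map snd J \<in> words {..<d} M"
      using J by (auto simp: words_def)
    have "w p r I = S $$ (\<tau> (p * N + word_index d (map fst J)), \<tau> (r * N + word_index d (map snd J)))"
      using \<pi>M len by (simp add: w_def I_eq \<tau> m permute_word_map)
    also have "\<dots> = w p r J"
      unfolding w_def
      by (rule psd_sqrt_invariant[OF S bij inv]) (use pr wi m in \<open>auto intro!: index_less_mult\<close>)
    finally show "w p r I = w p r J" .
  qed
  moreover have "\<E> \<rho> $$ (word_index d us, word_index d vs) = (\<Sum>p<din. \<Sum>q<din. \<rho> $$ (p, q) *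
         (\<Sum>r<din. \<Sum>ls\<in>words {..<d} M. w p r (zip us ls) * cnj (w q r (zip vs ls))))"
    if \<rho>: "\<rho> \<in> carrier_mat din din" and us: "us \<in> words {..<d} M" and vs: "vs \<in> words {..<d} M" for \<rho> us vs
    unfolding linear_map_expand[OF lin \<rho> wi[OF us] wi[OF vs]]
  proof (intro sum.cong refl arg_cong2[where f="(*)"])
    fix p q assume "p \<in> {..<din}" "q \<in> {..<din}"
    then have pq: "p < din" "q < din" by auto
    have a: "p * N + word_index d us < din * N" "q * N + word_index d vs < din * N"
      using pq wi us vs by (auto intro: index_less_mult)
    have "\<E> (matrix_unit din p q) $$ (word_index d us, word_index d vs)
        = (S * S) $$ (p * N + word_index d us, q * N + word_index d vs)"
      unfolding SS using C[OF pq wi[OF us] wi[OF vs]] by simp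
    also have "\<dots> = (\<Sum>c<din * N. S $$ (p * N + word_index d us, c) * S $$ (c, q * N + word_index d vs))"
      by (rule mult_index[OF Sc Sc a])
    \<comment> \<open>Hermiticity turns the square of S into a Gram form, with the amplitude of q
      conjugated.\<close>
    also have "\<dots> = (\<Sum>c<din * N. S $$ (p * N + word_index d us, c) * cnj (S $$ (q * N + word_index d vs, c)))"
      by (rule sum.cong[OF refl]) (simp add: Sh[OF a(2)])
    also have "\<dots> = (\<Sum>r<din. \<Sum>ls\<in>words {..<d} M. w p r (zip us ls) * cnj (w q r (zip vs ls)))"
      unfolding sum_lessThan_mult unfolding N_def sum_word_index
      by (intro sum.cong refl) (simp add: w_zip us vs N_def)
    finally show "\<E> (matrix_unit din p q) $$ (word_index d us, word_index d vs)
        = (\<Sum>r<din. \<Sum>ls\<in>words {..<d} M. w p r (zip us ls) * cnj (w q r (zip vs ls)))" .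
  qed
  ultimately show ?thesis using that by blast
qed

section \<open>Dimensions of symmetric subspaces\<close>

text \<open>The first form has n factors and matches the moment integrals; the second always has d^2
  - 1 factors, so that values at different n can be compared factor by factor.\<close>

lemma Dplus_pochhammer:
  assumes "0 < d"
  shows "Dplus d n = pochhammer (real (d\<^sup>2)) n / fact n"
    and "Dplus d n = pochhammer (real n + 1) (d\<^sup>2 - 1) / fact (d\<^sup>2 - 1)"
proof -
  have D: "1 \<le> d\<^sup>2" using assms by simp
  have "real ((d\<^sup>2 + n - 1) choose n) = pochhammer (real (d\<^sup>2 + n - 1) - real n + 1) n / fact n"
    by (simp add: binomial_gbinomial gbinomial_pochhammer')
  moreover have "real (d\<^sup>2 + n - 1) - real n + 1 = real (d\<^sup>2)" using D by (simp add: of_nat_diff)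
  ultimately show "Dplus d n = pochhammer (real (d\<^sup>2)) n / fact n" by (simp add: Dplus_def)
  have "(d\<^sup>2 + n - 1) choose n = (d\<^sup>2 + n - 1) choose (d\<^sup>2 - 1)"
    using binomial_symmetric[of n "d\<^sup>2 + n - 1"] D by simp
  then have "Dplus d n = pochhammer (real (d\<^sup>2 + n - 1) - real (d\<^sup>2 - 1) + 1) (d\<^sup>2 - 1) / fact (d\<^sup>2 - 1)"
    by (simp add: Dplus_def binomial_gbinomial gbinomial_pochhammer')
  moreover have "real (d\<^sup>2 + n - 1) - real (d\<^sup>2 - 1) + 1 = real n + 1" using D by (simp add: of_nat_diff)
  ultimately show "Dplus d n = pochhammer (real n + 1) (d\<^sup>2 - 1) / fact (d\<^sup>2 - 1)" by simp
qed

lemma Dplus_pos: "0 < d \<Longrightarrow> 0 < Dplus d n"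
  by (simp add: Dplus_pochhammer(1) pochhammer_pos)

lemma Dplus_mono:
  assumes "0 < d" "m \<le> n"
  shows "Dplus d m \<le> Dplus d n"
  unfolding Dplus_pochhammer(2)[OF assms(1)] pochhammer_prod
  using assms(2) by (intro divide_right_mono prod_mono) auto

text \<open>Supplies the hypothesis on \<open>s\<close> in \<open>overlap_bound\<close>: the rising
  factorial of d^2 of length M splits at M - k, and the first piece cancels in the ratio of
  dimensions.\<close>

lemma Dplus_ratio:
  assumes "0 < d" "k \<le> M"
  shows "(1 / sqrt (Dplus d (M - k) / Dplus d M))\<^sup>2 * fact M
    = fact (M - k) * pochhammer (real (d\<^sup>2 + (M - k))) k"
proof -
  have pos: "0 < pochhammer (real (d\<^sup>2)) (M - k)" using assms by (intro pochhammer_pos) simp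
  have "(1 / sqrt (Dplus d (M - k) / Dplus d M))\<^sup>2 = Dplus d M / Dplus d (M - k)"
    using Dplus_pos[OF assms(1)] by (simp add: power_divide less_imp_le)
  moreover have "pochhammer (real (d\<^sup>2)) M
      = pochhammer (real (d\<^sup>2)) (M - k) * pochhammer (real (d\<^sup>2 + (M - k))) k"
    using pochhammer_product[OF diff_le_self, of "real (d\<^sup>2)" M k] assms
    by (simp only: of_nat_add diff_diff_cancel)
  ultimately show ?thesis
    using pos by (simp add: Dplus_pochhammer(1)[OF assms(1)] del: of_nat_add of_nat_diff of_nat_power)
qed

text \<open>Bernoulli's inequality for the exponent n / 2, squared so that only integer powers
  occur. For n = 1 it fails when x > 0; the induction starts from equality at n = 2.\<close>

lemma half_Bernoulli:
  fixes x :: real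
  assumes "2 \<le> n" "0 \<le> x" "x \<le> 1" "real n * x \<le> 2"
  shows "(1 - real n * x / 2)\<^sup>2 \<le> (1 - x) ^ n"
  using assms
proof (induction n rule: dec_induct)
  case base
  then show ?case by simp
next
  case (step n)
  define a where "a = 1 - real n * x / 2"
  have nx: "real n * x \<le> 2 - x" using step.prems by (simp add: algebra_simps)
  have "a\<^sup>2 \<le> (1 - x) ^ n" unfolding a_def using step.IH step.prems nx by auto
  then have "(1 - x) * a\<^sup>2 \<le> (1 - x) ^ Suc n" using step.prems by (simp add: mult_left_mono)
  \<comment> \<open>After expansion this is x times the inequality x / 4 \<le> a (1 - a). Since 1 -
    a = n x / 2, it suffices that 1 \<le> 2 n a, which follows from x / 2 \<le> a.\<close>
  moreover have "(a - x / 2)\<^sup>2 \<le> (1 - x) * a\<^sup>2"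
  proof -
    have "1 \<le> (real n + 1) * a"
    proof -
      have ax: "x / 2 \<le> a" using nx by (simp add: a_def)
      have "real n * (x / 2) = 1 - a" by (simp add: a_def)
      moreover have "real n * (x / 2) \<le> real n * a" using ax by (intro mult_left_mono) auto
      ultimately show ?thesis by (simp add: algebra_simps)
    qed
    moreover have "0 \<le> a" using nx step.prems by (simp add: a_def)
    then have "a \<le> real n * a"
      using step.hyps mult_right_mono[of 1 "real n" a] by simp
    ultimately have "1 \<le> 2 * (real n * a)" by (simp add: algebra_simps)
    then have "x * 1 \<le> x * (2 * (real n * a))" using step.prems by (intro mult_left_mono) auto
    moreover have "a * (1 - a) = x * (2 * (real n * a)) / 4" by (simp add: a_def)
    ultimately have "x / 4 \<le> a * (1 - a)" by linarith
    then have "x * (x / 4) \<le> x * (a * (1 - a))" using step.prems by (intro mult_left_mono) auto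
    then show ?thesis by (simp add: power2_eq_square algebra_simps)
  qed
  moreover have "1 - real (Suc n) * x / 2 = a - x / 2" by (simp add: a_def algebra_simps)
  ultimately show ?case by simp
qed

text \<open>The ratio is a product of d^2 - 1 factors 1 - k / (M + 1 + j), each at least 1 - k / (M
  + 1), so its root is at least 1 - (d^2 - 1) k / (2 (M + 1)) by \<open>half_Bernoulli\<close>, or
  trivially where that number is negative. Enlarging d^2 - 1 to d^2 and 1 / (M + 1) to 1 / M gives
  the stated form.\<close>

lemma Dplus_ratio_bound:
  assumes d: "2 \<le> d" and k: "1 \<le> k" "k \<le> M"
  shows "4 * (1 - sqrt (Dplus d (M - k) / Dplus d M)) \<le> 2 * real k * real d ^ 2 / real M"
proof -
  define m where "m = d\<^sup>2 - 1"
  define x where "x = real k / (real M + 1)"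
  have "2\<^sup>2 \<le> d\<^sup>2" using d by (intro power_mono) auto
  then have m: "2 \<le> m" "real m \<le> real d ^ 2" by (auto simp: m_def)
  have x: "0 \<le> x" "x \<le> 1" "x \<le> real k / real M" using k by (auto simp: x_def frac_le)
  define t where "t = Dplus d (M - k) / Dplus d M"
  have t0: "0 \<le> t" using Dplus_pos[of d] d by (simp add: t_def less_imp_le)
  have t: "t = pochhammer (real (M - k) + 1) m / pochhammer (real M + 1) m"
    using d by (simp add: t_def Dplus_pochhammer(2) m_def)
  have "(1 - x) ^ n * pochhammer (real M + 1) n \<le> pochhammer (real (M - k) + 1) n" for n
  proof (induction n)
    case (Suc n)
    have "(1 - x) * (real M + 1 + real n) \<le> real (M - k) + 1 + real n"
    proof -
      have "(1 - x) * (real M + 1) = real (M - k) + 1" using k by (simp add: x_def field_simps of_nat_diff)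
      moreover have "(1 - x) * real n \<le> 1 * real n" using x by (intro mult_right_mono) auto
      ultimately show ?thesis by (simp add: distrib_left)
    qed
    then have "((1 - x) ^ n * pochhammer (real M + 1) n) * ((1 - x) * (real M + 1 + real n))
        \<le> pochhammer (real (M - k) + 1) n * (real (M - k) + 1 + real n)"
      using Suc x by (intro mult_mono) (auto intro!: pochhammer_nonneg)
    then show ?case by (simp add: pochhammer_Suc mult_ac)
  qed simp
  then have tx: "(1 - x) ^ m \<le> t"
    unfolding t by (subst pos_le_divide_eq) (auto intro!: pochhammer_pos)
  have mx: "real m * x \<le> real k * real d ^ 2 / real M"
  proof -
    have "real m * x \<le> real d ^ 2 * (real k / real M)" using m x by (intro mult_mono) auto
    then show ?thesis by (simp add: mult.commute)
  qed
  have "1 - real m * x / 2 \<le> sqrt t"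
  proof (cases "real m * x \<le> 2")
    case True
    then have "(1 - real m * x / 2)\<^sup>2 \<le> t" using half_Bernoulli[OF m(1) x(1,2)] tx by simp
    then show ?thesis by (rule real_le_rsqrt)
  next
    case False
    then have "1 - real m * x / 2 \<le> 0" by simp
    also have "0 \<le> sqrt t" using t0 by simp
    finally show ?thesis .
  qed
  then have "4 * (1 - sqrt t) \<le> 2 * (real m * x)" by simp
  also have "\<dots> \<le> 2 * (real k * real d ^ 2 / real M)" using mx by simp
  finally show ?thesis by (simp add: t_def mult.assoc)
qed

section \<open>The measure-and-prepare channel\<close>

lemma words_0 [simp]: "words A 0 = {[]}"
  by (auto simp: words_def)

lemma sum_words_Suc:
  "(\<Sum>xs\<in>words A (Suc n). f xs) = (\<Sum>a\<in>A. \<Sum>xs\<in>words A n. f (a # xs))"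
proof -
  have "words A (Suc n) = (\<lambda>(a, xs). a # xs) ` (A \<times> words A n)"
    by (auto simp: words_def length_Suc_conv)
  moreover have "inj_on (\<lambda>(a, xs). a # xs) (A \<times> words A n)"
    by (auto simp: inj_on_def)
  ultimately show ?thesis
    by (simp add: sum.reindex sum.cartesian_product case_prod_unfold)
qed

lemma sum_words_append:
  "(\<Sum>xs\<in>words A (m + n). f xs) = (\<Sum>us\<in>words A m. \<Sum>vs\<in>words A n. f (us @ vs))"
  by (induction m arbitrary: f) (simp_all add: sum_words_Suc)

lemma sum_words_pairs:
  "(\<Sum>L\<in>words (A \<times> B) n. f L) = (\<Sum>us\<in>words A n. \<Sum>vs\<in>words B n. f (zip us vs))"
proof (induction n arbitrary: f)
  case (Suc n)
  have "(\<Sum>L\<in>words (A \<times> B) (Suc n). f L)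
      = (\<Sum>a\<in>A. \<Sum>b\<in>B. \<Sum>us\<in>words A n. \<Sum>vs\<in>words B n. f ((a, b) # zip us vs))"
    by (simp add: sum_words_Suc Suc sum.cartesian_product')
  also have "\<dots> = (\<Sum>a\<in>A. \<Sum>us\<in>words A n. \<Sum>b\<in>B. \<Sum>vs\<in>words B n. f ((a, b) # zip us vs))"
    by (rule sum.cong[OF refl]) (rule sum.swap)
  finally show ?case by (simp add: sum_words_Suc)
qed simp

lemma zip_words: "us \<in> words A n \<Longrightarrow> ls \<in> words B n \<Longrightarrow> zip us ls \<in> words (A \<times> B) n"
  by (auto simp: words_def dest: set_zip_leftD set_zip_rightD)

lemma tensor_pow_carrier [simp]:
  "A \<in> carrier_mat d d \<Longrightarrow> tensor_pow A n \<in> carrier_mat (d ^ n) (d ^ n)"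
  by (induction n) (auto simp: kron_def)

lemma tensor_pow_index:
  assumes A: "A \<in> carrier_mat d d" and "us \<in> words {..<d} n" "vs \<in> words {..<d} n"
  shows "tensor_pow A n $$ (word_index d us, word_index d vs) = prod_list (map2 (\<lambda>i j. A $$ (i, j)) us vs)"
  using assms(2,3)
proof (induction n arbitrary: us vs)
  case (Suc n)
  obtain u us' v vs' where eq: "us = u # us'" "vs = v # vs'"
    using Suc.prems by (auto simp: words_def length_Suc_conv)
  have mem: "us' \<in> words {..<d} n" "vs' \<in> words {..<d} n" "u < d" "v < d"
    and len: "length us' = n" "length vs' = n"
    using Suc.prems eq by (auto simp: words_def)
  have lt: "word_index d us' < d ^ n" "word_index d vs' < d ^ n" using mem word_index_less by auto
  have d0: "d ^ n \<noteq> 0" using lt by linarith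
  have T: "dim_row (tensor_pow A n) = d ^ n" "dim_col (tensor_pow A n) = d ^ n" "dim_row A = d" "dim_col A = d"
    using A carrier_matD[OF tensor_pow_carrier[OF A, of n]] by auto
  have "u * d ^ n + word_index d us' < d * d ^ n" "v * d ^ n + word_index d vs' < d * d ^ n"
    using mem lt by (auto intro: index_less_mult)
  moreover have "(u * d ^ n + word_index d us') div d ^ n = u" "(v * d ^ n + word_index d vs') div d ^ n = v"
    using lt by (simp_all only: div_mult_self3[OF d0] div_less add_0_right)
  ultimately show ?case
    using Suc.IH[OF mem(1,2)] lt by (simp add: kron_def eq T len)
qed simp

text \<open>The trace of a tensor power is the power of the trace. For a state it is one, so surplus
  copies disappear under a partial trace.\<close>

lemma sum_prod_list_diag:
  fixes f :: "'a \<Rightarrow> 'a \<Rightarrow> complex"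
  shows "(\<Sum>us\<in>words A n. prod_list (map2 f us us)) = (\<Sum>i\<in>A. f i i) ^ n"
proof (induction n)
  case (Suc n)
  have "(\<Sum>us\<in>words A (Suc n). prod_list (map2 f us us))
      = (\<Sum>i\<in>A. f i i) * (\<Sum>us\<in>words A n. prod_list (map2 f us us))"
    unfolding sum_words_Suc sum_product by simp
  then show ?case using Suc by simp
qed simp

text \<open>Tracing out K commutes with tensor powers: multiplying out the sums over l gives a
  single sum over words of K-indices.\<close>

lemma prod_list_gram:
  assumes "us \<in> words {..<d} n" "vs \<in> words {..<d} n"
  shows "prod_list (map2 (\<lambda>i j. (\<Sum>l<d. x $$ (i, l) * cnj (x $$ (j, l))) / c) us vs)
    = (\<Sum>ls\<in>words {..<d} n. word_prod x (zip us ls) * cnj (word_prod x (zip vs ls))) / c ^ n"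
  using assms
proof (induction n arbitrary: us vs)
  case (Suc n)
  obtain u us' v vs' where eq: "us = u # us'" "vs = v # vs'"
    using Suc.prems by (auto simp: words_def length_Suc_conv)
  have mem: "us' \<in> words {..<d} n" "vs' \<in> words {..<d} n" using Suc.prems eq by (auto simp: words_def)
  have "(\<Sum>ls\<in>words {..<d} (Suc n). word_prod x (zip us ls) * cnj (word_prod x (zip vs ls)))
      = (\<Sum>l<d. x $$ (u, l) * cnj (x $$ (v, l))) *
        (\<Sum>ls\<in>words {..<d} n. word_prod x (zip us' ls) * cnj (word_prod x (zip vs' ls)))"
    unfolding sum_product sum_words_Suc eq by (intro sum.cong refl) (simp add: mult_ac)
  then show ?case using Suc.IH[OF mem] by (simp add: eq)
qed simp

text \<open>The state of H belonging to the unit vector x / |x|. At x = 0 some density operator has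
  to be chosen, here the projection onto the first basis vector.\<close>

definition reduced_state :: "nat \<Rightarrow> complex mat \<Rightarrow> complex mat" where
  "reduced_state d x = (if norm_sq d x = 0 then matrix_unit d 0 0
     else mat d d (\<lambda>(i, j). (\<Sum>l<d. x $$ (i, l) * cnj (x $$ (j, l))) / of_real (norm_sq d x)))"

lemma reduced_state_carrier [simp]: "reduced_state d x \<in> carrier_mat d d"
  by (simp add: reduced_state_def matrix_unit_def)

lemma mtrace_reduced_state:
  assumes "0 < d"
  shows "mtrace (reduced_state d x) = 1"
proof (cases "norm_sq d x = 0")
  case True
  have "(\<Sum>i<d. matrix_unit d 0 0 $$ (i, i)) = (\<Sum>i<d. if i = 0 then 1 else 0)"
    by (intro sum.cong refl) (auto simp: matrix_unit_def)
  with True assms show ?thesis by (simp add: mtrace_def reduced_state_def matrix_unit_def)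
next
  case False
  have "mtrace (reduced_state d x) = (\<Sum>i<d. \<Sum>l<d. x $$ (i, l) * cnj (x $$ (i, l))) / of_real (norm_sq d x)"
    using False by (simp add: mtrace_def reduced_state_def sum_divide_distrib)
  also have "(\<Sum>i<d. \<Sum>l<d. x $$ (i, l) * cnj (x $$ (i, l))) = of_real (norm_sq d x)"
    unfolding norm_sq_def of_real_sum complex_norm_square by (simp add: sum.cartesian_product case_prod_unfold)
  finally show ?thesis using False by simp
qed

lemma psd_gram:
  assumes T: "T \<in> carrier_mat n n" and c: "0 \<le> c" and fin: "finite F"
    and "\<And>i j. i < n \<Longrightarrow> j < n \<Longrightarrow> T $$ (i, j) = (\<Sum>e\<in>F. h e i * cnj (h e j)) * of_real c"
  shows "psd n T"
  unfolding psd_iff_qform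
proof (intro conjI allI T)
  fix v
  have "qform n T v = (\<Sum>i<n. \<Sum>j<n. \<Sum>e\<in>F. of_real c * ((cnj (v i) * h e i) * cnj (cnj (v j) * h e j)))"
    unfolding qform_def using assms(4)
    by (intro sum.cong refl) (simp add: sum_distrib_left sum_distrib_right mult_ac)
  also have "\<dots> = (\<Sum>i<n. \<Sum>e\<in>F. \<Sum>j<n. of_real c * ((cnj (v i) * h e i) * cnj (cnj (v j) * h e j)))"
    by (rule sum.cong[OF refl]) (rule sum.swap)
  also have "\<dots> = (\<Sum>e\<in>F. \<Sum>i<n. \<Sum>j<n. of_real c * ((cnj (v i) * h e i) * cnj (cnj (v j) * h e j)))"
    by (rule sum.swap)
  also have "\<dots> = (\<Sum>e\<in>F. of_real c * ((\<Sum>i<n. cnj (v i) * h e i) * cnj (\<Sum>i<n. cnj (v i) * h e i)))"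
    by (rule sum.cong[OF refl], simp only: cnj_sum sum_product) (simp add: sum_distrib_left)
  also have "\<dots> = of_real (\<Sum>e\<in>F. c * (cmod (\<Sum>i<n. cnj (v i) * h e i))\<^sup>2)"
    unfolding complex_norm_square[symmetric] by simp
  finally show "0 \<le> qform n T v"
    using c by (simp add: less_eq_complex_def sum_nonneg)
qed

lemma density_reduced_state:
  assumes "0 < d"
  shows "density_op d (reduced_state d x)"
  unfolding density_op_def
proof (intro conjI mtrace_reduced_state[OF assms])
  show "psd d (reduced_state d x)"
  proof (cases "norm_sq d x = 0")
    case True
    have "psd d (mat d d (\<lambda>(i, j). (\<lambda>a. if a = 0 then 1 else 0) i * cnj ((\<lambda>a. if a = 0 then 1 else 0) j)))"
      by (rule psd_rank_one)
    also have "mat d d (\<lambda>(i, j). (\<lambda>a. if a = 0 then 1 else 0) i * cnj ((\<lambda>a. if a = 0 then 1 else 0) j))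
        = reduced_state d x"
      using True by (intro eq_matI) (auto simp: reduced_state_def matrix_unit_def)
    finally show ?thesis .
  next
    case False
    then show ?thesis
      by (intro psd_gram[where F="{..<d}" and h="\<lambda>l i. x $$ (i, l)" and c="1 / norm_sq d x"])
        (auto simp: reduced_state_def)
  qed
qed

locale measure_prepare =
  fixes din d M k :: nat and \<E> :: "complex mat \<Rightarrow> complex mat"
    and w :: "nat \<Rightarrow> nat \<Rightarrow> (nat \<times> nat) list \<Rightarrow> complex" and \<mu> :: "complex mat measure"
  assumes d: "0 < d" and M: "0 < M" and k: "k \<le> M" and gm: "gaussian_moments d M \<mu>"
    and w_sym: "\<And>p r. p < din \<Longrightarrow> r < din \<Longrightarrow> symmetric_on (words (pairs d) M) (w p r)"
    and \<E>_eq: "\<And>\<rho> us vs. \<rho> \<in> carrier_mat din din \<Longrightarrow> us \<in> words {..<d} M \<Longrightarrow> vs \<in> words {..<d} M \<Longrightarrow>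
       \<E> \<rho> $$ (word_index d us, word_index d vs) = (\<Sum>p<din. \<Sum>q<din. \<rho> $$ (p, q) *
         (\<Sum>r<din. \<Sum>ls\<in>words {..<d} M. w p r (zip us ls) * cnj (w q r (zip vs ls))))"
    and \<E>_carrier: "\<And>\<rho>. \<rho> \<in> carrier_mat din din \<Longrightarrow> \<E> \<rho> \<in> carrier_mat (d ^ M) (d ^ M)"
    and \<E>_trace: "\<And>\<rho>. \<rho> \<in> carrier_mat din din \<Longrightarrow> mtrace (\<E> \<rho>) = mtrace \<rho>"
begin

text \<open>Overlap of the M-th tensor power of x with the purified output for the p-th input basis
  vector, with r the index of the purifying copy of the input space.\<close>

definition amp :: "nat \<Rightarrow> nat \<Rightarrow> complex mat \<Rightarrow> complex" where
  "amp p r x = (\<Sum>J\<in>words (pairs d) M. cnj (word_prod x J) * w p r J)"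

text \<open>The divisor M! is the constant of \<open>reproducing\<close> without weight and makes Q
  a resolution of the identity. The indices are exchanged because the trace of Q x times \<rho>
  pairs the entry (q, p) of Q x with the entry (p, q) of \<rho>.\<close>

definition Q :: "complex mat \<Rightarrow> complex mat" where
  "Q x = mat din din (\<lambda>(q, p). (\<Sum>r<din. amp p r x * cnj (amp q r x)) / fact M)"

lemma Q_carrier [simp]: "Q x \<in> carrier_mat din din"
  by (simp add: Q_def)

lemma Q_psd: "psd din (Q x)"
  by (rule psd_gram[where F="{..<din}" and h="\<lambda>r q. cnj (amp q r x)" and c="1 / fact M"])
    (auto simp: Q_def mult.commute)

lemma amp_moment:
  assumes "p < din" "r < din"
  shows "has_bochner_integral \<mu> (\<lambda>x. amp p r x * cnj (amp q r x))
    (fact M * (\<Sum>I\<in>words (pairs d) M. w p r I * cnj (w q r I)))"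
proof -
  have "has_bochner_integral \<mu>
     (\<lambda>x. \<Sum>I\<in>words (pairs d) M. (of_real (norm_sq d x ^ 0) * (word_prod x I * amp p r x)) * cnj (w q r I))
     (\<Sum>I\<in>words (pairs d) M. (fact M * pochhammer (of_nat (d\<^sup>2 + M)) 0 * w p r I) * cnj (w q r I))"
    unfolding amp_def
    by (intro has_bochner_integral_sum has_bochner_integral_mult_left reproducing[OF gm w_sym] assms) auto
  moreover have "(\<Sum>I\<in>words (pairs d) M. (of_real (norm_sq d x ^ 0) * (word_prod x I * amp p r x)) * cnj (w q r I))
      = amp p r x * cnj (amp q r x)" for x
    unfolding amp_def[of q] cnj_sum sum_distrib_left by (intro sum.cong refl) (simp add: mult_ac)
  ultimately show ?thesis by (simp add: sum_distrib_left mult_ac)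
qed

text \<open>Trace preservation, tested on matrix units: the purification of the channel is an
  isometry.\<close>

lemma amp_normalized:
  assumes "p < din" "q < din"
  shows "(\<Sum>r<din. \<Sum>I\<in>words (pairs d) M. w p r I * cnj (w q r I)) = (if p = q then 1 else 0)"
proof -
  let ?u = "matrix_unit din p q"
  have uc: "?u \<in> carrier_mat din din" by (simp add: matrix_unit_def)
  have "(if p = q then 1 else 0) = mtrace ?u"
  proof -
    have "mtrace ?u = (\<Sum>i<din. if i = p \<and> p = q then 1 else 0)"
      unfolding mtrace_def by (intro sum.cong) (auto simp: matrix_unit_def)
    also have "\<dots> = (if p = q then 1 else 0)" using assms by (cases "p = q") auto
    finally show ?thesis by simp
  qed
  also have "\<dots> = (\<Sum>us\<in>words {..<d} M. \<E> ?u $$ (word_index d us, word_index d us))"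
    using \<E>_carrier[OF uc] \<E>_trace[OF uc] by (simp add: mtrace_def sum_word_index)
  also have "\<dots> = (\<Sum>us\<in>words {..<d} M. \<Sum>r<din. \<Sum>ls\<in>words {..<d} M. w p r (zip us ls) * cnj (w q r (zip us ls)))"
  proof (rule sum.cong[OF refl])
    fix us assume us: "us \<in> words {..<d} M"
    let ?g = "\<lambda>p q. \<Sum>r<din. \<Sum>ls\<in>words {..<d} M. w p r (zip us ls) * cnj (w q r (zip us ls))"
    have "\<E> ?u $$ (word_index d us, word_index d us) = (\<Sum>p'<din. \<Sum>q'<din. ?u $$ (p', q') * ?g p' q')"
      by (rule \<E>_eq[OF uc us us])
    also have "\<dots> = (\<Sum>p'<din. \<Sum>q'<din. if q' = q then (if p' = p then ?g p q else 0) else 0)"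
      by (intro sum.cong refl) (auto simp: matrix_unit_def)
    also have "\<dots> = ?g p q" using assms by simp
    finally show "\<E> ?u $$ (word_index d us, word_index d us) = ?g p q" .
  qed
  also have "\<dots> = (\<Sum>r<din. \<Sum>us\<in>words {..<d} M. \<Sum>ls\<in>words {..<d} M. w p r (zip us ls) * cnj (w q r (zip us ls)))"
    by (rule sum.swap)
  finally show ?thesis by (simp add: sum_words_pairs)
qed

lemma Q_moment:
  assumes "p < din" "q < din"
  shows "has_bochner_integral \<mu> (\<lambda>x. Q x $$ (q, p)) (if p = q then 1 else 0)"
proof -
  have "has_bochner_integral \<mu> (\<lambda>x. (\<Sum>r<din. amp p r x * cnj (amp q r x)) / fact M)
     ((\<Sum>r<din. fact M * (\<Sum>I\<in>words (pairs d) M. w p r I * cnj (w q r I))) / fact M)"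
    by (intro has_bochner_integral_divide_zero has_bochner_integral_sum amp_moment) (use assms in auto)
  moreover have "(\<Sum>r<din. fact M * (\<Sum>I\<in>words (pairs d) M. w p r I * cnj (w q r I))) / fact M
      = (if p = q then 1 else 0)"
    unfolding sum_distrib_left[symmetric] amp_normalized[OF assms] by simp
  ultimately show ?thesis using assms by (simp add: Q_def)
qed

lemma povm_Q: "povm din \<mu> Q"
  unfolding povm_def
proof (intro conjI ballI allI impI Q_psd)
  show "integrable \<mu> (\<lambda>x. Q x $$ (i, j))" if "i < din" "j < din" for i j
    using Q_moment[OF that(2,1)] unfolding has_bochner_integral_iff by blast
  show "mat din din (\<lambda>(i, j). integral\<^sup>L \<mu> (\<lambda>x. Q x $$ (i, j))) = 1\<^sub>m din"
    by (intro eq_matI) (auto simp: has_bochner_integral_integral_eq[OF Q_moment])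
qed

lemma measurable_reduced_state:
  assumes "i < d" "j < d"
  shows "(\<lambda>x. reduced_state d x $$ (i, j)) \<in> borel_measurable \<mu>"
proof -
  have [measurable]: "norm_sq d \<in> borel_measurable \<mu>" by (rule measurable_norm_sq[OF gm])
  have [measurable]: "(\<lambda>x. \<Sum>l<d. x $$ (i, l) * cnj (x $$ (j, l))) \<in> borel_measurable \<mu>"
    using assms measurable_entry[OF gm]
    by (intro borel_measurable_sum borel_measurable_times measurable_compose[OF _ measurable_cnj]) auto
  have "(\<lambda>x. if norm_sq d x = 0 then matrix_unit d 0 0 $$ (i, j)
      else (\<Sum>l<d. x $$ (i, l) * cnj (x $$ (j, l))) / of_real (norm_sq d x)) \<in> borel_measurable \<mu>"
    by measurable
  moreover have "(\<lambda>x. reduced_state d x $$ (i, j)) = (\<lambda>x. if norm_sq d x = 0 then matrix_unit d 0 0 $$ (i, j)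
      else (\<Sum>l<d. x $$ (i, l) * cnj (x $$ (j, l))) / of_real (norm_sq d x))"
    using assms by (auto simp: reduced_state_def)
  ultimately show ?thesis by simp
qed

lemma mtrace_Q_mult:
  assumes "\<rho> \<in> carrier_mat din din"
  shows "mtrace (Q x * \<rho>) = (\<Sum>r<din. \<Sum>p<din. \<Sum>q<din. \<rho> $$ (p, q) * (amp p r x * cnj (amp q r x))) / fact M"
proof -
  have "mtrace (Q x * \<rho>) = (\<Sum>q<din. \<Sum>p<din. Q x $$ (q, p) * \<rho> $$ (p, q))"
  proof -
    have "dim_row (Q x * \<rho>) = din" by (simp add: Q_def)
    then show ?thesis
      unfolding mtrace_def by (intro sum.cong) (auto simp only: mult_index[OF Q_carrier assms] lessThan_iff)
  qed
  also have "\<dots> = (\<Sum>p<din. \<Sum>q<din. Q x $$ (q, p) * \<rho> $$ (p, q))" by (rule sum.swap)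
  also have "\<dots> = (\<Sum>p<din. \<Sum>q<din. \<Sum>r<din. \<rho> $$ (p, q) * (amp p r x * cnj (amp q r x)) / fact M)"
    by (intro sum.cong refl) (simp add: Q_def sum_distrib_left sum_distrib_right sum_divide_distrib mult_ac)
  also have "\<dots> = (\<Sum>p<din. \<Sum>r<din. \<Sum>q<din. \<rho> $$ (p, q) * (amp p r x * cnj (amp q r x)) / fact M)"
    by (rule sum.cong[OF refl]) (rule sum.swap)
  also have "\<dots> = (\<Sum>r<din. \<Sum>p<din. \<Sum>q<din. \<rho> $$ (p, q) * (amp p r x * cnj (amp q r x)) / fact M)"
    by (rule sum.swap)
  finally show ?thesis by (simp add: sum_divide_distrib)
qed

text \<open>At \<open>norm_sq d x = 0\<close> the left factor vanishes, so the junk value of the state is harmless.\<close>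

lemma outcome_times_state:
  assumes \<rho>: "\<rho> \<in> carrier_mat din din" and us: "us \<in> words {..<d} n" and vs: "vs \<in> words {..<d} n"
  shows "mtrace (Q x * \<rho>) * tensor_pow (reduced_state d x) n $$ (word_index d us, word_index d vs)
    = (\<Sum>r<din. \<Sum>ls\<in>words {..<d} n. \<Sum>p<din. \<Sum>q<din. (\<rho> $$ (p, q) / fact M) *
        (word_prod x (zip us ls) * amp p r x * cnj (word_prod x (zip vs ls) * amp q r x) / of_real (norm_sq d x ^ n)))"
proof (cases "norm_sq d x = 0")
  case True
  have "word_prod x J = 0" if "J \<in> words (pairs d) M" for J
    using norm_word_prod_le[OF that, of x] True M by (simp add: power_0_left)
  then have "amp p r x = 0" for p r by (simp add: amp_def)
  then show ?thesis by (simp add: mtrace_Q_mult[OF \<rho>])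
next
  case False
  define g where "g r = (\<Sum>p<din. \<Sum>q<din. \<rho> $$ (p, q) * (amp p r x * cnj (amp q r x)))" for r
  define h where "h ls = word_prod x (zip us ls) * cnj (word_prod x (zip vs ls))" for ls
  have "tensor_pow (reduced_state d x) n $$ (word_index d us, word_index d vs)
      = prod_list (map2 (\<lambda>i j. reduced_state d x $$ (i, j)) us vs)"
    by (rule tensor_pow_index[OF reduced_state_carrier us vs])
  also have "map2 (\<lambda>i j. reduced_state d x $$ (i, j)) us vs
      = map2 (\<lambda>i j. (\<Sum>l<d. x $$ (i, l) * cnj (x $$ (j, l))) / of_real (norm_sq d x)) us vs"
  proof (rule map_cong[OF refl])
    fix z assume "z \<in> set (zip us vs)"
    then have "z \<in> pairs d"
      using zip_words[OF us vs] by (auto simp: words_def)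
    then show "(case z of (i, j) \<Rightarrow> reduced_state d x $$ (i, j))
        = (case z of (i, j) \<Rightarrow> (\<Sum>l<d. x $$ (i, l) * cnj (x $$ (j, l))) / of_real (norm_sq d x))"
      using False by (auto simp: reduced_state_def)
  qed
  also have "prod_list \<dots> = (\<Sum>ls\<in>words {..<d} n. h ls) / of_real (norm_sq d x) ^ n"
    unfolding h_def by (rule prod_list_gram[OF us vs])
  finally have "mtrace (Q x * \<rho>) * tensor_pow (reduced_state d x) n $$ (word_index d us, word_index d vs)
     = ((\<Sum>r<din. g r) * (\<Sum>ls\<in>words {..<d} n. h ls)) * (1 / (fact M * of_real (norm_sq d x ^ n)))"
    by (simp add: mtrace_Q_mult[OF \<rho>] g_def[symmetric])
  also have "\<dots> = (\<Sum>r<din. \<Sum>ls\<in>words {..<d} n. (g r * h ls) * (1 / (fact M * of_real (norm_sq d x ^ n))))"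
    unfolding sum_product unfolding sum_distrib_right ..
  also have "\<dots> = (\<Sum>r<din. \<Sum>ls\<in>words {..<d} n. \<Sum>p<din. \<Sum>q<din. (\<rho> $$ (p, q) / fact M) *
        (word_prod x (zip us ls) * amp p r x * cnj (word_prod x (zip vs ls) * amp q r x) / of_real (norm_sq d x ^ n)))"
  proof (intro sum.cong refl)
    fix r ls
    show "(g r * h ls) * (1 / (fact M * of_real (norm_sq d x ^ n)))
      = (\<Sum>p<din. \<Sum>q<din. (\<rho> $$ (p, q) / fact M) *
        (word_prod x (zip us ls) * amp p r x * cnj (word_prod x (zip vs ls) * amp q r x) / of_real (norm_sq d x ^ n)))"
      unfolding g_def h_def sum_distrib_right by (intro sum.cong refl) (simp add: mult_ac)
  qed
  finally show ?thesis .
qed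

lemma integrable_outcome_times_state:
  assumes \<rho>: "\<rho> \<in> carrier_mat din din" and us: "us \<in> words {..<d} n" and vs: "vs \<in> words {..<d} n"
  shows "integrable \<mu> (\<lambda>x. mtrace (Q x * \<rho>) * tensor_pow (reduced_state d x) n $$ (word_index d us, word_index d vs))"
  unfolding outcome_times_state[OF assms] amp_def
  by (intro Bochner_Integration.integrable_sum integrable_mult_right integrable_overlap[OF gm] zip_words us vs)

lemma ptrace_index:
  assumes "us \<in> words {..<d} k" "vs \<in> words {..<d} k"
  shows "ptrace d M k X $$ (word_index d us, word_index d vs)
    = (\<Sum>ls\<in>words {..<d} (M - k). X $$ (word_index d (us @ ls), word_index d (vs @ ls)))"
  using word_index_less[OF assms(1)] word_index_less[OF assms(2)]
  unfolding ptrace_def by (simp add: sum_word_index word_index_append words_def)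

lemma append_words: "us \<in> words A k \<Longrightarrow> ls \<in> words A (M - k) \<Longrightarrow> us @ ls \<in> words A M"
  using k by (auto simp: words_def)

text \<open>For each outcome the last M - k copies have trace one, so k copies remain, while the
  outcome density \<open>Q\<close> still comes from all M factors.\<close>

lemma ptrace_meas_prep:
  assumes \<rho>: "\<rho> \<in> carrier_mat din din" and us: "us \<in> words {..<d} k" and vs: "vs \<in> words {..<d} k"
  shows "ptrace d M k (meas_prep d M \<mu> Q (reduced_state d) \<rho>) $$ (word_index d us, word_index d vs)
    = integral\<^sup>L \<mu> (\<lambda>x. mtrace (Q x * \<rho>) * tensor_pow (reduced_state d x) k $$ (word_index d us, word_index d vs))"
proof -
  let ?t = "\<lambda>x n us vs. tensor_pow (reduced_state d x) n $$ (word_index d us, word_index d vs)"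
  have "ptrace d M k (meas_prep d M \<mu> Q (reduced_state d) \<rho>) $$ (word_index d us, word_index d vs)
      = (\<Sum>ls\<in>words {..<d} (M - k). integral\<^sup>L \<mu> (\<lambda>x. mtrace (Q x * \<rho>) * ?t x M (us @ ls) (vs @ ls)))"
    unfolding ptrace_index[OF us vs]
    using word_index_less[OF append_words[OF us]] word_index_less[OF append_words[OF vs]]
    by (intro sum.cong refl) (simp add: meas_prep_def)
  also have "\<dots> = integral\<^sup>L \<mu> (\<lambda>x. \<Sum>ls\<in>words {..<d} (M - k). mtrace (Q x * \<rho>) * ?t x M (us @ ls) (vs @ ls))"
    by (rule Bochner_Integration.integral_sum[symmetric])
      (intro integrable_outcome_times_state \<rho> append_words us vs)
  also have "\<dots> = integral\<^sup>L \<mu> (\<lambda>x. mtrace (Q x * \<rho>) * ?t x k us vs)"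
  proof (rule Bochner_Integration.integral_cong[OF refl])
    fix x
    let ?f = "\<lambda>i j. reduced_state d x $$ (i, j)"
    have "?t x M (us @ ls) (vs @ ls) = ?t x k us vs * prod_list (map2 ?f ls ls)"
      if "ls \<in> words {..<d} (M - k)" for ls
      using us vs tensor_pow_index[OF reduced_state_carrier append_words[OF us that] append_words[OF vs that], of x]
        tensor_pow_index[OF reduced_state_carrier us vs, of x] by (simp add: words_def)
    then have "(\<Sum>ls\<in>words {..<d} (M - k). mtrace (Q x * \<rho>) * ?t x M (us @ ls) (vs @ ls))
        = (\<Sum>ls\<in>words {..<d} (M - k). (mtrace (Q x * \<rho>) * ?t x k us vs) * prod_list (map2 ?f ls ls))"
      by (intro sum.cong refl) simp
    also have "\<dots> = (mtrace (Q x * \<rho>) * ?t x k us vs) * (\<Sum>i<d. ?f i i) ^ (M - k)"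
      unfolding sum_distrib_left[symmetric] sum_prod_list_diag ..
    also have "(\<Sum>i<d. ?f i i) = 1"
      using mtrace_reduced_state[OF d, of x] reduced_state_carrier[of d x] by (simp add: mtrace_def)
    finally show "(\<Sum>ls\<in>words {..<d} (M - k). mtrace (Q x * \<rho>) * ?t x M (us @ ls) (vs @ ls))
        = mtrace (Q x * \<rho>) * ?t x k us vs" by simp
  qed
  finally show ?thesis .
qed

end

section \<open>Both marginal channels on a fixed pure input entangled with an ancilla\<close>

locale measure_prepare_input = measure_prepare +
  fixes n :: nat and \<phi> :: "nat \<Rightarrow> complex"
  assumes normalized: "(\<Sum>i<n * din. (cmod (\<phi> i))\<^sup>2) = 1"
begin

abbreviation "prep \<equiv> \<lambda>\<rho>. ptrace d M k (meas_prep d M \<mu> Q (reduced_state d) \<rho>)"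
abbreviation "marg \<equiv> \<lambda>\<rho>. ptrace d M k (\<E> \<rho>)"

definition X :: "complex mat" where
  "X = mat (n * din) (n * din) (\<lambda>(i, j). \<phi> i * cnj (\<phi> j))"

definition block :: "nat \<Rightarrow> nat \<Rightarrow> complex mat" where
  "block \<alpha> \<beta> = mat din din (\<lambda>(p, q). \<phi> (\<alpha> * din + p) * cnj (\<phi> (\<beta> * din + q)))"

lemma block_carrier [simp]: "block \<alpha> \<beta> \<in> carrier_mat din din"
  by (simp add: block_def)

lemma X_block:
  assumes "\<alpha> < n" "\<beta> < n"
  shows "mat din din (\<lambda>(p, q). X $$ (\<alpha> * din + p, \<beta> * din + q)) = block \<alpha> \<beta>"
  using assms by (intro eq_matI) (auto simp: X_def block_def index_less_mult)

text \<open>For each r and each ancilla index \<alpha>, the input vector contracted with the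
  amplitudes; it stays symmetric, and \<open>G\<close> is its overlap with the tensor power of
  x.\<close>

definition W :: "nat \<Rightarrow> nat \<Rightarrow> (nat \<times> nat) list \<Rightarrow> complex" where
  "W r \<alpha> J = (\<Sum>p<din. \<phi> (\<alpha> * din + p) * w p r J)"

definition G :: "nat \<Rightarrow> nat \<Rightarrow> complex mat \<Rightarrow> complex" where
  "G r \<alpha> x = (\<Sum>J\<in>words (pairs d) M. cnj (word_prod x J) * W r \<alpha> J)"

lemma W_sym: "r < din \<Longrightarrow> symmetric_on (words (pairs d) M) (W r \<alpha>)"
  using w_sym unfolding symmetric_on_def W_def by (intro ballI impI sum.cong refl) (metis lessThan_iff)

lemma G_eq: "G r \<alpha> x = (\<Sum>p<din. \<phi> (\<alpha> * din + p) * amp p r x)"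
  unfolding G_def W_def amp_def sum_distrib_left
  by (subst sum.swap) (simp add: mult_ac)

definition idx :: "nat \<times> nat list \<Rightarrow> nat" where
  "idx z = fst z * d ^ k + word_index d (snd z)"

definition Z :: "(nat \<times> nat list) set" where
  "Z = {..<n} \<times> words {..<d} k"

lemma finite_Z [simp]: "finite Z" by (simp add: Z_def)

lemma idx_less: "z \<in> Z \<Longrightarrow> idx z < n * d ^ k"
  by (auto simp: Z_def idx_def intro!: index_less_mult word_index_less)

lemma sum_idx: "(\<Sum>a<n * d ^ k. f a) = (\<Sum>z\<in>Z. f (idx z))"
  unfolding sum_lessThan_mult sum_word_index by (simp add: Z_def idx_def sum.cartesian_product')

lemma ext_map_idx:
  assumes "z \<in> Z" "z' \<in> Z"
  shows "ext_map n din (d ^ k) \<Phi> X $$ (idx z, idx z')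
    = \<Phi> (block (fst z) (fst z')) $$ (word_index d (snd z), word_index d (snd z'))"
proof -
  have lt: "word_index d (snd z) < d ^ k" "word_index d (snd z') < d ^ k"
    using assms by (auto simp: Z_def word_index_less)
  have D0: "d ^ k \<noteq> 0" using d by simp
  have "idx z div d ^ k = fst z" "idx z' div d ^ k = fst z'"
    "idx z mod d ^ k = word_index d (snd z)" "idx z' mod d ^ k = word_index d (snd z')"
    unfolding idx_def using lt
    by (simp_all only: div_mult_self3[OF D0] div_less add_0_right mod_mult_self3 mod_less)
  then show ?thesis
    unfolding ext_map_def using idx_less[OF assms(1)] idx_less[OF assms(2)] assms
    by (simp add: X_block Z_def mem_Times_iff)
qed

lemma qform_idx:
  "qform (n * d ^ k) T v = (\<Sum>z\<in>Z. \<Sum>z'\<in>Z. cnj (v (idx z)) * T $$ (idx z, idx z') * v (idx z'))"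
  unfolding qform_def sum_idx ..

lemma prep_index:
  assumes z: "z \<in> Z" "z' \<in> Z"
  shows "ext_map n din (d ^ k) prep X $$ (idx z, idx z')
    = (\<Sum>r<din. \<Sum>l\<in>words {..<d} k. integral\<^sup>L \<mu> (\<lambda>x.
        word_prod x (zip (snd z) l) * G r (fst z) x * cnj (word_prod x (zip (snd z') l) * G r (fst z') x)
          / of_real (norm_sq d x ^ k))) / fact M"
proof -
  have us: "snd z \<in> words {..<d} k" "snd z' \<in> words {..<d} k" using z by (auto simp: Z_def)
  let ?h = "\<lambda>r l x. word_prod x (zip (snd z) l) * G r (fst z) x * cnj (word_prod x (zip (snd z') l) * G r (fst z') x)
          / of_real (norm_sq d x ^ k)"
  have eq: "mtrace (Q x * block (fst z) (fst z')) *
      tensor_pow (reduced_state d x) k $$ (word_index d (snd z), word_index d (snd z'))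
     = (\<Sum>r<din. \<Sum>l\<in>words {..<d} k. ?h r l x / fact M)" for x
    unfolding outcome_times_state[OF block_carrier us]
  proof (intro sum.cong refl)
    fix r l
    let ?c = "word_prod x (zip (snd z) l) * cnj (word_prod x (zip (snd z') l)) / (of_real (norm_sq d x ^ k) * fact M)"
    have "(\<Sum>p<din. \<Sum>q<din. (block (fst z) (fst z') $$ (p, q) / fact M) *
        (word_prod x (zip (snd z) l) * amp p r x * cnj (word_prod x (zip (snd z') l) * amp q r x) / of_real (norm_sq d x ^ k)))
      = ?c * (G r (fst z) x * cnj (G r (fst z') x))"
      unfolding G_eq cnj_sum sum_product unfolding sum_distrib_left
      by (intro sum.cong refl) (simp add: block_def mult_ac)
    then show "(\<Sum>p<din. \<Sum>q<din. (block (fst z) (fst z') $$ (p, q) / fact M) *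
        (word_prod x (zip (snd z) l) * amp p r x * cnj (word_prod x (zip (snd z') l) * amp q r x) / of_real (norm_sq d x ^ k)))
      = ?h r l x / fact M" by (simp add: mult_ac)
  qed
  have int: "integrable \<mu> (?h r l)" if "l \<in> words {..<d} k" for r l
    unfolding G_def by (intro integrable_overlap[OF gm] zip_words us that)
  have "ext_map n din (d ^ k) prep X $$ (idx z, idx z')
      = integral\<^sup>L \<mu> (\<lambda>x. \<Sum>r<din. \<Sum>l\<in>words {..<d} k. ?h r l x / fact M)"
    unfolding ext_map_idx[OF z] ptrace_meas_prep[OF block_carrier us] eq ..
  also have "\<dots> = (\<Sum>r<din. integral\<^sup>L \<mu> (\<lambda>x. \<Sum>l\<in>words {..<d} k. ?h r l x / fact M))"
    by (intro Bochner_Integration.integral_sum Bochner_Integration.integrable_sum integrable_divide int)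
  also have "\<dots> = (\<Sum>r<din. \<Sum>l\<in>words {..<d} k. integral\<^sup>L \<mu> (\<lambda>x. ?h r l x / fact M))"
    by (rule sum.cong[OF refl]) (intro Bochner_Integration.integral_sum integrable_divide int)
  finally show ?thesis by (simp only: integral_divide_zero sum_divide_distrib)
qed

text \<open>The K-word of length M splits into l, the partners of the kept factors, and a rest that
  pairs with the traced H-word into a word L over pairs. So L labels discarded pairs and fits the
  shape of \<open>overlap_bound\<close>.\<close>

lemma marg_index:
  assumes z: "z \<in> Z" "z' \<in> Z"
  shows "ext_map n din (d ^ k) marg X $$ (idx z, idx z')
    = (\<Sum>r<din. \<Sum>l\<in>words {..<d} k. \<Sum>L\<in>words (pairs d) (M - k).
        W r (fst z) (zip (snd z) l @ L) * cnj (W r (fst z') (zip (snd z') l @ L)))"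
proof -
  have us: "snd z \<in> words {..<d} k" "snd z' \<in> words {..<d} k" using z by (auto simp: Z_def)
  have len: "length (snd z) = k" "length (snd z') = k" using us by (auto simp: words_def)
  let ?h = "\<lambda>r ls ms. W r (fst z) (zip (snd z @ ls) ms) * cnj (W r (fst z') (zip (snd z' @ ls) ms))"
  have "ext_map n din (d ^ k) marg X $$ (idx z, idx z')
      = (\<Sum>ls\<in>words {..<d} (M - k). \<Sum>r<din. \<Sum>ms\<in>words {..<d} M. ?h r ls ms)"
    unfolding ext_map_idx[OF z] ptrace_index[OF us]
  proof (rule sum.cong[OF refl])
    fix ls assume ls: "ls \<in> words {..<d} (M - k)"
    let ?w = "\<lambda>p r ms. w p r (zip (snd z @ ls) ms)" and ?w' = "\<lambda>p r ms. w p r (zip (snd z' @ ls) ms)"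
    have "\<E> (block (fst z) (fst z')) $$ (word_index d (snd z @ ls), word_index d (snd z' @ ls))
       = (\<Sum>p<din. \<Sum>q<din. \<Sum>r<din. \<Sum>ms\<in>words {..<d} M.
           (\<phi> (fst z * din + p) * ?w p r ms) * cnj (\<phi> (fst z' * din + q) * ?w' q r ms))"
      unfolding \<E>_eq[OF block_carrier append_words[OF us(1) ls] append_words[OF us(2) ls]] sum_distrib_left
      by (intro sum.cong refl) (simp add: block_def mult_ac)
    also have "\<dots> = (\<Sum>p<din. \<Sum>r<din. \<Sum>q<din. \<Sum>ms\<in>words {..<d} M.
           (\<phi> (fst z * din + p) * ?w p r ms) * cnj (\<phi> (fst z' * din + q) * ?w' q r ms))"
      by (rule sum.cong[OF refl]) (rule sum.swap)
    also have "\<dots> = (\<Sum>r<din. \<Sum>p<din. \<Sum>q<din. \<Sum>ms\<in>words {..<d} M.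
           (\<phi> (fst z * din + p) * ?w p r ms) * cnj (\<phi> (fst z' * din + q) * ?w' q r ms))"
      by (rule sum.swap)
    also have "\<dots> = (\<Sum>r<din. \<Sum>p<din. \<Sum>ms\<in>words {..<d} M. \<Sum>q<din.
           (\<phi> (fst z * din + p) * ?w p r ms) * cnj (\<phi> (fst z' * din + q) * ?w' q r ms))"
      by (rule sum.cong[OF refl], rule sum.cong[OF refl]) (rule sum.swap)
    also have "\<dots> = (\<Sum>r<din. \<Sum>ms\<in>words {..<d} M. \<Sum>p<din. \<Sum>q<din.
           (\<phi> (fst z * din + p) * ?w p r ms) * cnj (\<phi> (fst z' * din + q) * ?w' q r ms))"
      by (rule sum.cong[OF refl]) (rule sum.swap)
    finally show "\<E> (block (fst z) (fst z')) $$ (word_index d (snd z @ ls), word_index d (snd z' @ ls))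
        = (\<Sum>r<din. \<Sum>ms\<in>words {..<d} M. ?h r ls ms)"
      unfolding W_def cnj_sum sum_product .
  qed
  also have "\<dots> = (\<Sum>r<din. \<Sum>ls\<in>words {..<d} (M - k). \<Sum>ms\<in>words {..<d} (k + (M - k)). ?h r ls ms)"
    using k by (subst sum.swap) simp
  also have "\<dots> = (\<Sum>r<din. \<Sum>ls\<in>words {..<d} (M - k). \<Sum>l\<in>words {..<d} k. \<Sum>m\<in>words {..<d} (M - k). ?h r ls (l @ m))"
    unfolding sum_words_append ..
  also have "\<dots> = (\<Sum>r<din. \<Sum>l\<in>words {..<d} k. \<Sum>ls\<in>words {..<d} (M - k). \<Sum>m\<in>words {..<d} (M - k). ?h r ls (l @ m))"
    by (rule sum.cong[OF refl]) (rule sum.swap)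
  also have "\<dots> = (\<Sum>r<din. \<Sum>l\<in>words {..<d} k. \<Sum>ls\<in>words {..<d} (M - k). \<Sum>m\<in>words {..<d} (M - k).
      W r (fst z) (zip (snd z) l @ zip ls m) * cnj (W r (fst z') (zip (snd z') l @ zip ls m)))"
    by (intro sum.cong refl) (simp add: words_def len)
  finally show ?thesis unfolding sum_words_pairs .
qed

text \<open>For a test vector v and fixed indices r and l, \<open>overlap\<close> is the
  \<open>b\<close> and \<open>slice\<close> the \<open>u\<close> of \<open>overlap_bound\<close>,
  the coefficients \<open>y\<close> being the conjugates of v.\<close>

definition overlap :: "(nat \<Rightarrow> complex) \<Rightarrow> nat \<Rightarrow> nat list \<Rightarrow> complex mat \<Rightarrow> complex" where
  "overlap v r l x = (\<Sum>z\<in>Z. cnj (v (idx z)) * word_prod x (zip (snd z) l) * G r (fst z) x)"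

definition slice :: "(nat \<Rightarrow> complex) \<Rightarrow> nat \<Rightarrow> nat list \<Rightarrow> (nat \<times> nat) list \<Rightarrow> complex" where
  "slice v r l L = (\<Sum>z\<in>Z. cnj (v (idx z)) * W r (fst z) (zip (snd z) l @ L))"

text \<open>As for any Gram matrix, there is one squared modulus for each index (r, l, L) that is
  summed out.\<close>

lemma qform_marg:
  "qform (n * d ^ k) (ext_map n din (d ^ k) marg X) v
    = of_real (\<Sum>r<din. \<Sum>l\<in>words {..<d} k. \<Sum>L\<in>words (pairs d) (M - k). (cmod (slice v r l L))\<^sup>2)"
proof -
  define F where "F = {..<din} \<times> words {..<d} k \<times> words (pairs d) (M - k)"
  define h where "h = (\<lambda>(r, l, L) z. W r (fst z) (zip (snd z) l @ L))"
  have "qform (n * d ^ k) (ext_map n din (d ^ k) marg X) v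
      = (\<Sum>z\<in>Z. \<Sum>z'\<in>Z. \<Sum>e\<in>F. (cnj (v (idx z)) * h e z) * cnj (cnj (v (idx z')) * h e z'))"
    unfolding qform_idx F_def h_def
    by (intro sum.cong refl)
      (simp add: marg_index sum_distrib_left sum_distrib_right sum.cartesian_product' mult_ac)
  also have "\<dots> = (\<Sum>z\<in>Z. \<Sum>e\<in>F. \<Sum>z'\<in>Z. (cnj (v (idx z)) * h e z) * cnj (cnj (v (idx z')) * h e z'))"
    by (rule sum.cong[OF refl]) (rule sum.swap)
  also have "\<dots> = (\<Sum>e\<in>F. \<Sum>z\<in>Z. \<Sum>z'\<in>Z. (cnj (v (idx z)) * h e z) * cnj (cnj (v (idx z')) * h e z'))"
    by (rule sum.swap)
  also have "\<dots> = of_real (\<Sum>e\<in>F. (cmod (\<Sum>z\<in>Z. cnj (v (idx z)) * h e z))\<^sup>2)"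
    unfolding of_real_sum complex_norm_square cnj_sum sum_product ..
  finally show ?thesis by (simp add: F_def h_def slice_def sum.cartesian_product')
qed

lemma qform_prep:
  "qform (n * d ^ k) (ext_map n din (d ^ k) prep X) v
    = of_real ((\<Sum>r<din. \<Sum>l\<in>words {..<d} k. integral\<^sup>L \<mu> (\<lambda>x. (cmod (overlap v r l x))\<^sup>2 / norm_sq d x ^ k)) / fact M)"
proof -
  define F where "F = {..<din} \<times> words {..<d} k"
  define h where "h = (\<lambda>(r, l) z x. word_prod x (zip (snd z) l) * G r (fst z) x)"
  have int: "integrable \<mu> (\<lambda>x. h e z x * cnj (h e z' x) / of_real (norm_sq d x ^ k))"
    if "e \<in> F" "z \<in> Z" "z' \<in> Z" for e z z'
  proof -
    obtain r l where e: "e = (r, l)" by (cases e)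
    have "l \<in> words {..<d} k" "snd z \<in> words {..<d} k" "snd z' \<in> words {..<d} k"
      using that e by (auto simp: F_def Z_def)
    then show ?thesis
      unfolding e h_def G_def split by (intro integrable_overlap[OF gm] zip_words)
  qed
  have "qform (n * d ^ k) (ext_map n din (d ^ k) prep X) v
      = (\<Sum>z\<in>Z. \<Sum>z'\<in>Z. \<Sum>e\<in>F. (cnj (v (idx z)) * v (idx z')) *
          integral\<^sup>L \<mu> (\<lambda>x. h e z x * cnj (h e z' x) / of_real (norm_sq d x ^ k)) / fact M)"
    unfolding qform_idx F_def h_def
    by (intro sum.cong refl)
      (simp add: prep_index sum_distrib_left sum_distrib_right sum_divide_distrib sum.cartesian_product' mult_ac)
  also have "\<dots> = (\<Sum>z\<in>Z. \<Sum>e\<in>F. \<Sum>z'\<in>Z. (cnj (v (idx z)) * v (idx z')) *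
          integral\<^sup>L \<mu> (\<lambda>x. h e z x * cnj (h e z' x) / of_real (norm_sq d x ^ k)) / fact M)"
    by (rule sum.cong[OF refl]) (rule sum.swap)
  also have "\<dots> = (\<Sum>e\<in>F. \<Sum>z\<in>Z. \<Sum>z'\<in>Z. (cnj (v (idx z)) * v (idx z')) *
          integral\<^sup>L \<mu> (\<lambda>x. h e z x * cnj (h e z' x) / of_real (norm_sq d x ^ k)) / fact M)"
    by (rule sum.swap)
  also have "\<dots> = (\<Sum>e\<in>F. of_real (integral\<^sup>L \<mu> (\<lambda>x.
      (cmod (\<Sum>z\<in>Z. cnj (v (idx z)) * h e z x))\<^sup>2 / norm_sq d x ^ k)) / fact M)"
  proof (rule sum.cong[OF refl])
    fix e assume e: "e \<in> F"
    have "complex_of_real ((cmod (\<Sum>z\<in>Z. cnj (v (idx z)) * h e z x))\<^sup>2 / norm_sq d x ^ k)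
        = (\<Sum>z\<in>Z. \<Sum>z'\<in>Z. (cnj (v (idx z)) * v (idx z')) * (h e z x * cnj (h e z' x) / of_real (norm_sq d x ^ k)))" for x
      unfolding of_real_divide complex_norm_square cnj_sum sum_product sum_divide_distrib
      by (intro sum.cong refl) (simp add: mult_ac)
    then have "complex_of_real (integral\<^sup>L \<mu> (\<lambda>x. (cmod (\<Sum>z\<in>Z. cnj (v (idx z)) * h e z x))\<^sup>2 / norm_sq d x ^ k))
        = integral\<^sup>L \<mu> (\<lambda>x. \<Sum>z\<in>Z. \<Sum>z'\<in>Z. (cnj (v (idx z)) * v (idx z')) *
            (h e z x * cnj (h e z' x) / of_real (norm_sq d x ^ k)))"
      unfolding integral_complex_of_real[symmetric] by simp
    also have "\<dots> = (\<Sum>z\<in>Z. integral\<^sup>L \<mu> (\<lambda>x. \<Sum>z'\<in>Z. (cnj (v (idx z)) * v (idx z')) *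
            (h e z x * cnj (h e z' x) / of_real (norm_sq d x ^ k))))"
      by (intro Bochner_Integration.integral_sum Bochner_Integration.integrable_sum integrable_mult_right int e)
    also have "\<dots> = (\<Sum>z\<in>Z. \<Sum>z'\<in>Z. integral\<^sup>L \<mu> (\<lambda>x. (cnj (v (idx z)) * v (idx z')) *
            (h e z x * cnj (h e z' x) / of_real (norm_sq d x ^ k))))"
      by (rule sum.cong[OF refl]) (intro Bochner_Integration.integral_sum integrable_mult_right int e)
    finally show "(\<Sum>z\<in>Z. \<Sum>z'\<in>Z. (cnj (v (idx z)) * v (idx z')) *
          integral\<^sup>L \<mu> (\<lambda>x. h e z x * cnj (h e z' x) / of_real (norm_sq d x ^ k)) / fact M)
        = of_real (integral\<^sup>L \<mu> (\<lambda>x. (cmod (\<Sum>z\<in>Z. cnj (v (idx z)) * h e z x))\<^sup>2 / norm_sq d x ^ k)) / fact M"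
      unfolding integral_mult_right_zero by (simp add: sum_divide_distrib)
  qed
  also have "\<dots> = of_real ((\<Sum>e\<in>F. integral\<^sup>L \<mu> (\<lambda>x.
      (cmod (\<Sum>z\<in>Z. cnj (v (idx z)) * h e z x))\<^sup>2 / norm_sq d x ^ k)) / fact M)"
    by (simp add: sum_divide_distrib)
  finally show ?thesis by (simp add: F_def h_def overlap_def sum.cartesian_product' mult.assoc)
qed

section \<open>Comparison of the two marginals and the trace norm of their difference\<close>

definition t :: real where "t = Dplus d (M - k) / Dplus d M"

lemma t_pos: "0 < t"
  using Dplus_pos[OF d] by (simp add: t_def)

lemma t_le_1: "sqrt t \<le> 1"
proof -
  have "Dplus d (M - k) \<le> Dplus d M" by (rule Dplus_mono[OF d]) simp
  then show ?thesis using Dplus_pos[OF d] by (simp add: t_def)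
qed

text \<open>\<open>overlap_bound\<close> at s = 1 / sqrt t, multiplied by t: as t s = sqrt t and t
  s^2 = 1, the coefficient 2 s - s^2 becomes 2 sqrt t - 1.\<close>

lemma overlap_slice_bound:
  assumes r: "r < din" and l: "l \<in> words {..<d} k"
  shows "(2 * sqrt t - 1) * (\<Sum>L\<in>words (pairs d) (M - k). (cmod (slice v r l L))\<^sup>2)
    \<le> integral\<^sup>L \<mu> (\<lambda>x. (cmod (overlap v r l x))\<^sup>2 / norm_sq d x ^ k) / fact M"
proof -
  define s where "s = 1 / sqrt t"
  have s: "s\<^sup>2 * fact M = fact (M - k) * pochhammer (real (d\<^sup>2 + (M - k))) k"
    unfolding s_def t_def by (rule Dplus_ratio[OF d k])
  let ?R = "\<Sum>L\<in>words (pairs d) (M - k). (cmod (slice v r l L))\<^sup>2"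
  let ?I = "integral\<^sup>L \<mu> (\<lambda>x. (cmod (overlap v r l x))\<^sup>2 / norm_sq d x ^ k)"
  have "(2 * s - s\<^sup>2) * fact M * ?R \<le> s\<^sup>2 * ?I"
    unfolding slice_def overlap_def G_def
    by (rule overlap_bound(2)[OF gm finite_Z k _ _ s])
      (use l W_sym[OF r] in \<open>auto simp: Z_def intro!: zip_words\<close>)
  moreover have "s\<^sup>2 = 1 / t" "t * s = sqrt t"
    using t_pos by (auto simp: s_def power_divide real_div_sqrt)
  ultimately have "t * ((2 * s - 1 / t) * fact M * ?R) \<le> t * (1 / t * ?I)"
    using t_pos by (intro mult_left_mono) auto
  moreover have "t * ((2 * s - 1 / t) * fact M * ?R) = (2 * (t * s) - 1) * fact M * ?R"
    using t_pos by (simp add: field_simps)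
  ultimately have "(2 * sqrt t - 1) * fact M * ?R \<le> ?I"
    using t_pos \<open>t * s = sqrt t\<close> by simp
  then show ?thesis by (simp add: field_simps)
qed

lemma ext_map_carrier [simp]: "ext_map n din D \<Phi> Y \<in> carrier_mat (n * D) (n * D)"
  by (simp add: ext_map_def)

lemma psd_marg: "psd (n * d ^ k) (ext_map n din (d ^ k) marg X)"
  unfolding psd_iff_qform by (auto simp: qform_marg less_eq_complex_def intro!: sum_nonneg)

lemma psd_prep_minus_marg:
  "psd (n * d ^ k) (ext_map n din (d ^ k) prep X - of_real (2 * sqrt t - 1) \<cdot>\<^sub>m ext_map n din (d ^ k) marg X)"
  unfolding psd_iff_qform
proof (intro conjI allI)
  fix v
  define s where "s r l = (\<Sum>L\<in>words (pairs d) (M - k). (cmod (slice v r l L))\<^sup>2)" for r l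
  let ?o = "\<lambda>r l. integral\<^sup>L \<mu> (\<lambda>x. (cmod (overlap v r l x))\<^sup>2 / norm_sq d x ^ k)"
  have "(2 * sqrt t - 1) * (\<Sum>r<din. \<Sum>l\<in>words {..<d} k. s r l) \<le> (\<Sum>r<din. \<Sum>l\<in>words {..<d} k. ?o r l) / fact M"
    unfolding sum_distrib_left sum_divide_distrib
    by (intro sum_mono overlap_slice_bound[of _ _ v, folded s_def]) auto
  then show "0 \<le> qform (n * d ^ k)
      (ext_map n din (d ^ k) prep X - of_real (2 * sqrt t - 1) \<cdot>\<^sub>m ext_map n din (d ^ k) marg X) v"
    unfolding qform_minus[OF ext_map_carrier smult_carrier_mat[OF ext_map_carrier]]
      qform_smult[OF ext_map_carrier] qform_marg qform_prep s_def of_real_mult[symmetric] of_real_diff[symmetric]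
    by (simp add: less_eq_complex_def del: of_real_mult of_real_diff of_real_divide of_real_sum)
qed (intro minus_carrier_mat smult_carrier_mat ext_map_carrier)

lemma sum_mtrace_block: "(\<Sum>\<alpha><n. mtrace (block \<alpha> \<alpha>)) = 1"
proof -
  have "(\<Sum>\<alpha><n. mtrace (block \<alpha> \<alpha>)) = (\<Sum>\<alpha><n. \<Sum>p<din. complex_of_real ((cmod (\<phi> (\<alpha> * din + p)))\<^sup>2))"
    unfolding complex_norm_square by (simp add: mtrace_def block_def)
  also have "\<dots> = complex_of_real (\<Sum>i<n * din. (cmod (\<phi> i))\<^sup>2)"
    unfolding sum_lessThan_mult by simp
  finally show ?thesis using normalized by simp
qed

lemma mtrace_ext_map:
  "mtrace (ext_map n din (d ^ k) \<Phi> X)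
    = (\<Sum>\<alpha><n. \<Sum>us\<in>words {..<d} k. \<Phi> (block \<alpha> \<alpha>) $$ (word_index d us, word_index d us))"
proof -
  have "mtrace (ext_map n din (d ^ k) \<Phi> X) = (\<Sum>z\<in>Z. ext_map n din (d ^ k) \<Phi> X $$ (idx z, idx z))"
    unfolding mtrace_def carrier_matD(1)[OF ext_map_carrier] sum_idx ..
  also have "\<dots> = (\<Sum>z\<in>Z. \<Phi> (block (fst z) (fst z)) $$ (word_index d (snd z), word_index d (snd z)))"
    by (intro sum.cong refl) (simp add: ext_map_idx)
  finally show ?thesis by (simp add: Z_def sum.cartesian_product')
qed

lemma mtrace_marg: "mtrace (ext_map n din (d ^ k) marg X) = 1"
proof -
  have "(\<Sum>us\<in>words {..<d} k. marg (block \<alpha> \<alpha>) $$ (word_index d us, word_index d us)) = mtrace (block \<alpha> \<alpha>)" for \<alpha>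
  proof -
    have "(\<Sum>us\<in>words {..<d} k. marg (block \<alpha> \<alpha>) $$ (word_index d us, word_index d us))
        = (\<Sum>us\<in>words {..<d} (k + (M - k)). \<E> (block \<alpha> \<alpha>) $$ (word_index d us, word_index d us))"
      unfolding sum_words_append by (intro sum.cong refl) (simp add: ptrace_index)
    also have "\<dots> = mtrace (\<E> (block \<alpha> \<alpha>))"
      using k \<E>_carrier[OF block_carrier, of \<alpha> \<alpha>] by (simp add: mtrace_def sum_word_index)
    finally show ?thesis by (simp add: \<E>_trace)
  qed
  then show ?thesis unfolding mtrace_ext_map by (simp add: sum_mtrace_block)
qed

text \<open>The prepared state has trace one for every outcome, and by the resolution of the
  identity the outcome densities integrate to the trace of the block.\<close>

lemma mtrace_prep: "mtrace (ext_map n din (d ^ k) prep X) = 1"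
proof -
  have "(\<Sum>us\<in>words {..<d} k. prep (block \<alpha> \<alpha>) $$ (word_index d us, word_index d us)) = mtrace (block \<alpha> \<alpha>)" for \<alpha>
  proof -
    let ?t = "\<lambda>x us. tensor_pow (reduced_state d x) k $$ (word_index d us, word_index d us)"
    let ?B = "block \<alpha> \<alpha>"
    have "(\<Sum>us\<in>words {..<d} k. prep ?B $$ (word_index d us, word_index d us))
        = (\<Sum>us\<in>words {..<d} k. integral\<^sup>L \<mu> (\<lambda>x. mtrace (Q x * ?B) * ?t x us))"
      by (intro sum.cong refl) (simp add: ptrace_meas_prep)
    also have "\<dots> = integral\<^sup>L \<mu> (\<lambda>x. \<Sum>us\<in>words {..<d} k. mtrace (Q x * ?B) * ?t x us)"
      by (rule Bochner_Integration.integral_sum[symmetric]) (intro integrable_outcome_times_state block_carrier)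
    also have "\<dots> = integral\<^sup>L \<mu> (\<lambda>x. mtrace (Q x * ?B))"
    proof (rule Bochner_Integration.integral_cong[OF refl])
      fix x
      have "(\<Sum>us\<in>words {..<d} k. ?t x us) = (\<Sum>i<d. reduced_state d x $$ (i, i)) ^ k"
      proof -
        have "(\<Sum>us\<in>words {..<d} k. ?t x us)
            = (\<Sum>us\<in>words {..<d} k. prod_list (map2 (\<lambda>i j. reduced_state d x $$ (i, j)) us us))"
          by (intro sum.cong refl tensor_pow_index reduced_state_carrier)
        also have "\<dots> = (\<Sum>i<d. reduced_state d x $$ (i, i)) ^ k" by (rule sum_prod_list_diag)
        finally show ?thesis .
      qed
      also have "(\<Sum>i<d. reduced_state d x $$ (i, i)) = 1"
        using mtrace_reduced_state[OF d, of x] reduced_state_carrier[of d x] by (simp add: mtrace_def)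
      finally show "(\<Sum>us\<in>words {..<d} k. mtrace (Q x * ?B) * ?t x us) = mtrace (Q x * ?B)"
        unfolding sum_distrib_left[symmetric] by simp
    qed
    also have "\<dots> = integral\<^sup>L \<mu> (\<lambda>x. \<Sum>q<din. \<Sum>p<din. Q x $$ (q, p) * ?B $$ (p, q))"
    proof (rule Bochner_Integration.integral_cong[OF refl])
      fix x
      have "dim_row (Q x * ?B) = din" by (simp add: Q_def)
      then show "mtrace (Q x * ?B) = (\<Sum>q<din. \<Sum>p<din. Q x $$ (q, p) * ?B $$ (p, q))"
        unfolding mtrace_def by (intro sum.cong) (auto simp only: mult_index[OF Q_carrier block_carrier] lessThan_iff)
    qed
    also have "\<dots> = (\<Sum>q<din. \<Sum>p<din. (if p = q then 1 else 0) * ?B $$ (p, q))"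
      by (intro has_bochner_integral_integral_eq has_bochner_integral_sum has_bochner_integral_mult_left Q_moment) auto
    also have "\<dots> = (\<Sum>q<din. \<Sum>p<din. if p = q then ?B $$ (q, q) else 0)"
      by (intro sum.cong refl) auto
    also have "\<dots> = mtrace ?B"
      by (simp add: mtrace_def block_def)
    finally show ?thesis .
  qed
  then show ?thesis unfolding mtrace_ext_map by (simp add: sum_mtrace_block)
qed

lemma trace_norm_bound:
  "trace_norm (ext_map n din (d ^ k) (\<lambda>\<rho>. prep \<rho> - marg \<rho>) X) \<le> 4 * (1 - sqrt t)"
proof -
  let ?T1 = "ext_map n din (d ^ k) prep X" and ?T2 = "ext_map n din (d ^ k) marg X"
  \<comment> \<open>Subtracting the multiple 2 sqrt t - 1 of \<open>?T2\<close> leaves a positive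
    operator; \<open>?N\<close> is what is then missing to the full difference and is positive
    because t \<le> 1.\<close>
  let ?P = "?T1 - of_real (2 * sqrt t - 1) \<cdot>\<^sub>m ?T2" and ?N = "of_real (2 * (1 - sqrt t)) \<cdot>\<^sub>m ?T2"
  have "ext_map n din (d ^ k) (\<lambda>\<rho>. prep \<rho> - marg \<rho>) X = ?P - ?N"
  proof (rule eq_matI)
    fix i j assume "i < dim_row (?P - ?N)" "j < dim_col (?P - ?N)"
    then have ij: "i < n * d ^ k" "j < n * d ^ k" by (auto simp: ext_map_def)
    have D: "d ^ k > 0" using d by simp
    then have m: "i mod d ^ k < d ^ k" "j mod d ^ k < d ^ k" by auto
    have "ext_map n din (d ^ k) (\<lambda>\<rho>. prep \<rho> - marg \<rho>) X $$ (i, j) = ?T1 $$ (i, j) - ?T2 $$ (i, j)"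
      using ij m by (simp add: ext_map_def) (simp add: ptrace_def)
    also have "\<dots> = (?P - ?N) $$ (i, j)"
      using ij by (simp add: carrier_matD[OF ext_map_carrier] algebra_simps)
    finally show "ext_map n din (d ^ k) (\<lambda>\<rho>. prep \<rho> - marg \<rho>) X $$ (i, j) = (?P - ?N) $$ (i, j)" .
  qed (auto simp: ext_map_def)
  moreover have N: "psd (n * d ^ k) ?N"
    using psd_marg t_le_1 unfolding psd_iff_qform
    by (auto simp: qform_smult[OF ext_map_carrier] qform_marg less_eq_complex_def intro!: mult_nonneg_nonneg sum_nonneg
        simp flip: of_real_mult)
  ultimately have "trace_norm (ext_map n din (d ^ k) (\<lambda>\<rho>. prep \<rho> - marg \<rho>) X) \<le> Re (mtrace ?P) + Re (mtrace ?N)"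
    using trace_norm_minus_le[OF psd_prep_minus_marg N] by simp
  moreover have "mtrace ?P = mtrace ?T1 - of_real (2 * sqrt t - 1) * mtrace ?T2"
    by (simp add: mtrace_def carrier_matD[OF ext_map_carrier] sum_subtractf sum_distrib_left)
  moreover have "mtrace ?N = of_real (2 * (1 - sqrt t)) * mtrace ?T2"
    by (simp add: mtrace_def carrier_matD[OF ext_map_carrier] sum_distrib_left)
  ultimately show ?thesis
    unfolding mtrace_prep mtrace_marg by simp
qed

end

theorem theorem5:
  fixes din d M k :: nat and \<E> :: "complex mat \<Rightarrow> complex mat"
  assumes "d \<ge> 2" and "1 \<le> k" and "k \<le> M"
    and "sym_broadcast din d M \<E>"
  shows "\<exists>(\<mu> :: complex mat measure) Q \<sigma>.
     povm din \<mu> Q \<and>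
     (\<forall>x \<in> space \<mu>. density_op d (\<sigma> x)) \<and>
     (\<forall>i<d. \<forall>j<d. (\<lambda>x. \<sigma> x $$ (i,j)) \<in> borel_measurable \<mu>) \<and>
     diamond_norm din (d ^ k)
        (\<lambda>\<rho>. ptrace d M k (meas_prep d M \<mu> Q \<sigma> \<rho>) - ptrace d M k (\<E> \<rho>))
       \<le> 4 * (1 - sqrt (Dplus d (M - k) / Dplus d M)) \<and>
     4 * (1 - sqrt (Dplus d (M - k) / Dplus d M)) \<le> 2 * real k * real d ^ 2 / real M"
proof -
  have d: "0 < d" using assms(1) by simp
  obtain \<mu> where \<mu>: "gaussian_moments d M \<mu>" using gaussian_moments_exist by blast
  obtain w where w: "\<And>p r. p < din \<Longrightarrow> r < din \<Longrightarrow> symmetric_on (words (pairs d) M) (w p r)"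
    "\<And>\<rho> us vs. \<rho> \<in> carrier_mat din din \<Longrightarrow> us \<in> words {..<d} M \<Longrightarrow> vs \<in> words {..<d} M \<Longrightarrow>
       \<E> \<rho> $$ (word_index d us, word_index d vs) = (\<Sum>p<din. \<Sum>q<din. \<rho> $$ (p, q) *
         (\<Sum>r<din. \<Sum>ls\<in>words {..<d} M. w p r (zip us ls) * cnj (w q r (zip vs ls))))"
    using symmetric_purification[OF d assms(4)] by blast
  interpret mp: measure_prepare din d M k \<E> w \<mu>
    using d assms \<mu> w
    by unfold_locales (auto simp: sym_broadcast_def channel_def Defs.linear_map_def)
  have "diamond_norm din (d ^ k)
        (\<lambda>\<rho>. ptrace d M k (meas_prep d M \<mu> mp.Q (reduced_state d) \<rho>) - ptrace d M k (\<E> \<rho>))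
       \<le> 4 * (1 - sqrt (Dplus d (M - k) / Dplus d M))" (is "_ \<le> ?c")
    unfolding diamond_norm_def
  proof (rule cSup_least)
    \<comment> \<open>The value 0 that \<open>diamond_norm\<close> inserts into the supremum is
      covered because the bound itself is nonnegative.\<close>
    have "Dplus d (M - k) \<le> Dplus d M" by (rule Dplus_mono[OF d]) simp
    then have c0: "0 \<le> ?c" using Dplus_pos[OF d, of M] by simp
    fix y assume "y \<in> insert 0 {trace_norm (ext_map n din (d ^ k)
        (\<lambda>\<rho>. ptrace d M k (meas_prep d M \<mu> mp.Q (reduced_state d) \<rho>) - ptrace d M k (\<E> \<rho>))
        (mat (n * din) (n * din) (\<lambda>(i, j). vec_index \<psi> i * cnj (vec_index \<psi> j)))) | n \<psi>.
        \<psi> \<in> carrier_vec (n * din) \<and> (\<Sum>i<n * din. (cmod (vec_index \<psi> i))\<^sup>2) = 1}"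
    then consider "y = 0" | n \<psi> where "(\<Sum>i<n * din. (cmod (vec_index \<psi> i))\<^sup>2) = 1"
        "y = trace_norm (ext_map n din (d ^ k)
        (\<lambda>\<rho>. ptrace d M k (meas_prep d M \<mu> mp.Q (reduced_state d) \<rho>) - ptrace d M k (\<E> \<rho>))
        (mat (n * din) (n * din) (\<lambda>(i, j). vec_index \<psi> i * cnj (vec_index \<psi> j))))"
      by blast
    then show "y \<le> ?c"
    proof cases
      case 1
      then show ?thesis using c0 by simp
    next
      case (2 n \<psi>)
      interpret mpi: measure_prepare_input din d M k \<E> w \<mu> n "vec_index \<psi>"
        by unfold_locales (rule 2(1))
      show ?thesis unfolding 2(2) using mpi.trace_norm_bound unfolding mpi.X_def mpi.t_def .
    qed
  qed simp
  then show ?thesis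
    using mp.povm_Q density_reduced_state[OF d] mp.measurable_reduced_state
      Dplus_ratio_bound[OF assms(1,2,3)] by blast
qed

end
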